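(* Let $a,b,c,\alpha,W>0$, and let $(H_\tau)_{\tau\in\mathbb{R}}$ be the exponentially attenuated Ornstein-Uhlenbeck channel with parameters $a,b,c$ (defined in the context). Let $\hat H_f=\int_{-\infty}^{\infty}e^{-j2\pi f\tau}H_\tau\,d\tau$, and let $$C=E\left[\int_{-W/2}^{W/2}\log_2\bigl(1+\alpha|\hat H_f|^2\bigr)\,df\right]$$ be its ergodic capacity. Put $\beta_1=\dfrac{2\pi^2}{\alpha c(a+b)}$, $\beta_2=\dfrac{(a+b)^2}{4\pi^2}$, $\hat\sigma^2(f)=\dfrac{c(a+b)}{(a+b)^2+(2\pi f)^2}$, and for $\theta\in\mathbb{R}$ $$C_\theta=W\log_2\bigl(1+2e^{-\theta}\alpha\hat\sigma^2(W/2)\bigr)-\frac{4\sqrt{\beta_2}}{\ln 2}\arctan\left(\frac{W/2}{\sqrt{\beta_2}}\right)+\frac{4\sqrt{\beta_2+e^{-\theta}/\beta_1}}{\ln 2}\arctan\left(\frac{W/2}{\sqrt{\beta_2+e^{-\theta}/\beta_1}}\right).$$ Then $C_\gamma\le C\le C_0$, where $\gamma$ is the Euler(-Mascheroni) constant.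
   Context: Exponentially attenuated Ornstein-Uhlenbeck channel: $H_\tau=X_\tau+jY_\tau$ ($j$ the imaginary unit), where $(X_\tau)_{\tau\in\mathbb{R}}$, $(Y_\tau)_{\tau\in\mathbb{R}}$ are independent real Gaussian processes with zero mean and common covariance function $$R(\tau,\tau')=c\,e^{-a|\tau-\tau'|}\,b\,e^{-b(\tau+\tau')}\,\mathbf 1_{[0,\infty)}(\tau)\,\mathbf 1_{[0,\infty)}(\tau'),\qquad \tau,\tau'\in\mathbb{R}.$$ Equivalently, $X_\tau=\tilde X_\tau g(\tau)$ and $Y_\tau=\tilde Y_\tau g(\tau)$ with $\tilde X,\tilde Y$ independent stationary Ornstein-Uhlenbeck processes with covariance $e^{-a|\tau-\tau'|}$ and $g(\tau)=\sqrt{bc}\,e^{-b\tau}\mathbf 1_{[0,\infty)}(\tau)$. Integrals of random processes are stochastic Riemann integrals, i.e. mean-square limits of Riemann sums (with a further mean-square limit for infinite integration bounds). *)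

theory Defs
  imports "HOL-Probability.Probability"
begin

section \<open>Mean-square calculus\<close>

definition second_order ::
    "'a measure \<Rightarrow> ('a \<Rightarrow> 'b::{real_normed_vector, second_countable_topology}) \<Rightarrow> bool"
  where "second_order M Z \<longleftrightarrow> Z \<in> borel_measurable M \<and> integrable M (\<lambda>\<omega>. (norm (Z \<omega>))\<^sup>2)"

text \<open>
  The Bochner integral of a non-integrable function is 0; requiring the approximants to be
  second order rules out spurious convergence.
\<close>

definition ms_tendsto ::
    "'a measure \<Rightarrow> ('i \<Rightarrow> 'a \<Rightarrow> 'b::{real_normed_vector, second_countable_topology})
      \<Rightarrow> ('a \<Rightarrow> 'b) \<Rightarrow> 'i filter \<Rightarrow> bool"
  where "ms_tendsto M S L F \<longleftrightarrow>
    second_order M L \<and> (\<forall>\<^sub>F i in F. second_order M (S i)) \<and>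
    ((\<lambda>i. \<integral>\<omega>. (norm (S i \<omega> - L \<omega>))\<^sup>2 \<partial>M) \<longlongrightarrow> 0) F"

text \<open>
  Tagged divisions of \<open>[s, t]\<close> as the mesh tends to 0: the Riemann (constant gauge) counterpart
  of \<^const>\<open>division_filter\<close>.
\<close>

definition riemann_filter :: "real \<Rightarrow> real \<Rightarrow> (real \<times> real set) set filter"
  where "riemann_filter s t =
    (INF \<delta>\<in>{0<..}. principal {p. p tagged_division_of {s..t} \<and> (\<lambda>x. ball x \<delta>) fine p})"

definition has_ms_integral ::
    "'a measure \<Rightarrow> (real \<Rightarrow> 'a \<Rightarrow> 'b::{real_normed_vector, second_countable_topology})
      \<Rightarrow> real \<Rightarrow> real \<Rightarrow> ('a \<Rightarrow> 'b) \<Rightarrow> bool"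
  where "has_ms_integral M Z s t I \<longleftrightarrow>
    ms_tendsto M (\<lambda>p \<omega>. \<Sum>(x, K)\<in>p. measure lborel K *\<^sub>R Z x \<omega>) I (riemann_filter s t)"

definition ms_integral ::
    "'a measure \<Rightarrow> (real \<Rightarrow> 'a \<Rightarrow> 'b::{real_normed_vector, second_countable_topology})
      \<Rightarrow> real \<Rightarrow> real \<Rightarrow> 'a \<Rightarrow> 'b"
  where "ms_integral M Z s t = (SOME I. has_ms_integral M Z s t I)"

definition has_ms_integral_real_line ::
    "'a measure \<Rightarrow> (real \<Rightarrow> 'a \<Rightarrow> 'b::{real_normed_vector, second_countable_topology})
      \<Rightarrow> ('a \<Rightarrow> 'b) \<Rightarrow> bool"
  where "has_ms_integral_real_line M Z I \<longleftrightarrow>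
    (\<exists>J. (\<forall>s t. s \<le> t \<longrightarrow> has_ms_integral M Z s t (J s t)) \<and>
         ms_tendsto M (\<lambda>(s, t). J s t) I (at_bot \<times>\<^sub>F at_top))"

text \<open>
  Mean-square integrals are determined up to almost sure equality, so the choice of version is
  immaterial for expectations.
\<close>

definition ms_integral_real_line ::
    "'a measure \<Rightarrow> (real \<Rightarrow> 'a \<Rightarrow> 'b::{real_normed_vector, second_countable_topology}) \<Rightarrow> 'a \<Rightarrow> 'b"
  where "ms_integral_real_line M Z = (SOME I. has_ms_integral_real_line M Z I)"


section \<open>Gaussian processes\<close>

text \<open>
  Degenerate (almost surely constant) variables count as Gaussian; the channel below vanishes
  almost surely at negative times.
\<close>

definition gaussian_rv :: "'a measure \<Rightarrow> ('a \<Rightarrow> real) \<Rightarrow> bool"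
  where "gaussian_rv M Z \<longleftrightarrow> Z \<in> borel_measurable M \<and>
    (\<exists>\<mu> \<sigma>. (\<sigma> > 0 \<and> distributed M lborel Z (normal_density \<mu> \<sigma>)) \<or> (AE \<omega> in M. Z \<omega> = \<mu>))"

definition gaussian_process :: "'a measure \<Rightarrow> (real \<Rightarrow> 'a \<Rightarrow> real) \<Rightarrow> bool"
  where "gaussian_process M X \<longleftrightarrow>
    (\<forall>T u. finite T \<longrightarrow> gaussian_rv M (\<lambda>\<omega>. \<Sum>\<tau>\<in>T. u \<tau> * X \<tau> \<omega>))"

definition covariance_fun ::
    "'a measure \<Rightarrow> (real \<Rightarrow> 'a \<Rightarrow> real) \<Rightarrow> real \<Rightarrow> real \<Rightarrow> real"
  where "covariance_fun M X \<tau> \<tau>' =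
    (\<integral>\<omega>. (X \<tau> \<omega> - (\<integral>\<eta>. X \<tau> \<eta> \<partial>M)) * (X \<tau>' \<omega> - (\<integral>\<eta>. X \<tau>' \<eta> \<partial>M)) \<partial>M)"

definition indep_processes ::
    "'a measure \<Rightarrow> (real \<Rightarrow> 'a \<Rightarrow> real) \<Rightarrow> (real \<Rightarrow> 'a \<Rightarrow> real) \<Rightarrow> bool"
  where "indep_processes M X Y \<longleftrightarrow>
    prob_space.indep_var M
      (\<Pi>\<^sub>M \<tau>\<in>UNIV. borel) (\<lambda>\<omega> \<tau>. X \<tau> \<omega>) (\<Pi>\<^sub>M \<tau>\<in>UNIV. borel) (\<lambda>\<omega> \<tau>. Y \<tau> \<omega>)"


section \<open>The exponentially attenuated Ornstein-Uhlenbeck channel\<close>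

definition OU_covariance :: "real \<Rightarrow> real \<Rightarrow> real \<Rightarrow> real \<Rightarrow> real \<Rightarrow> real"
  where "OU_covariance a b c \<tau> \<tau>' =
    c * exp (- a * \<bar>\<tau> - \<tau>'\<bar>) * b * exp (- b * (\<tau> + \<tau>')) *
    indicator {0..} \<tau> * indicator {0..} \<tau>'"

definition OU_channel ::
    "'a measure \<Rightarrow> real \<Rightarrow> real \<Rightarrow> real \<Rightarrow> (real \<Rightarrow> 'a \<Rightarrow> complex) \<Rightarrow> bool"
  where "OU_channel M a b c H \<longleftrightarrow> (\<exists>X Y.
    gaussian_process M X \<and> gaussian_process M Y \<and> indep_processes M X Y \<and>
    (\<forall>\<tau>. (\<integral>\<omega>. X \<tau> \<omega> \<partial>M) = 0) \<and> (\<forall>\<tau>. (\<integral>\<omega>. Y \<tau> \<omega> \<partial>M) = 0) \<and>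
    covariance_fun M X = OU_covariance a b c \<and> covariance_fun M Y = OU_covariance a b c \<and>
    H = (\<lambda>\<tau> \<omega>. complex_of_real (X \<tau> \<omega>) + \<i> * complex_of_real (Y \<tau> \<omega>)))"

definition channel_spectrum ::
    "'a measure \<Rightarrow> (real \<Rightarrow> 'a \<Rightarrow> complex) \<Rightarrow> real \<Rightarrow> 'a \<Rightarrow> complex"
  where "channel_spectrum M H f =
    ms_integral_real_line M (\<lambda>\<tau> \<omega>. exp (- \<i> * complex_of_real (2 * pi * f * \<tau>)) * H \<tau> \<omega>)"

text \<open>
  The frequency integral is a mean-square integral as well; pathwise integration would depend
  on the choice of versions of the random variables \<open>channel_spectrum M H f\<close>.
\<close>

definition ergodic_capacity ::
    "'a measure \<Rightarrow> (real \<Rightarrow> 'a \<Rightarrow> complex) \<Rightarrow> real \<Rightarrow> real \<Rightarrow> real"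
  where "ergodic_capacity M H \<alpha> W =
    (\<integral>\<omega>. ms_integral M
      (\<lambda>f \<omega>. log 2 (1 + \<alpha> * (cmod (channel_spectrum M H f \<omega>))\<^sup>2)) (- W / 2) (W / 2) \<omega> \<partial>M)"

definition OU_spectral_variance :: "real \<Rightarrow> real \<Rightarrow> real \<Rightarrow> real \<Rightarrow> real"
  where "OU_spectral_variance a b c f = c * (a + b) / ((a + b)\<^sup>2 + (2 * pi * f)\<^sup>2)"

definition OU_capacity_bound :: "real \<Rightarrow> real \<Rightarrow> real \<Rightarrow> real \<Rightarrow> real \<Rightarrow> real \<Rightarrow> real"
  where "OU_capacity_bound a b c \<alpha> W \<theta> =
    (let \<beta>\<^sub>1 = 2 * pi\<^sup>2 / (\<alpha> * c * (a + b));
         \<beta>\<^sub>2 = (a + b)\<^sup>2 / (4 * pi\<^sup>2);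
         r = sqrt \<beta>\<^sub>2;
         q = sqrt (\<beta>\<^sub>2 + exp (- \<theta>) / \<beta>\<^sub>1)
     in W * log 2 (1 + 2 * exp (- \<theta>) * \<alpha> * OU_spectral_variance a b c (W / 2))
        - 4 * r / ln 2 * arctan (W / 2 / r)
        + 4 * q / ln 2 * arctan (W / 2 / q))"

end

(*
  Frequency by frequency, the spectrum is a mean-square limit of Gaussian sums, hence a proper
  complex Gaussian variable whose squared modulus is exponentially distributed with mean
  2 sigma^2(f). Jensen's inequality for ln (1 + x) gives the upper bound; convexity of
  y |-> ln (1 + x e^y), together with E[ln T] = Gamma'(1) = -gamma for T exponential with mean 1,
  gives the lower bound. Integrating both bounds over the frequency band is elementary.
  The mean-square integrals exist because Riemann sums of a mean-square continuous process are
  Cauchy in L^2; pairing a mean-square integral with a second-order variable turns it into an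
  ordinary Henstock-Kurzweil integral, which reduces second moments and expectations to calculus.
*)

theory Submission
  imports Defs
begin

section \<open>Second-order random variables\<close>

text \<open>Three obstacles shape the proof. The channel is not mean-square continuous: its second
  moment jumps from 0 to \<open>2 * b * c\<close> at time 0, so the existence criterion for
  integrals tolerates one exceptional point, near which the cells have small total length. The
  spectrum at each frequency is only a chosen representative, so random variables are compared
  through \<open>l2_norm\<close>, and no pathwise regularity in the frequency is used. Finally,
  neither the law of the squared modulus nor \<open>E[ln T]\<close> is computed directly: a Frullani
  integral shows that \<open>E[ln (1 + V)]\<close> depends on the Laplace transform of
  \<open>V\<close> alone, and \<open>ln T\<close> is bounded below by
  \<open>(1 - T powr (- h)) / h\<close>, whose mean is a difference quotient of Gamma at 1. The two
  bounds share one form because both integrate log2(1 + 2 e^(-theta) alpha sigma^2(f)) over the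
  band: theta = 0 puts the arithmetic mean of the exponential law inside the logarithm, theta =
  gamma its geometric mean.\<close>

definition l2_norm :: "'a measure \<Rightarrow> ('a \<Rightarrow> 'b::real_normed_vector) \<Rightarrow> real"
  where "l2_norm M Z = sqrt (\<integral>\<omega>. (norm (Z \<omega>))\<^sup>2 \<partial>M)"

lemma l2_norm_nonneg [simp]: "0 \<le> l2_norm M Z"
  by (simp add: l2_norm_def)

lemma l2_norm_power2: "(l2_norm M Z)\<^sup>2 = (\<integral>\<omega>. (norm (Z \<omega>))\<^sup>2 \<partial>M)"
  by (simp add: l2_norm_def)

lemma l2_norm_minus_commute: "l2_norm M (\<lambda>\<omega>. Z \<omega> - U \<omega>) = l2_norm M (\<lambda>\<omega>. U \<omega> - Z \<omega>)"
  by (simp add: l2_norm_def norm_minus_commute)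

lemma second_orderI:
  assumes "Z \<in> borel_measurable M" "integrable M (\<lambda>\<omega>. (norm (Z \<omega>))\<^sup>2)"
  shows "second_order M Z"
  using assms by (simp add: second_order_def)

lemma second_orderD:
  assumes "second_order M Z"
  shows "Z \<in> borel_measurable M" "integrable M (\<lambda>\<omega>. (norm (Z \<omega>))\<^sup>2)"
  using assms by (simp_all add: second_order_def)

lemma second_order_dominated:
  assumes "second_order M U" "Z \<in> borel_measurable M"
    and "\<And>\<omega>. norm (Z \<omega>) \<le> C * norm (U \<omega>)"
  shows "second_order M Z"
proof (rule second_orderI[OF assms(2)])
  have bound: "norm ((norm (Z \<omega>))\<^sup>2) \<le> norm (C\<^sup>2 * (norm (U \<omega>))\<^sup>2)" for \<omega>
    using power_mono[OF assms(3)[of \<omega>], of 2] by (simp add: power_mult_distrib)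
  have "integrable M (\<lambda>\<omega>. C\<^sup>2 * (norm (U \<omega>))\<^sup>2)"
    using second_orderD(2)[OF assms(1)] by simp
  moreover have "(\<lambda>\<omega>. (norm (Z \<omega>))\<^sup>2) \<in> borel_measurable M"
    using assms(2) by measurable
  ultimately show "integrable M (\<lambda>\<omega>. (norm (Z \<omega>))\<^sup>2)"
    by (rule Bochner_Integration.integrable_bound) (rule AE_I2, rule bound)
qed

lemma second_order_zero: "second_order M (\<lambda>\<omega>. 0)"
  by (simp add: second_order_def)

lemma norm_add_power2_le:
  fixes x y :: "'b::real_normed_vector"
  shows "(norm (x + y))\<^sup>2 \<le> 2 * (norm x)\<^sup>2 + 2 * (norm y)\<^sup>2"
proof -
  have "(norm (x + y))\<^sup>2 \<le> (norm x + norm y)\<^sup>2"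
    by (intro power_mono norm_triangle_ineq) simp
  also have "\<dots> \<le> 2 * (norm x)\<^sup>2 + 2 * (norm y)\<^sup>2"
    using sum_squares_bound[of "norm x" "norm y"] by (simp add: power2_sum)
  finally show ?thesis .
qed

lemma second_order_add:
  fixes Z U :: "'a \<Rightarrow> 'b::euclidean_space"
  assumes "second_order M Z" "second_order M U"
  shows "second_order M (\<lambda>\<omega>. Z \<omega> + U \<omega>)"
proof (rule second_orderI)
  note [measurable] = second_orderD(1)[OF assms(1)] second_orderD(1)[OF assms(2)]
  show "(\<lambda>\<omega>. Z \<omega> + U \<omega>) \<in> borel_measurable M" by measurable
  show "integrable M (\<lambda>\<omega>. (norm (Z \<omega> + U \<omega>))\<^sup>2)"
  proof (rule Bochner_Integration.integrable_bound)
    show "integrable M (\<lambda>\<omega>. 2 * (norm (Z \<omega>))\<^sup>2 + 2 * (norm (U \<omega>))\<^sup>2)"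
      using second_orderD(2)[OF assms(1)] second_orderD(2)[OF assms(2)] by simp
    show "AE \<omega> in M. norm ((norm (Z \<omega> + U \<omega>))\<^sup>2) \<le> norm (2 * (norm (Z \<omega>))\<^sup>2 + 2 * (norm (U \<omega>))\<^sup>2)"
      using norm_add_power2_le by (intro AE_I2) simp
  qed measurable
qed

lemma second_order_scaleR:
  fixes Z :: "'a \<Rightarrow> 'b::euclidean_space"
  assumes "second_order M Z"
  shows "second_order M (\<lambda>\<omega>. r *\<^sub>R Z \<omega>)"
  using second_orderD[OF assms] by (intro second_order_dominated[OF assms, where C="\<bar>r\<bar>"]) auto

lemma second_order_diff:
  fixes Z U :: "'a \<Rightarrow> 'b::euclidean_space"
  assumes "second_order M Z" "second_order M U"
  shows "second_order M (\<lambda>\<omega>. Z \<omega> - U \<omega>)"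
  using second_order_add[OF assms(1) second_order_scaleR[OF assms(2), of "-1"]] by simp

lemma second_order_sum:
  fixes Z :: "'i \<Rightarrow> 'a \<Rightarrow> 'b::euclidean_space"
  assumes "\<And>i. i \<in> I \<Longrightarrow> second_order M (Z i)"
  shows "second_order M (\<lambda>\<omega>. \<Sum>i\<in>I. Z i \<omega>)"
  using assms
proof (induction I rule: infinite_finite_induct)
  case (insert x F)
  then show ?case using second_order_add[of M "Z x" "\<lambda>\<omega>. \<Sum>i\<in>F. Z i \<omega>"] by simp
qed (simp_all add: second_order_zero)

lemma integrable_inner_second_order:
  fixes Z U :: "'a \<Rightarrow> 'b::euclidean_space"
  assumes "second_order M Z" "second_order M U"
  shows "integrable M (\<lambda>\<omega>. Z \<omega> \<bullet> U \<omega>)"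
proof (rule Bochner_Integration.integrable_bound)
  note [measurable] = second_orderD(1)[OF assms(1)] second_orderD(1)[OF assms(2)]
  show "(\<lambda>\<omega>. Z \<omega> \<bullet> U \<omega>) \<in> borel_measurable M" by measurable
  show "integrable M (\<lambda>\<omega>. (norm (Z \<omega>))\<^sup>2 + (norm (U \<omega>))\<^sup>2)"
    using second_orderD(2)[OF assms(1)] second_orderD(2)[OF assms(2)] by simp
  have "\<bar>Z \<omega> \<bullet> U \<omega>\<bar> \<le> (norm (Z \<omega>))\<^sup>2 + (norm (U \<omega>))\<^sup>2" for \<omega>
  proof -
    have "\<bar>Z \<omega> \<bullet> U \<omega>\<bar> \<le> norm (Z \<omega>) * norm (U \<omega>)" by (rule Cauchy_Schwarz_ineq2)
    then show ?thesis
      using sum_squares_bound[of "norm (Z \<omega>)" "norm (U \<omega>)"]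
        mult_nonneg_nonneg[OF norm_ge_zero norm_ge_zero, of "Z \<omega>" "U \<omega>"] by linarith
  qed
  then show "AE \<omega> in M. norm (Z \<omega> \<bullet> U \<omega>) \<le> norm ((norm (Z \<omega>))\<^sup>2 + (norm (U \<omega>))\<^sup>2)"
    by (intro AE_I2) simp
qed

lemma l2_norm_add_power2:
  fixes Z U :: "'a \<Rightarrow> 'b::euclidean_space"
  assumes "second_order M Z" "second_order M U"
  shows "(l2_norm M (\<lambda>\<omega>. Z \<omega> + U \<omega>))\<^sup>2
    = (l2_norm M Z)\<^sup>2 + 2 * (\<integral>\<omega>. Z \<omega> \<bullet> U \<omega> \<partial>M) + (l2_norm M U)\<^sup>2"
proof -
  have "(\<lambda>\<omega>. (norm (Z \<omega> + U \<omega>))\<^sup>2) = (\<lambda>\<omega>. (norm (Z \<omega>))\<^sup>2 + 2 * (Z \<omega> \<bullet> U \<omega>) + (norm (U \<omega>))\<^sup>2)"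
    by (simp add: power2_norm_eq_inner inner_simps inner_commute algebra_simps)
  then show ?thesis
    using second_orderD(2)[OF assms(1)] second_orderD(2)[OF assms(2)]
      integrable_inner_second_order[OF assms]
    by (simp add: l2_norm_power2)
qed

lemma l2_norm_scaleR: "l2_norm M (\<lambda>\<omega>. r *\<^sub>R Z \<omega>) = \<bar>r\<bar> * l2_norm M Z"
  by (simp add: l2_norm_def power_mult_distrib real_sqrt_mult)

section \<open>Cauchy-Schwarz and Minkowski inequalities for the mean-square seminorm\<close>

lemma l2_Cauchy_Schwarz:
  fixes Z U :: "'a \<Rightarrow> 'b::euclidean_space"
  assumes "second_order M Z" "second_order M U"
  shows "\<bar>\<integral>\<omega>. Z \<omega> \<bullet> U \<omega> \<partial>M\<bar> \<le> l2_norm M Z * l2_norm M U"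
proof -
  let ?p = "\<integral>\<omega>. Z \<omega> \<bullet> U \<omega> \<partial>M" and ?z = "l2_norm M Z" and ?u = "l2_norm M U"
  have quad: "0 \<le> x\<^sup>2 * ?z\<^sup>2 + 2 * x * y * ?p + y\<^sup>2 * ?u\<^sup>2" for x y :: real
  proof -
    have "0 \<le> (l2_norm M (\<lambda>\<omega>. x *\<^sub>R Z \<omega> + y *\<^sub>R U \<omega>))\<^sup>2" by simp
    also have "\<dots> = x\<^sup>2 * ?z\<^sup>2 + 2 * x * y * ?p + y\<^sup>2 * ?u\<^sup>2"
      using l2_norm_add_power2[OF second_order_scaleR[OF assms(1), of x]
          second_order_scaleR[OF assms(2), of y]]
      by (simp add: l2_norm_scaleR power_mult_distrib mult.assoc)
    finally show ?thesis .
  qed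
  have "?p\<^sup>2 \<le> (?z * ?u)\<^sup>2"
  proof (cases "?u = 0")
    \<comment> \<open>For x equal to the square of \<open>?u\<close>, the form \<open>quad\<close>
      is smallest at y = \<open>- ?p\<close>; this choice avoids denominators.\<close>
    case False
    have "0 \<le> ?u\<^sup>2 * (?u\<^sup>2 * ?z\<^sup>2 - ?p\<^sup>2)"
      using quad[of "?u\<^sup>2" "- ?p"] by (simp add: power2_eq_square algebra_simps)
    then have "0 \<le> ?u\<^sup>2 * ?z\<^sup>2 - ?p\<^sup>2"
      using False by (simp add: zero_le_mult_iff)
    then show ?thesis by (simp add: power_mult_distrib mult.commute)
  next
    \<comment> \<open>\<open>l2_norm\<close> is a seminorm on functions, so \<open>?u = 0\<close>
      does not make \<open>U\<close> zero. The form is now affine in y, hence constant: if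
      \<open>?p\<close> were nonzero, the witness below would give it the value -1.\<close>
    case True
    have "0 \<le> ?z\<^sup>2 + 2 * y * ?p" for y using quad[of 1 y] True by simp
    from this[of "- (?z\<^sup>2 + 1) / (2 * ?p)"] have "?p = 0"
      by (cases "?p = 0") (simp_all add: field_simps)
    then show ?thesis by simp
  qed
  then show ?thesis by (metis abs_le_square_iff abs_of_nonneg l2_norm_nonneg mult_nonneg_nonneg)
qed

lemma l2_norm_triangle:
  fixes Z U :: "'a \<Rightarrow> 'b::euclidean_space"
  assumes "second_order M Z" "second_order M U"
  shows "l2_norm M (\<lambda>\<omega>. Z \<omega> + U \<omega>) \<le> l2_norm M Z + l2_norm M U"
proof (rule power2_le_imp_le)
  show "(l2_norm M (\<lambda>\<omega>. Z \<omega> + U \<omega>))\<^sup>2 \<le> (l2_norm M Z + l2_norm M U)\<^sup>2"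
    using l2_Cauchy_Schwarz[OF assms] l2_norm_add_power2[OF assms] by (simp add: power2_sum)
qed simp

lemma l2_norm_triangle_diff:
  fixes Z U V :: "'a \<Rightarrow> 'b::euclidean_space"
  assumes "second_order M Z" "second_order M U" "second_order M V"
  shows "l2_norm M (\<lambda>\<omega>. Z \<omega> - V \<omega>)
    \<le> l2_norm M (\<lambda>\<omega>. Z \<omega> - U \<omega>) + l2_norm M (\<lambda>\<omega>. U \<omega> - V \<omega>)"
  using l2_norm_triangle[OF second_order_diff[OF assms(1,2)] second_order_diff[OF assms(2,3)]]
  by simp

lemma l2_norm_triangle_minus:
  fixes Z U :: "'a \<Rightarrow> 'b::euclidean_space"
  assumes "second_order M Z" "second_order M U"
  shows "l2_norm M (\<lambda>\<omega>. Z \<omega> - U \<omega>) \<le> l2_norm M Z + l2_norm M U"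
  using l2_norm_triangle[OF assms(1) second_order_scaleR[OF assms(2), of "-1"]]
    l2_norm_scaleR[of M "-1" U] by simp

lemma l2_norm_sum_le:
  fixes Z :: "'i \<Rightarrow> 'a \<Rightarrow> 'b::euclidean_space"
  assumes "\<And>i. i \<in> I \<Longrightarrow> second_order M (Z i)"
  shows "l2_norm M (\<lambda>\<omega>. \<Sum>i\<in>I. Z i \<omega>) \<le> (\<Sum>i\<in>I. l2_norm M (Z i))"
  using assms
proof (induction I rule: infinite_finite_induct)
  case (insert x F)
  then show ?case
    using l2_norm_triangle[OF _ second_order_sum[of F M Z], of "Z x"] by force
qed (simp_all add: l2_norm_def)

lemma l2_norm_le_mult:
  fixes U :: "'a \<Rightarrow> 'b::euclidean_space" and Z :: "'a \<Rightarrow> 'c::euclidean_space"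
  assumes "second_order M U" "Z \<in> borel_measurable M" "0 \<le> C"
    and le: "\<And>\<omega>. norm (Z \<omega>) \<le> C * norm (U \<omega>)"
  shows "l2_norm M Z \<le> C * l2_norm M U"
proof (rule power2_le_imp_le)
  have "(l2_norm M Z)\<^sup>2 \<le> (\<integral>\<omega>. C\<^sup>2 * (norm (U \<omega>))\<^sup>2 \<partial>M)"
    unfolding l2_norm_power2
  proof (rule integral_mono)
    show "integrable M (\<lambda>\<omega>. (norm (Z \<omega>))\<^sup>2)"
      by (rule second_orderD(2)[OF second_order_dominated[OF assms(1,2) le]])
    show "integrable M (\<lambda>\<omega>. C\<^sup>2 * (norm (U \<omega>))\<^sup>2)"
      using second_orderD(2)[OF assms(1)] by simp
    show "(norm (Z \<omega>))\<^sup>2 \<le> C\<^sup>2 * (norm (U \<omega>))\<^sup>2" for \<omega>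
      using power_mono[OF le norm_ge_zero, where n = 2] by (simp add: power_mult_distrib)
  qed
  then show "(l2_norm M Z)\<^sup>2 \<le> (C * l2_norm M U)\<^sup>2"
    by (simp add: power_mult_distrib l2_norm_power2)
qed (use \<open>0 \<le> C\<close> in simp)

section \<open>Mean-square limits\<close>

lemma ms_tendsto_l2_norm:
  assumes "ms_tendsto M S L F"
  shows "((\<lambda>i. l2_norm M (\<lambda>\<omega>. S i \<omega> - L \<omega>)) \<longlongrightarrow> 0) F"
  using tendsto_real_sqrt[of _ 0 F] assms unfolding ms_tendsto_def l2_norm_def by force

lemma ms_tendstoI:
  assumes "second_order M L" "\<forall>\<^sub>F i in F. second_order M (S i)"
    and "((\<lambda>i. l2_norm M (\<lambda>\<omega>. S i \<omega> - L \<omega>)) \<longlongrightarrow> 0) F"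
  shows "ms_tendsto M S L F"
  using assms(1,2) tendsto_power[OF assms(3), of 2]
  unfolding ms_tendsto_def l2_norm_power2 by simp

lemma ms_tendstoD:
  assumes "ms_tendsto M S L F"
  shows "second_order M L" "\<forall>\<^sub>F i in F. second_order M (S i)"
  using assms unfolding ms_tendsto_def by auto

lemma ms_tendsto_mono:
  assumes "ms_tendsto M S L F" "G \<le> F"
  shows "ms_tendsto M S L G"
  using assms unfolding ms_tendsto_def by (auto intro: filter_leD tendsto_mono)

lemma tendsto_l2_norm:
  fixes L :: "'a \<Rightarrow> 'b::euclidean_space"
  assumes "ms_tendsto M S L F"
  shows "((\<lambda>i. l2_norm M (S i)) \<longlongrightarrow> l2_norm M L) F"
proof (rule LIM_zero_cancel, rule Lim_null_comparison)
  show "\<forall>\<^sub>F i in F. norm (l2_norm M (S i) - l2_norm M L) \<le> l2_norm M (\<lambda>\<omega>. S i \<omega> - L \<omega>)"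
    using ms_tendstoD(2)[OF assms]
  proof eventually_elim
    case (elim i)
    note L = ms_tendstoD(1)[OF assms]
    show ?case
      using l2_norm_triangle[OF second_order_diff[OF elim L] L]
        l2_norm_triangle[OF second_order_diff[OF L elim] elim] l2_norm_minus_commute[of M "S i" L]
      by simp
  qed
qed (rule ms_tendsto_l2_norm[OF assms])

text \<open>Strong convergence implies weak convergence, by Cauchy-Schwarz. It carries pairings with
  a fixed \<open>U\<close> through limits of Riemann sums.\<close>

lemma tendsto_integral_inner:
  fixes L U :: "'a \<Rightarrow> 'b::euclidean_space"
  assumes "ms_tendsto M S L F" "second_order M U"
  shows "((\<lambda>i. \<integral>\<omega>. S i \<omega> \<bullet> U \<omega> \<partial>M) \<longlongrightarrow> (\<integral>\<omega>. L \<omega> \<bullet> U \<omega> \<partial>M)) F"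
proof (rule LIM_zero_cancel, rule Lim_null_comparison)
  show "\<forall>\<^sub>F i in F. norm ((\<integral>\<omega>. S i \<omega> \<bullet> U \<omega> \<partial>M) - (\<integral>\<omega>. L \<omega> \<bullet> U \<omega> \<partial>M))
      \<le> l2_norm M (\<lambda>\<omega>. S i \<omega> - L \<omega>) * l2_norm M U"
    using ms_tendstoD(2)[OF assms(1)]
  proof eventually_elim
    case (elim i)
    note L = ms_tendstoD(1)[OF assms(1)]
    show ?case
      using l2_Cauchy_Schwarz[OF second_order_diff[OF elim L] assms(2)]
        integrable_inner_second_order[OF elim assms(2)] integrable_inner_second_order[OF L assms(2)]
      by (simp add: inner_diff_left)
  qed
  show "((\<lambda>i. l2_norm M (\<lambda>\<omega>. S i \<omega> - L \<omega>) * l2_norm M U) \<longlongrightarrow> 0) F"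
    using tendsto_mult_left_zero[OF ms_tendsto_l2_norm[OF assms(1)]] .
qed

lemma ms_tendsto_diff:
  fixes I J :: "'a \<Rightarrow> 'b::euclidean_space"
  assumes "ms_tendsto M S I F" "ms_tendsto M T J F"
  shows "ms_tendsto M (\<lambda>i \<omega>. S i \<omega> - T i \<omega>) (\<lambda>\<omega>. I \<omega> - J \<omega>) F"
proof (rule ms_tendstoI)
  note so = ms_tendstoD(2)[OF assms(1)] ms_tendstoD(2)[OF assms(2)]
  note IJ = ms_tendstoD(1)[OF assms(1)] ms_tendstoD(1)[OF assms(2)]
  show "second_order M (\<lambda>\<omega>. I \<omega> - J \<omega>)"
    using IJ by (rule second_order_diff)
  show "\<forall>\<^sub>F i in F. second_order M (\<lambda>\<omega>. S i \<omega> - T i \<omega>)"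
    using so by eventually_elim (rule second_order_diff)
  show "((\<lambda>i. l2_norm M (\<lambda>\<omega>. S i \<omega> - T i \<omega> - (I \<omega> - J \<omega>))) \<longlongrightarrow> 0) F"
  proof (rule Lim_null_comparison)
    show "((\<lambda>i. l2_norm M (\<lambda>\<omega>. S i \<omega> - I \<omega>) + l2_norm M (\<lambda>\<omega>. T i \<omega> - J \<omega>)) \<longlongrightarrow> 0) F"
      using tendsto_add[OF ms_tendsto_l2_norm[OF assms(1)] ms_tendsto_l2_norm[OF assms(2)]] by simp
    show "\<forall>\<^sub>F i in F. norm (l2_norm M (\<lambda>\<omega>. S i \<omega> - T i \<omega> - (I \<omega> - J \<omega>)))
        \<le> l2_norm M (\<lambda>\<omega>. S i \<omega> - I \<omega>) + l2_norm M (\<lambda>\<omega>. T i \<omega> - J \<omega>)"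
      using so
    proof eventually_elim
      case (elim i)
      show ?case
        using l2_norm_triangle_minus[OF second_order_diff[OF elim(1) IJ(1)] second_order_diff[OF elim(2) IJ(2)]]
        by (simp add: algebra_simps)
    qed
  qed
qed

section \<open>Completeness of mean-square convergence\<close>

context prob_space
begin

lemma nn_integral_norm_le_l2_norm:
  fixes Z :: "'a \<Rightarrow> 'b::euclidean_space"
  assumes "second_order M Z"
  shows "(\<integral>\<^sup>+\<omega>. ennreal (norm (Z \<omega>)) \<partial>M) \<le> ennreal (l2_norm M Z)"
    and "integrable M (\<lambda>\<omega>. norm (Z \<omega>))"
    and "(\<integral>\<omega>. norm (Z \<omega>) \<partial>M) \<le> l2_norm M Z"
proof -
  note [measurable] = second_orderD(1)[OF assms]
  have 1: "second_order M (\<lambda>\<omega>. norm (Z \<omega>))" "second_order M (\<lambda>\<omega>. 1::real)"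
    using second_orderD[OF assms] by (auto intro!: second_orderI)
  show int: "integrable M (\<lambda>\<omega>. norm (Z \<omega>))"
    using integrable_inner_second_order[OF 1] by simp
  show "(\<integral>\<omega>. norm (Z \<omega>) \<partial>M) \<le> l2_norm M Z"
    using l2_Cauchy_Schwarz[OF 1] by (simp add: l2_norm_def prob_space)
  then show "(\<integral>\<^sup>+\<omega>. ennreal (norm (Z \<omega>)) \<partial>M) \<le> ennreal (l2_norm M Z)"
    using int by (subst nn_integral_eq_integral) (auto intro: ennreal_leI)
qed

lemma integrable_second_order:
  fixes Z :: "'a \<Rightarrow> 'b::euclidean_space"
  assumes "second_order M Z"
  shows "integrable M Z"
  using nn_integral_norm_le_l2_norm(2)[OF assms] second_orderD(1)[OF assms] by (rule integrable_norm_cancel)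

text \<open>The Riesz-Fischer argument: geometrically small increments have a finite sum of first
  moments, so the telescoping series converges absolutely almost surely, and Fatou's lemma turns the
  almost sure limit into a mean-square one with an explicit rate.\<close>

lemma l2_complete_geometric:
  fixes S :: "nat \<Rightarrow> 'a \<Rightarrow> 'b::euclidean_space"
  assumes S: "\<And>n. second_order M (S n)"
    and fast: "\<And>n. l2_norm M (\<lambda>\<omega>. S (Suc n) \<omega> - S n \<omega>) \<le> (1/2) ^ n"
  shows "\<exists>L. second_order M L \<and> (\<forall>n. l2_norm M (\<lambda>\<omega>. S n \<omega> - L \<omega>) \<le> 2 * (1/2) ^ n)"
proof -
  note [measurable] = second_orderD(1)[OF S]
  define D where "D n \<omega> = S (Suc n) \<omega> - S n \<omega>" for n \<omega>
  have D: "second_order M (D n)" for n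
    unfolding D_def by (intro second_order_diff S)
  note [measurable] = second_orderD(1)[OF D]
  have "(\<integral>\<^sup>+\<omega>. (\<Sum>n. ennreal (norm (D n \<omega>))) \<partial>M) = (\<Sum>n. \<integral>\<^sup>+\<omega>. ennreal (norm (D n \<omega>)) \<partial>M)"
    by (rule nn_integral_suminf) measurable
  also have "\<dots> \<le> (\<Sum>n. ennreal ((1/2) ^ n))"
  proof (intro suminf_le allI)
    show "(\<integral>\<^sup>+\<omega>. ennreal (norm (D n \<omega>)) \<partial>M) \<le> ennreal ((1/2) ^ n)" for n
      using order_trans[OF nn_integral_norm_le_l2_norm(1)[OF D] ennreal_leI[OF fast[folded D_def]]] .
  qed auto
  also have "\<dots> = ennreal (\<Sum>n. (1/2) ^ n)"
    by (intro suminf_ennreal2 summable_geometric) auto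
  finally have "(\<integral>\<^sup>+\<omega>. (\<Sum>n. ennreal (norm (D n \<omega>))) \<partial>M) \<noteq> \<infinity>"
    by (metis ennreal_neq_top infinity_ennreal_def top.extremum_uniqueI)
  then have "AE \<omega> in M. (\<Sum>n. ennreal (norm (D n \<omega>))) \<noteq> \<infinity>"
    by (intro nn_integral_noteq_infinite) measurable
  then have conv: "AE \<omega> in M. (\<lambda>n. S n \<omega>) \<longlonglongrightarrow> lim (\<lambda>n. S n \<omega>)"
  proof eventually_elim
    case (elim \<omega>)
    then have "summable (\<lambda>n. norm (D n \<omega>))"
      by (intro summable_suminf_not_top) auto
    then have "summable (\<lambda>n. D n \<omega>)" by (rule summable_norm_cancel)
    then have "convergent (\<lambda>n. \<Sum>k<n. D k \<omega>)" by (simp add: summable_iff_convergent)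
    moreover have "(\<Sum>k<n. D k \<omega>) = S n \<omega> - S 0 \<omega>" for n
      unfolding D_def by (rule sum_lessThan_telescope)
    ultimately have "convergent (\<lambda>n. S n \<omega> - S 0 \<omega>)" by simp
    then have "convergent (\<lambda>n. S n \<omega>)" by (simp add: convergent_diff_const_right_iff)
    then show ?case by (simp add: convergent_LIMSEQ_iff)
  qed
  \<comment> \<open>\<open>lim\<close> is total, so \<open>L\<close> is defined and measurable
    everywhere; its values off the convergence set do not affect any integral below.\<close>
  define L where "L \<omega> = lim (\<lambda>n. S n \<omega>)" for \<omega>
  have L [measurable]: "L \<in> borel_measurable M"
    unfolding L_def by (rule borel_measurable_lim_metric) measurable
  \<comment> \<open>The subtracted term makes the induction close: the geometric tail bound drops by
    exactly the size allowed for the next increment.\<close>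
  have step: "l2_norm M (\<lambda>\<omega>. S (n + k) \<omega> - S n \<omega>) \<le> 2 * (1/2) ^ n - 2 * (1/2) ^ (n + k)" for n k
  proof (induction k)
    case (Suc k)
    have "l2_norm M (\<lambda>\<omega>. S (n + Suc k) \<omega> - S n \<omega>)
        \<le> l2_norm M (\<lambda>\<omega>. S (n + Suc k) \<omega> - S (n + k) \<omega>) + l2_norm M (\<lambda>\<omega>. S (n + k) \<omega> - S n \<omega>)"
      by (intro l2_norm_triangle_diff S)
    then show ?case using fast[of "n + k"] Suc by simp
  qed (simp add: l2_norm_def)
  have bound: "(\<integral>\<^sup>+\<omega>. ennreal ((norm (S n \<omega> - L \<omega>))\<^sup>2) \<partial>M) \<le> ennreal ((2 * (1/2) ^ n)\<^sup>2)" for n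
  proof -
    have "(\<integral>\<^sup>+\<omega>. ennreal ((norm (S n \<omega> - L \<omega>))\<^sup>2) \<partial>M)
        = (\<integral>\<^sup>+\<omega>. liminf (\<lambda>k. ennreal ((norm (S n \<omega> - S k \<omega>))\<^sup>2)) \<partial>M)"
    proof (rule nn_integral_cong_AE, use conv in eventually_elim)
      case (elim \<omega>)
      then have "(\<lambda>k. ennreal ((norm (S n \<omega> - S k \<omega>))\<^sup>2)) \<longlonglongrightarrow> ennreal ((norm (S n \<omega> - L \<omega>))\<^sup>2)"
        unfolding L_def by (intro tendsto_intros)
      then show ?case by (intro lim_imp_Liminf[symmetric]) auto
    qed
    also have "\<dots> \<le> liminf (\<lambda>k. \<integral>\<^sup>+\<omega>. ennreal ((norm (S n \<omega> - S k \<omega>))\<^sup>2) \<partial>M)"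
      by (rule nn_integral_liminf) measurable
    also have "\<dots> \<le> ennreal ((2 * (1/2) ^ n)\<^sup>2)"
    proof (rule Liminf_le[OF sequentially_bot], rule eventually_sequentiallyI[of n])
      fix k assume "n \<le> k"
      then obtain j where k: "k = n + j" using le_Suc_ex by blast
      have "l2_norm M (\<lambda>\<omega>. S n \<omega> - S k \<omega>) \<le> 2 * (1/2) ^ n"
        using step[of n j] zero_le_power[of "1/2::real" "n + j"]
        unfolding k l2_norm_minus_commute[of M "S n" "S (n + j)"] by linarith
      from power_mono[OF this l2_norm_nonneg, of 2]
      have "(\<integral>\<omega>. (norm (S n \<omega> - S k \<omega>))\<^sup>2 \<partial>M) \<le> (2 * (1/2) ^ n)\<^sup>2"
        unfolding l2_norm_power2 .
      then show "(\<integral>\<^sup>+\<omega>. ennreal ((norm (S n \<omega> - S k \<omega>))\<^sup>2) \<partial>M) \<le> ennreal ((2 * (1/2) ^ n)\<^sup>2)"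
        using second_orderD(2)[OF second_order_diff[OF S S], of n k]
        by (subst nn_integral_eq_integral) (auto intro!: ennreal_leI)
    qed
    finally show ?thesis .
  qed
  have SL: "second_order M (\<lambda>\<omega>. S n \<omega> - L \<omega>)" for n
  proof (rule second_orderI)
    show "integrable M (\<lambda>\<omega>. (norm (S n \<omega> - L \<omega>))\<^sup>2)"
    proof (rule integrableI_bounded)
      show "(\<integral>\<^sup>+\<omega>. ennreal (norm ((norm (S n \<omega> - L \<omega>))\<^sup>2)) \<partial>M) < \<infinity>"
        using order_le_less_trans[OF bound[of n] ennreal_less_top] by simp
    qed measurable
  qed measurable
  have "second_order M L"
    using second_order_diff[OF S SL, of 0 0] by simp
  moreover have "l2_norm M (\<lambda>\<omega>. S n \<omega> - L \<omega>) \<le> 2 * (1/2) ^ n" for n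
  proof -
    have "ennreal (\<integral>\<omega>. (norm (S n \<omega> - L \<omega>))\<^sup>2 \<partial>M) \<le> ennreal ((2 * (1/2) ^ n)\<^sup>2)"
      using bound[of n] second_orderD(2)[OF SL, of n] by (subst (asm) nn_integral_eq_integral) auto
    then have "(l2_norm M (\<lambda>\<omega>. S n \<omega> - L \<omega>))\<^sup>2 \<le> (2 * (1/2) ^ n)\<^sup>2"
      unfolding l2_norm_power2 by (simp add: ennreal_le_iff)
    then show ?thesis by (rule power2_le_imp_le) simp
  qed
  ultimately show ?thesis by blast
qed

text \<open>One index is picked for each scale (1/2)^n. The resulting sequence has a limit by
  \<open>l2_complete_geometric\<close>, and every eventual index is close to it by comparison with
  the picked ones. In this form the criterion serves both the mesh filter and the filter of growing
  intervals.\<close>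

lemma ms_Cauchy_convergent:
  fixes S :: "'i \<Rightarrow> 'a \<Rightarrow> 'b::euclidean_space"
  assumes F: "F \<noteq> bot" and S: "\<forall>\<^sub>F i in F. second_order M (S i)"
    and Cauchy: "\<And>\<epsilon>. \<epsilon> > 0 \<Longrightarrow>
      \<exists>P. eventually P F \<and> (\<forall>i j. P i \<longrightarrow> P j \<longrightarrow> l2_norm M (\<lambda>\<omega>. S i \<omega> - S j \<omega>) \<le> \<epsilon>)"
  shows "\<exists>L. ms_tendsto M S L F"
proof -
  have "\<exists>P. eventually P F \<and> (\<forall>i j. P i \<longrightarrow> P j \<longrightarrow> l2_norm M (\<lambda>\<omega>. S i \<omega> - S j \<omega>) \<le> (1/2) ^ n)" for n
    by (rule Cauchy) simp
  then obtain P where P: "\<And>n. eventually (P n) F"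
    "\<And>n i j. P n i \<Longrightarrow> P n j \<Longrightarrow> l2_norm M (\<lambda>\<omega>. S i \<omega> - S j \<omega>) \<le> (1/2) ^ n"
    by metis
  \<comment> \<open>Accumulating the conditions up to n makes \<open>x n\<close> and
    \<open>x (Suc n)\<close> both satisfy \<open>P n\<close>, as the increment bound
    requires.\<close>
  define Q where "Q n i \<longleftrightarrow> second_order M (S i) \<and> (\<forall>m\<in>{..n}. P m i)" for n i
  have Q: "eventually (Q n) F" for n
    unfolding Q_def using S P(1) by (intro eventually_conj eventually_ball_finite) auto
  then have "\<exists>i. Q n i" for n using F eventually_happens by blast
  then obtain x where x: "Q n (x n)" for n by metis
  obtain L where L: "second_order M L" "\<And>n. l2_norm M (\<lambda>\<omega>. S (x n) \<omega> - L \<omega>) \<le> 2 * (1/2) ^ n"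
  proof -
    have "second_order M (S (x n))" for n using x by (auto simp: Q_def)
    moreover have "l2_norm M (\<lambda>\<omega>. S (x (Suc n)) \<omega> - S (x n) \<omega>) \<le> (1/2) ^ n" for n
      using x[of n] x[of "Suc n"] by (intro P(2)) (auto simp: Q_def)
    ultimately show ?thesis using l2_complete_geometric[of "\<lambda>n. S (x n)"] that by blast
  qed
  have "((\<lambda>i. l2_norm M (\<lambda>\<omega>. S i \<omega> - L \<omega>)) \<longlongrightarrow> 0) F"
  proof (rule tendstoI)
    fix e :: real assume "e > 0"
    \<comment> \<open>Two distances are added below, one at most (1/2)^n and one at most twice that;
      hence e / 3.\<close>
    then obtain n where n: "(1/2) ^ n < e / 3" using real_arch_pow_inv[of "e/3" "1/2"] by auto
    show "\<forall>\<^sub>F i in F. dist (l2_norm M (\<lambda>\<omega>. S i \<omega> - L \<omega>)) 0 < e"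
      using Q[of n]
    proof eventually_elim
      case (elim i)
      have "l2_norm M (\<lambda>\<omega>. S i \<omega> - L \<omega>)
          \<le> l2_norm M (\<lambda>\<omega>. S i \<omega> - S (x n) \<omega>) + l2_norm M (\<lambda>\<omega>. S (x n) \<omega> - L \<omega>)"
        using elim x[of n] L(1) by (intro l2_norm_triangle_diff) (auto simp: Q_def)
      moreover have "l2_norm M (\<lambda>\<omega>. S i \<omega> - S (x n) \<omega>) \<le> (1/2) ^ n"
        using elim x[of n] by (intro P(2)) (auto simp: Q_def)
      ultimately show ?case using L(2)[of n] n by simp
    qed
  qed
  then show ?thesis using ms_tendstoI[OF L(1) S] by blast
qed

end

section \<open>Mean-square integrals\<close>

lemma eventually_riemann_filter:
  "(\<forall>\<^sub>F p in riemann_filter s t. P p) \<longleftrightarrow>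
    (\<exists>\<delta>>0. \<forall>p. p tagged_division_of {s..t} \<and> (\<lambda>x. ball x \<delta>) fine p \<longrightarrow> P p)"
  unfolding riemann_filter_def
proof (subst eventually_INF_base; clarsimp simp: eventually_principal Bex_def)
  fix d1 d2 :: real assume "0 < d1" "0 < d2"
  then show "\<exists>x. 0 < x \<and>
      {p. p tagged_division_of {s..t} \<and> (\<lambda>y. ball y x) fine p} \<subseteq> {p. p tagged_division_of {s..t} \<and> (\<lambda>x. ball x d1) fine p} \<and>
      {p. p tagged_division_of {s..t} \<and> (\<lambda>y. ball y x) fine p} \<subseteq> {p. p tagged_division_of {s..t} \<and> (\<lambda>x. ball x d2) fine p}"
    by (intro exI[of _ "min d1 d2"]) (fastforce simp: fine_def)
qed

text \<open>A constant radius is a special gauge. Hence any limit along shrinking mesh is also a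
  limit along gauges, which makes Henstock-Kurzweil integration available for scalars derived from
  mean-square integrals.\<close>

lemma division_filter_le_riemann_filter: "division_filter {s..t} \<le> riemann_filter s t"
proof (rule filter_leI)
  fix P assume "\<forall>\<^sub>F p in riemann_filter s t. P p"
  then obtain \<delta> where "\<delta> > 0" "\<forall>p. p tagged_division_of {s..t} \<and> (\<lambda>x. ball x \<delta>) fine p \<longrightarrow> P p"
    unfolding eventually_riemann_filter by blast
  then show "\<forall>\<^sub>F p in division_filter {s..t}. P p"
    unfolding eventually_division_filter using gauge_ball by blast
qed

lemma riemann_filter_neq_bot: "riemann_filter s t \<noteq> bot"
  using division_filter_le_riemann_filter[of s t] division_filter_not_empty[of s t]
  by (metis bot.extremum_uniqueI box_real(2))

text \<open>The indicator of \<open>{u..v}\<close> is integrated over each cell and over the whole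
  interval; additivity of the integral replaces any combinatorics of interval endpoints.\<close>

lemma content_Int_tagged_division:
  fixes s t u v :: real
  assumes "p tagged_division_of {s..t}"
  shows "measure lborel ({u..v} \<inter> {s..t}) = (\<Sum>(x, K)\<in>p. measure lborel ({u..v} \<inter> K))"
proof -
  have *: "((\<lambda>x. if x \<in> {u..v} then 1 else 0) has_integral measure lborel ({u..v} \<inter> {s'..t'})) {s'..t'}" for s' t'
    using has_integral_const_real[of "1::real" "max u s'" "min v t'"]
    by (subst has_integral_restrict_Int) simp
  have "((\<lambda>x. if x \<in> {u..v} then 1 else 0) has_integral (\<Sum>(x, K)\<in>p. measure lborel ({u..v} \<inter> K))) {s..t}"
  proof (rule has_integral_combine_tagged_division[OF assms])
    fix x K assume "(x, K) \<in> p"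
    then obtain s' t' where "K = {s'..t'}" using tagged_division_ofD(4)[OF assms] by fastforce
    then show "((\<lambda>x. if x \<in> {u..v} then 1 else 0) has_integral measure lborel ({u..v} \<inter> K)) K"
      using * by simp
  qed
  then show ?thesis using * has_integral_unique by blast
qed

text \<open>With this, Riemann sums over two divisions can both be written over the overlaps of
  their cells, that is, over a common refinement.\<close>

lemma content_eq_sum_Int:
  fixes s t :: real
  assumes "p tagged_division_of {s..t}" "q tagged_division_of {s..t}" "(x, K) \<in> p"
  shows "measure lborel K = (\<Sum>(y, L)\<in>q. measure lborel (K \<inter> L))"
proof -
  obtain u v where K: "K = {u..v}" using tagged_division_ofD(4)[OF assms(1,3)] by auto
  then have "K \<inter> {s..t} = K" using tagged_division_ofD(3)[OF assms(1,3)] by auto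
  then show ?thesis using content_Int_tagged_division[OF assms(2), of u v] unfolding K by metis
qed

text \<open>A cell of a fine division lies within distance \<delta> of its tag, so cells tagged near
  \<open>x0\<close> all lie in the interval \<open>?B\<close> of length 4 \<delta>. This controls
  the cells that may see a jump at \<open>x0\<close>.\<close>

lemma sum_content_near_le:
  fixes s t :: real
  assumes p: "p tagged_division_of {s..t}" and fine: "(\<lambda>x. ball x \<delta>) fine p" and "\<delta> > 0"
  shows "(\<Sum>(x, K)\<in>p. measure lborel K * (if \<bar>x - x0\<bar> < \<delta> then 1 else 0)) \<le> 4 * \<delta>"
proof -
  let ?B = "{x0 - 2 * \<delta>..x0 + 2 * \<delta>}"
  have "(\<Sum>(x, K)\<in>p. measure lborel K * (if \<bar>x - x0\<bar> < \<delta> then 1 else 0)) \<le> (\<Sum>(x, K)\<in>p. measure lborel (?B \<inter> K))"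
  proof (rule sum_mono, clarify)
    fix x K assume xK: "(x, K) \<in> p"
    have "?B \<inter> K = K" if "\<bar>x - x0\<bar> < \<delta>"
      using fineD[OF fine xK] that by (fastforce simp: subset_iff dist_real_def)
    then show "measure lborel K * (if \<bar>x - x0\<bar> < \<delta> then 1 else 0) \<le> measure lborel (?B \<inter> K)" by simp
  qed
  also have "\<dots> = measure lborel (?B \<inter> {s..t})"
    by (rule content_Int_tagged_division[OF p, symmetric])
  also have "\<dots> \<le> measure lborel ?B"
    using fmeasurable_cbox(1)[of "x0 - 2 * \<delta>" "x0 + 2 * \<delta>"]
    by (intro measure_mono_fmeasurable) auto
  also have "\<dots> = 4 * \<delta>" using \<open>\<delta> > 0\<close> by simp
  finally show ?thesis .
qed

lemma second_order_riemann_sum: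
  fixes Z :: "real \<Rightarrow> 'a \<Rightarrow> 'b::euclidean_space"
  assumes "\<And>x. x \<in> {s..t} \<Longrightarrow> second_order M (Z x)" "p tagged_division_of {s..t}"
  shows "second_order M (\<lambda>\<omega>. \<Sum>(x, K)\<in>p. measure lborel K *\<^sub>R Z x \<omega>)"
proof -
  have "second_order M (\<lambda>\<omega>. measure lborel (snd k) *\<^sub>R Z (fst k) \<omega>)" if "k \<in> p" for k
    using that tagged_division_ofD(2,3)[OF assms(2), of "fst k" "snd k"]
    by (intro second_order_scaleR assms(1)) auto
  then show ?thesis
    using second_order_sum[of p M "\<lambda>k \<omega>. measure lborel (snd k) *\<^sub>R Z (fst k) \<omega>"]
    by (simp add: case_prod_unfold)
qed

text \<open>The freedom in \<open>U\<close> is the point: the constant 1 yields expectations, the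
  integral itself yields its second moment, and the difference of two candidates shows that they
  agree.\<close>

lemma has_ms_integral_imp_has_integral_inner:
  fixes Z :: "real \<Rightarrow> 'a \<Rightarrow> 'b::euclidean_space"
  assumes Z: "\<And>x. x \<in> {s..t} \<Longrightarrow> second_order M (Z x)" and I: "has_ms_integral M Z s t I"
    and U: "second_order M U"
  shows "((\<lambda>x. \<integral>\<omega>. Z x \<omega> \<bullet> U \<omega> \<partial>M) has_integral (\<integral>\<omega>. I \<omega> \<bullet> U \<omega> \<partial>M)) {s..t}"
proof -
  have "((\<lambda>p. \<integral>\<omega>. (\<Sum>(x, K)\<in>p. measure lborel K *\<^sub>R Z x \<omega>) \<bullet> U \<omega> \<partial>M) \<longlongrightarrow> (\<integral>\<omega>. I \<omega> \<bullet> U \<omega> \<partial>M))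
      (division_filter {s..t})"
    using tendsto_integral_inner[OF ms_tendsto_mono[OF I[unfolded has_ms_integral_def]
          division_filter_le_riemann_filter] U] .
  moreover have "\<forall>\<^sub>F p in division_filter {s..t}.
      (\<integral>\<omega>. (\<Sum>(x, K)\<in>p. measure lborel K *\<^sub>R Z x \<omega>) \<bullet> U \<omega> \<partial>M)
      = (\<Sum>(x, K)\<in>p. measure lborel K *\<^sub>R (\<integral>\<omega>. Z x \<omega> \<bullet> U \<omega> \<partial>M))"
    using eventually_division_filter_tagged_division[of "{s..t}"]
  proof eventually_elim
    case (elim p)
    have int: "integrable M (\<lambda>\<omega>. measure lborel (snd k) * (Z (fst k) \<omega> \<bullet> U \<omega>))" if "k \<in> p" for k
      using that tagged_division_ofD(2,3)[OF elim, of "fst k" "snd k"]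
      by (intro integrable_mult_right integrable_inner_second_order U Z) auto
    have "(\<integral>\<omega>. (\<Sum>(x, K)\<in>p. measure lborel K *\<^sub>R Z x \<omega>) \<bullet> U \<omega> \<partial>M)
        = (\<integral>\<omega>. (\<Sum>k\<in>p. measure lborel (snd k) * (Z (fst k) \<omega> \<bullet> U \<omega>)) \<partial>M)"
      by (simp add: inner_sum_left case_prod_unfold)
    also have "\<dots> = (\<Sum>k\<in>p. \<integral>\<omega>. measure lborel (snd k) * (Z (fst k) \<omega> \<bullet> U \<omega>) \<partial>M)"
      by (rule Bochner_Integration.integral_sum) (rule int)
    finally show ?case by (simp add: case_prod_unfold)
  qed
  ultimately show ?thesis
    unfolding has_integral_cbox[of _ _ s t, unfolded box_real] by (rule Lim_transform_eventually)
qed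

text \<open>Minkowski's inequality for the Riemann sums, passed to the limit. A majorant
  \<open>h\<close> with known integral is enough, so the norm function itself never has to be
  integrated.\<close>

lemma has_ms_integral_l2_norm_le:
  fixes Z :: "real \<Rightarrow> 'a \<Rightarrow> 'b::euclidean_space"
  assumes Z: "\<And>x. x \<in> {s..t} \<Longrightarrow> second_order M (Z x)" and I: "has_ms_integral M Z s t I"
    and h: "\<And>x. x \<in> {s..t} \<Longrightarrow> l2_norm M (Z x) \<le> h x" "(h has_integral A) {s..t}"
  shows "l2_norm M I \<le> A"
proof (rule tendsto_le)
  show "division_filter {s..t} \<noteq> bot" using division_filter_not_empty[of s t] by simp
  show "((\<lambda>p. \<Sum>(x, K)\<in>p. measure lborel K *\<^sub>R h x) \<longlongrightarrow> A) (division_filter {s..t})"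
    using h(2) has_integral_cbox[of h A s t] by simp
  show "((\<lambda>p. l2_norm M (\<lambda>\<omega>. \<Sum>(x, K)\<in>p. measure lborel K *\<^sub>R Z x \<omega>)) \<longlongrightarrow> l2_norm M I)
      (division_filter {s..t})"
    using tendsto_l2_norm[OF ms_tendsto_mono[OF I[unfolded has_ms_integral_def]
          division_filter_le_riemann_filter]] .
  show "\<forall>\<^sub>F p in division_filter {s..t}.
      l2_norm M (\<lambda>\<omega>. \<Sum>(x, K)\<in>p. measure lborel K *\<^sub>R Z x \<omega>) \<le> (\<Sum>(x, K)\<in>p. measure lborel K *\<^sub>R h x)"
    using eventually_division_filter_tagged_division[of "{s..t}"]
  proof eventually_elim
    case (elim p)
    have tag: "fst k \<in> {s..t}" if "k \<in> p" for k
      using that tagged_division_ofD(2,3)[OF elim, of "fst k" "snd k"] by auto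
    have "l2_norm M (\<lambda>\<omega>. \<Sum>k\<in>p. measure lborel (snd k) *\<^sub>R Z (fst k) \<omega>)
        \<le> (\<Sum>k\<in>p. l2_norm M (\<lambda>\<omega>. measure lborel (snd k) *\<^sub>R Z (fst k) \<omega>))"
      using tag by (intro l2_norm_sum_le second_order_scaleR Z)
    also have "\<dots> \<le> (\<Sum>k\<in>p. measure lborel (snd k) * h (fst k))"
      unfolding l2_norm_scaleR using tag h(1) by (intro sum_mono mult_mono) auto
    finally show ?case by (simp add: case_prod_unfold)
  qed
qed

lemma has_ms_integral_diff:
  fixes Z :: "real \<Rightarrow> 'a \<Rightarrow> 'b::euclidean_space"
  assumes "has_ms_integral M Z s t I" "has_ms_integral M U s t J"
  shows "has_ms_integral M (\<lambda>x \<omega>. Z x \<omega> - U x \<omega>) s t (\<lambda>\<omega>. I \<omega> - J \<omega>)"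
  using ms_tendsto_diff[OF assms[unfolded has_ms_integral_def]]
  by (simp add: has_ms_integral_def scaleR_diff_right sum_subtractf case_prod_unfold)

text \<open>The defect \<open>U\<close> is paired with itself: each pairing of an integral with
  \<open>U\<close> is an ordinary integral, and those are additive over intervals, so
  \<open>U\<close> has second moment 0. Equality cannot hold pointwise, since the integrals are
  fixed only up to null sets.\<close>

lemma has_ms_integral_combine:
  fixes Z :: "real \<Rightarrow> 'a \<Rightarrow> 'b::euclidean_space"
  assumes Z: "\<And>x. second_order M (Z x)" and "s \<le> t" "t \<le> u"
    and I: "has_ms_integral M Z s t I" and J: "has_ms_integral M Z t u J"
    and K: "has_ms_integral M Z s u K"
  shows "l2_norm M (\<lambda>\<omega>. K \<omega> - (I \<omega> + J \<omega>)) = 0"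
proof -
  have so: "second_order M I" "second_order M J" "second_order M K"
    using I J K by (auto simp: has_ms_integral_def dest: ms_tendstoD)
  define U where "U = (\<lambda>\<omega>. K \<omega> - (I \<omega> + J \<omega>))"
  have U: "second_order M U"
    unfolding U_def by (intro second_order_diff second_order_add so)
  have "((\<lambda>x. \<integral>\<omega>. Z x \<omega> \<bullet> U \<omega> \<partial>M) has_integral
      (\<integral>\<omega>. I \<omega> \<bullet> U \<omega> \<partial>M) + (\<integral>\<omega>. J \<omega> \<bullet> U \<omega> \<partial>M)) {s..u}"
    using assms(2,3) has_ms_integral_imp_has_integral_inner[OF Z I U]
      has_ms_integral_imp_has_integral_inner[OF Z J U] by (rule has_integral_combine)
  then have "(\<integral>\<omega>. K \<omega> \<bullet> U \<omega> \<partial>M) = (\<integral>\<omega>. I \<omega> \<bullet> U \<omega> \<partial>M) + (\<integral>\<omega>. J \<omega> \<bullet> U \<omega> \<partial>M)"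
    using has_ms_integral_imp_has_integral_inner[OF Z K U] has_integral_unique by blast
  moreover have "(norm (U \<omega>))\<^sup>2 = K \<omega> \<bullet> U \<omega> - (I \<omega> \<bullet> U \<omega> + J \<omega> \<bullet> U \<omega>)" for \<omega>
    unfolding power2_norm_eq_inner U_def by (simp add: inner_diff_left inner_add_left)
  ultimately have "(l2_norm M U)\<^sup>2 = 0"
    using so U by (simp add: l2_norm_power2 integrable_inner_second_order)
  then show ?thesis by (simp add: U_def)
qed

section \<open>Existence of mean-square integrals\<close>

context prob_space
begin

text \<open>Uniform continuity is asked only between points on the same side of \<open>x0\<close>,
  so one jump is allowed. On a common refinement of two fine divisions, overlapping cells have
  nearby tags; their contributions differ by little, except when the tags straddle
  \<open>x0\<close>, and such cells have total length of order \<delta>.\<close>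

lemma has_ms_integral_exists:
  fixes Z :: "real \<Rightarrow> 'a \<Rightarrow> 'b::euclidean_space"
  assumes "s \<le> t"
    and Z: "\<And>x. x \<in> {s..t} \<Longrightarrow> second_order M (Z x)"
    and bdd: "\<And>x. x \<in> {s..t} \<Longrightarrow> l2_norm M (Z x) \<le> B"
    and cont: "\<And>\<epsilon>. \<epsilon> > 0 \<Longrightarrow> \<exists>\<delta>>0. \<forall>x\<in>{s..t}. \<forall>y\<in>{s..t}. \<bar>x - y\<bar> < \<delta> \<longrightarrow> (x < x0 \<longleftrightarrow> y < x0)
        \<longrightarrow> l2_norm M (\<lambda>\<omega>. Z x \<omega> - Z y \<omega>) \<le> \<epsilon>"
  shows "\<exists>I. has_ms_integral M Z s t I"
  unfolding has_ms_integral_def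
proof (rule ms_Cauchy_convergent[OF riemann_filter_neq_bot])
  let ?S = "\<lambda>p \<omega>. \<Sum>(x, K)\<in>p. measure lborel K *\<^sub>R Z x \<omega>"
  show "\<forall>\<^sub>F p in riemann_filter s t. second_order M (?S p)"
    unfolding eventually_riemann_filter
    using second_order_riemann_sum[of s t M Z] Z by (auto intro: exI[of _ 1])
  fix \<epsilon> :: real assume "\<epsilon> > 0"
  have "0 \<le> B" using bdd[of s] \<open>s \<le> t\<close> l2_norm_nonneg[of M "Z s"] by (auto simp del: l2_norm_nonneg)
  \<comment> \<open>Half of the tolerance goes to the continuous part, spread over the length of the
    interval; the added 1 covers \<open>s = t\<close>.\<close>
  define e where "e = \<epsilon> / (2 * (t - s + 1))"
  have "e > 0" using \<open>\<epsilon> > 0\<close> \<open>s \<le> t\<close> by (auto simp: e_def)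
  from cont[OF this] obtain d where d: "d > 0"
    "\<And>x y. x \<in> {s..t} \<Longrightarrow> y \<in> {s..t} \<Longrightarrow> \<bar>x - y\<bar> < d \<Longrightarrow> (x < x0 \<longleftrightarrow> y < x0)
        \<Longrightarrow> l2_norm M (\<lambda>\<omega>. Z x \<omega> - Z y \<omega>) \<le> e" by blast
  \<comment> \<open>The bound by \<open>d\<close> makes tags of overlapping cells close enough for
    \<open>cont\<close>; the other bound keeps the straddling cells, of length at most 8 \<delta>
    and contribution at most \<open>2 * B\<close> per unit length, below \<epsilon> / 2.\<close>
  define \<delta> where "\<delta> = min d (\<epsilon> / (16 * (B + 1))) / 2"
  have \<delta>: "\<delta> > 0" "2 * \<delta> \<le> d" and "2 * \<delta> \<le> \<epsilon> / (16 * (B + 1))"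
    using d(1) \<open>\<epsilon> > 0\<close> \<open>0 \<le> B\<close> by (auto simp: \<delta>_def)
  then have \<delta>3: "16 * (B + 1) * (2 * \<delta>) \<le> \<epsilon>"
    using \<open>0 \<le> B\<close> by (simp add: pos_le_divide_eq mult.commute)
  define P where "P p \<longleftrightarrow> p tagged_division_of {s..t} \<and> (\<lambda>x. ball x \<delta>) fine p" for p
  have "l2_norm M (\<lambda>\<omega>. ?S p \<omega> - ?S q \<omega>) \<le> \<epsilon>" if p: "P p" and q: "P q" for p q
  proof -
    have pt: "p tagged_division_of {s..t}" "q tagged_division_of {s..t}" and
      pf: "(\<lambda>x. ball x \<delta>) fine p" "(\<lambda>x. ball x \<delta>) fine q"
      using p q by (auto simp: P_def)
    have tags: "fst k \<in> {s..t}" if "k \<in> p \<or> k \<in> q" for k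
      using that tagged_division_ofD(2,3)[OF pt(1), of "fst k" "snd k"]
        tagged_division_ofD(2,3)[OF pt(2), of "fst k" "snd k"]
      by (metis prod.collapse subsetD)
    let ?c = "\<lambda>k l. measure lborel (snd k \<inter> snd l :: real set)"
    have cp: "measure lborel (snd k) = (\<Sum>l\<in>q. ?c k l)" if "k \<in> p" for k
      using content_eq_sum_Int[OF pt, of "fst k" "snd k"] that by (simp add: case_prod_unfold)
    have cq: "measure lborel (snd l) = (\<Sum>k\<in>p. ?c k l)" if "l \<in> q" for l
      using content_eq_sum_Int[OF pt(2,1), of "fst l" "snd l"] that
      by (simp add: case_prod_unfold Int_commute)
    have Sp: "?S p \<omega> = (\<Sum>k\<in>p. \<Sum>l\<in>q. ?c k l *\<^sub>R Z (fst k) \<omega>)" for \<omega>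
      using cp by (simp add: case_prod_unfold scaleR_sum_left)
    have Sq: "?S q \<omega> = (\<Sum>k\<in>p. \<Sum>l\<in>q. ?c k l *\<^sub>R Z (fst l) \<omega>)" for \<omega>
      using cq by (subst sum.swap) (simp add: case_prod_unfold scaleR_sum_left)
    let ?D = "\<lambda>k l \<omega>. Z (fst k) \<omega> - Z (fst l) \<omega>"
    have D: "second_order M (?D k l)" if "k \<in> p" "l \<in> q" for k l
      using tags that by (intro second_order_diff Z) auto
    have "l2_norm M (\<lambda>\<omega>. ?S p \<omega> - ?S q \<omega>) = l2_norm M (\<lambda>\<omega>. \<Sum>k\<in>p. \<Sum>l\<in>q. ?c k l *\<^sub>R ?D k l \<omega>)"
      unfolding Sp Sq by (simp add: sum_subtractf scaleR_diff_right)
    also have "\<dots> \<le> (\<Sum>k\<in>p. \<Sum>l\<in>q. l2_norm M (\<lambda>\<omega>. ?c k l *\<^sub>R ?D k l \<omega>))"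
      using D by (intro order_trans[OF l2_norm_sum_le] sum_mono l2_norm_sum_le second_order_sum
          second_order_scaleR) auto
    also have "\<dots> = (\<Sum>k\<in>p. \<Sum>l\<in>q. ?c k l * l2_norm M (?D k l))"
      by (simp add: l2_norm_scaleR)
    also have "\<dots> \<le> (\<Sum>k\<in>p. \<Sum>l\<in>q. ?c k l * (e + 2 * B * (if \<bar>fst k - x0\<bar> < 2 * \<delta> then 1 else 0)))"
    proof (intro sum_mono)
      fix k l assume kl: "k \<in> p" "l \<in> q"
      show "?c k l * l2_norm M (?D k l) \<le> ?c k l * (e + 2 * B * (if \<bar>fst k - x0\<bar> < 2 * \<delta> then 1 else 0))"
      proof (cases "snd k \<inter> snd l = {}")
        case False
        then obtain z where z: "z \<in> snd k" "z \<in> snd l" by auto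
        have "z \<in> ball (fst k) \<delta>" "z \<in> ball (fst l) \<delta>"
          using fineD[OF pf(1), of "fst k" "snd k"] fineD[OF pf(2), of "fst l" "snd l"] kl z by auto
        then have near: "\<bar>fst k - fst l\<bar> < 2 * \<delta>" by (auto simp: dist_real_def)
        have "l2_norm M (?D k l) \<le> e + 2 * B * (if \<bar>fst k - x0\<bar> < 2 * \<delta> then 1 else 0)"
        proof (cases "fst k < x0 \<longleftrightarrow> fst l < x0")
          case True
          have "l2_norm M (?D k l) \<le> e"
            using tags kl near \<delta>(2) True by (intro d(2)) auto
          then show ?thesis using \<open>0 \<le> B\<close> by simp
        next
          \<comment> \<open>Tags on opposite sides of \<open>x0\<close> and closer than 2 \<delta>
            are both within 2 \<delta> of \<open>x0\<close>; only the crude bound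
            \<open>2 * B\<close> is available here.\<close>
          case False
          then have "\<bar>fst k - x0\<bar> < 2 * \<delta>" using near by auto
          moreover have "l2_norm M (?D k l) \<le> 2 * B"
            using l2_norm_triangle_minus[OF Z Z, of "fst k" "fst l"] tags kl
              bdd[of "fst k"] bdd[of "fst l"] by auto
          ultimately show ?thesis using \<open>e > 0\<close> by simp
        qed
        then show ?thesis by (rule mult_left_mono) simp
      qed simp
    qed
    also have "\<dots> = (\<Sum>k\<in>p. measure lborel (snd k) * (e + 2 * B * (if \<bar>fst k - x0\<bar> < 2 * \<delta> then 1 else 0)))"
      using cp by (simp add: sum_distrib_right)
    also have "\<dots> = e * (\<Sum>(x, K)\<in>p. measure lborel K)
        + 2 * B * (\<Sum>(x, K)\<in>p. measure lborel K * (if \<bar>x - x0\<bar> < 2 * \<delta> then 1 else 0))"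
      unfolding sum_distrib_left sum.distrib[symmetric] case_prod_unfold
      by (intro sum.cong refl) (auto simp: algebra_simps)
    also have "\<dots> \<le> e * (t - s) + 2 * B * (4 * (2 * \<delta>))"
    proof (intro add_mono mult_left_mono)
      show "(\<Sum>(x, K)\<in>p. measure lborel K) \<le> t - s"
        using additive_content_tagged_division[of p s t] pt(1) \<open>s \<le> t\<close> by simp
      have "(\<lambda>x. ball x (2 * \<delta>)) fine p"
        using \<delta>(1) by (intro fineI order_trans[OF fineD[OF pf(1)] subset_ball]) auto
      then show "(\<Sum>(x, K)\<in>p. measure lborel K * (if \<bar>x - x0\<bar> < 2 * \<delta> then 1 else 0)) \<le> 4 * (2 * \<delta>)"
        using pt(1) \<delta>(1) by (intro sum_content_near_le) auto
    qed (use \<open>e > 0\<close> \<open>0 \<le> B\<close> in auto)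
    also have "\<dots> \<le> \<epsilon> / 2 + \<epsilon> / 2"
    proof (intro add_mono)
      show "e * (t - s) \<le> \<epsilon> / 2" using \<open>s \<le> t\<close> \<open>\<epsilon> > 0\<close> by (simp add: e_def field_simps)
      show "2 * B * (4 * (2 * \<delta>)) \<le> \<epsilon> / 2" using \<delta>(1) \<delta>3 by (simp add: algebra_simps)
    qed
    finally show ?thesis by simp
  qed
  moreover have "eventually P (riemann_filter s t)"
    unfolding eventually_riemann_filter P_def using \<delta>(1) by blast
  ultimately show "\<exists>P. eventually P (riemann_filter s t) \<and>
      (\<forall>p q. P p \<longrightarrow> P q \<longrightarrow> l2_norm M (\<lambda>\<omega>. ?S p \<omega> - ?S q \<omega>) \<le> \<epsilon>)"
    by blast
qed

text \<open>Enlarging an interval changes the integral by at most the increments of the primitive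
  \<open>G\<close> of the majorant at the two ends. Since \<open>G\<close> has limits at both
  infinities, the integrals over growing intervals are Cauchy.\<close>

lemma has_ms_integral_real_line_exists:
  fixes Z :: "real \<Rightarrow> 'a \<Rightarrow> 'b::euclidean_space"
  assumes Z: "\<And>x. second_order M (Z x)"
    and ex: "\<And>s t. s \<le> t \<Longrightarrow> \<exists>I. has_ms_integral M Z s t I"
    and h: "\<And>x. l2_norm M (Z x) \<le> h x" "\<And>s t. s \<le> t \<Longrightarrow> (h has_integral G t - G s) {s..t}"
    and lim: "(G \<longlongrightarrow> l) at_bot" "(G \<longlongrightarrow> r) at_top"
  shows "\<exists>I. has_ms_integral_real_line M Z I"
proof -
  obtain J where J: "\<And>s t. s \<le> t \<Longrightarrow> has_ms_integral M Z s t (J s t)"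
    using ex by metis
  have so: "second_order M (J s t)" if "s \<le> t" for s t
    using J[OF that] by (auto simp: has_ms_integral_def dest: ms_tendstoD)
  have bound: "l2_norm M (J s t) \<le> G t - G s" if "s \<le> t" for s t
    using has_ms_integral_l2_norm_le[OF Z J[OF that] h(1) h(2)[OF that]] .
  have nested: "l2_norm M (\<lambda>\<omega>. J s' t' \<omega> - J s t \<omega>) \<le> (G s - G s') + (G t' - G t)"
    if st: "s' \<le> s" "s \<le> t" "t \<le> t'" for s s' t t'
  proof -
    have leq: "s' \<le> t" "s' \<le> t'" using st by auto
    \<comment> \<open>\<open>D\<close> and \<open>E\<close> are the defects of additivity at t and
      at s. They have norm 0 but need not vanish pointwise, so they are kept as summands.\<close>
    define D where "D \<omega> = J s' t' \<omega> - (J s' t \<omega> + J t t' \<omega>)" for \<omega>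
    define E where "E \<omega> = J s' t \<omega> - (J s' s \<omega> + J s t \<omega>)" for \<omega>
    have D: "l2_norm M D = 0" "second_order M D"
      unfolding D_def using has_ms_integral_combine[OF Z leq(1) st(3) J J J, OF leq(1) st(3) leq(2)]
      by (auto intro!: second_order_diff second_order_add so leq st)
    have E: "l2_norm M E = 0" "second_order M E"
      unfolding E_def using has_ms_integral_combine[OF Z st(1,2) J J J, OF st(1,2) leq(1)]
      by (auto intro!: second_order_diff second_order_add so leq st)
    have eq: "(\<lambda>\<omega>. J s' t' \<omega> - J s t \<omega>) = (\<lambda>\<omega>. (D \<omega> + E \<omega>) + (J s' s \<omega> + J t t' \<omega>))"
      by (simp add: D_def E_def)
    have "l2_norm M (\<lambda>\<omega>. J s' t' \<omega> - J s t \<omega>)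
        \<le> (l2_norm M D + l2_norm M E) + (l2_norm M (J s' s) + l2_norm M (J t t'))"
      unfolding eq
      by (intro order_trans[OF l2_norm_triangle] add_mono l2_norm_triangle second_order_add so D E st)
    then show ?thesis using D E bound[OF st(1)] bound[OF st(3)] by simp
  qed
  have "\<exists>I. ms_tendsto M (\<lambda>(s, t). J s t) I (at_bot \<times>\<^sub>F at_top)"
  proof (rule ms_Cauchy_convergent)
    have le: "\<forall>\<^sub>F (s, t) in at_bot \<times>\<^sub>F at_top. s \<le> (t::real)"
      unfolding eventually_prod_filter using eventually_le_at_bot[of "0::real"] eventually_ge_at_top[of "0::real"]
      by (intro exI[of _ "\<lambda>s. s \<le> 0"] exI[of _ "\<lambda>t. 0 \<le> t"]) auto
    show "at_bot \<times>\<^sub>F at_top \<noteq> (bot :: (real \<times> real) filter)"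
      by (simp add: prod_filter_eq_bot)
    show "\<forall>\<^sub>F i in at_bot \<times>\<^sub>F at_top. second_order M (case i of (s, t) \<Rightarrow> J s t)"
      using le by eventually_elim (use so in auto)
    fix \<epsilon> :: real assume "\<epsilon> > 0"
    then have "\<forall>\<^sub>F s in at_bot. dist (G s) l < \<epsilon> / 8" "\<forall>\<^sub>F t in at_top. dist (G t) r < \<epsilon> / 8"
      using tendstoD[OF lim(1), of "\<epsilon> / 8"] tendstoD[OF lim(2), of "\<epsilon> / 8"] by auto
    then obtain S T where S: "\<And>s. s \<le> S \<Longrightarrow> dist (G s) l < \<epsilon> / 8"
      and T: "\<And>t. T \<le> t \<Longrightarrow> dist (G t) r < \<epsilon> / 8"
      unfolding eventually_at_bot_linorder eventually_at_top_linorder by blast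
    define P where "P i \<longleftrightarrow> fst i \<le> min S T \<and> T \<le> snd i" for i :: "real \<times> real"
    have near: "l2_norm M (\<lambda>\<omega>. J s' t' \<omega> - J s t \<omega>) \<le> \<epsilon> / 2"
      if "s' \<le> s" "s \<le> min S T" "T \<le> t" "t \<le> t'" for s s' t t'
      using nested[of s' s t t'] S[of s] S[of s'] T[of t] T[of t'] that
      by (simp add: dist_real_def abs_if split: if_splits)
    have "eventually P (at_bot \<times>\<^sub>F at_top)"
      unfolding eventually_prod_filter P_def
      using eventually_le_at_bot[of "min S T"] eventually_ge_at_top[of T] by force
    moreover have "l2_norm M (\<lambda>\<omega>. (case i of (s, t) \<Rightarrow> J s t) \<omega> - (case j of (s, t) \<Rightarrow> J s t) \<omega>) \<le> \<epsilon>"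
      if "P i" "P j" for i j
    proof -
      obtain s t s' t' where ij: "i = (s, t)" "j = (s', t')" by (cases i, cases j)
      have st: "s \<le> min S T" "T \<le> t" "s' \<le> min S T" "T \<le> t'" using that by (auto simp: P_def ij)
      then have leq: "s \<le> t" "s' \<le> t'" "min s s' \<le> max t t'" by auto
      \<comment> \<open>Two intervals need not be nested; both are compared with an interval
        containing them. Each comparison costs at most \<epsilon> / 2, from four deviations of
        \<open>G\<close> below \<epsilon> / 8.\<close>
      let ?m = "J (min s s') (max t t')"
      have "l2_norm M (\<lambda>\<omega>. J s t \<omega> - J s' t' \<omega>)
          \<le> l2_norm M (\<lambda>\<omega>. J s t \<omega> - ?m \<omega>) + l2_norm M (\<lambda>\<omega>. ?m \<omega> - J s' t' \<omega>)"
        by (intro l2_norm_triangle_diff so leq)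
      also have "l2_norm M (\<lambda>\<omega>. J s t \<omega> - ?m \<omega>) = l2_norm M (\<lambda>\<omega>. ?m \<omega> - J s t \<omega>)"
        by (rule l2_norm_minus_commute)
      finally show ?thesis
        unfolding ij using near[of "min s s'" s t "max t t'"] near[of "min s s'" s' t' "max t t'"] st by simp
    qed
    ultimately show "\<exists>P. eventually P (at_bot \<times>\<^sub>F at_top) \<and> (\<forall>i j. P i \<longrightarrow> P j \<longrightarrow>
        l2_norm M (\<lambda>\<omega>. (case i of (s, t) \<Rightarrow> J s t) \<omega> - (case j of (s, t) \<Rightarrow> J s t) \<omega>) \<le> \<epsilon>)"
      by blast
  qed
  then show ?thesis unfolding has_ms_integral_real_line_def using J by blast
qed

end

section \<open>Logarithmic moments of the exponential law\<close>

text \<open>A Frullani integral: the positive kernel e^(-s(1+u)) is integrated over s > 0 and 0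
  \<le> u \<le> y in both orders. It writes the logarithm as a mixture of the functions 1 - e^(-sy),
  so only Laplace transforms matter afterwards.\<close>

lemma nn_integral_ln_one_plus:
  assumes "0 \<le> y"
  shows "(\<integral>\<^sup>+s. ennreal (indicator {0<..} s * ((1 - exp (- s * y)) * exp (- s) / s)) \<partial>lborel)
    = ennreal (ln (1 + y))"
proof -
  have inner: "ennreal (indicator {0<..} s * ((1 - exp (- s * y)) * exp (- s) / s))
      = (\<integral>\<^sup>+u. ennreal (indicator {0<..} s * exp (- s * (1 + u))) * indicator {0..y} u \<partial>lborel)" for s :: real
  proof (cases "s > 0")
    case True
    have deriv: "((\<lambda>u. - exp (- s * (1 + u)) / s) has_real_derivative exp (- s * (1 + u))) (at u)" for u
      using True by (auto intro!: derivative_eq_intros)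
    have "(\<integral>\<^sup>+u. ennreal (exp (- s * (1 + u))) * indicator {0..y} u \<partial>lborel)
        = ennreal (- exp (- s * (1 + y)) / s - (- exp (- s * (1 + 0)) / s))"
      using assms by (intro nn_integral_FTC_Icc[OF _ deriv]) auto
    also have "- exp (- s * (1 + y)) / s - (- exp (- s * (1 + 0)) / s) = (1 - exp (- s * y)) * exp (- s) / s"
      using True by (simp add: field_simps flip: exp_add)
    finally show ?thesis using True by simp
  qed simp
  have outer: "(\<integral>\<^sup>+s. ennreal (indicator {0<..} s * exp (- s * (1 + u))) * indicator {0..y} u \<partial>lborel)
      = ennreal (1 / (1 + u)) * indicator {0..y} u" for u :: real
  proof (cases "u \<in> {0..y}")
    case True
    have "(\<integral>\<^sup>+s. ennreal (indicator {0<..} s * exp (- s * (1 + u))) \<partial>lborel)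
        = (\<integral>\<^sup>+s. ennreal (exp (- s * (1 + u))) * indicator {0..} s \<partial>lborel)"
      by (rule nn_integral_cong_AE, rule AE_mp[OF AE_lborel_singleton[of 0]])
        (auto simp: indicator_def)
    also have "\<dots> = ennreal (0 - (- exp (- 0 * (1 + u)) / (1 + u)))"
    proof (rule nn_integral_FTC_atLeast)
      fix s :: real
      show "((\<lambda>s. - exp (- s * (1 + u)) / (1 + u)) has_real_derivative exp (- s * (1 + u))) (at s)"
        using True by (auto intro!: derivative_eq_intros simp: add_nonneg_eq_0_iff field_simps)
      show "((\<lambda>s. - exp (- s * (1 + u)) / (1 + u)) \<longlongrightarrow> 0) at_top"
        using True by real_asymp
    qed auto
    finally show ?thesis using True by simp
  qed simp
  have "(\<integral>\<^sup>+s. ennreal (indicator {0<..} s * ((1 - exp (- s * y)) * exp (- s) / s)) \<partial>lborel)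
      = (\<integral>\<^sup>+u. \<integral>\<^sup>+s. ennreal (indicator {0<..} s * exp (- s * (1 + u))) * indicator {0..y} u \<partial>lborel \<partial>lborel)"
    unfolding inner by (rule lborel_pair.Fubini') measurable
  also have "\<dots> = (\<integral>\<^sup>+u. ennreal (1 / (1 + u)) * indicator {0..y} u \<partial>lborel)"
    unfolding outer ..
  also have "\<dots> = ennreal (ln (1 + y) - ln (1 + 0))"
  proof (rule nn_integral_FTC_Icc[where F = "\<lambda>u. ln (1 + u)"])
    fix u :: real assume "u \<in> {0..y}"
    then show "((\<lambda>u. ln (1 + u)) has_real_derivative 1 / (1 + u)) (at u)"
      by (auto intro!: derivative_eq_intros)
  qed (use assms in auto)
  finally show ?thesis by simp
qed

text \<open>Two variables, possibly on different spaces, with the same Laplace transform therefore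
  have the same mean of ln(1 + V); no uniqueness theorem for laws is invoked.\<close>

lemma (in prob_space) nn_integral_ln_one_plus_laplace:
  assumes [measurable]: "V \<in> borel_measurable M" and V: "\<And>\<omega>. 0 \<le> V \<omega>"
  shows "(\<integral>\<^sup>+\<omega>. ennreal (ln (1 + V \<omega>)) \<partial>M)
    = (\<integral>\<^sup>+s. ennreal (indicator {0<..} s * (exp (- s) / s) * (1 - (\<integral>\<omega>. exp (- s * V \<omega>) \<partial>M))) \<partial>lborel)"
proof -
  interpret pair_sigma_finite M lborel ..
  have "(\<integral>\<^sup>+\<omega>. ennreal (ln (1 + V \<omega>)) \<partial>M)
      = (\<integral>\<^sup>+\<omega>. \<integral>\<^sup>+s. ennreal (indicator {0<..} s * ((1 - exp (- s * V \<omega>)) * exp (- s) / s)) \<partial>lborel \<partial>M)"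
    using nn_integral_ln_one_plus[OF V] by simp
  also have "\<dots> = (\<integral>\<^sup>+s. \<integral>\<^sup>+\<omega>. ennreal (indicator {0<..} s * ((1 - exp (- s * V \<omega>)) * exp (- s) / s)) \<partial>M \<partial>lborel)"
    by (rule Fubini'[symmetric]) measurable
  also have "\<dots> = (\<integral>\<^sup>+s. ennreal (indicator {0<..} s * (exp (- s) / s) * (1 - (\<integral>\<omega>. exp (- s * V \<omega>) \<partial>M))) \<partial>lborel)"
  proof (rule nn_integral_cong)
    fix s :: real
    show "(\<integral>\<^sup>+\<omega>. ennreal (indicator {0<..} s * ((1 - exp (- s * V \<omega>)) * exp (- s) / s)) \<partial>M)
        = ennreal (indicator {0<..} s * (exp (- s) / s) * (1 - (\<integral>\<omega>. exp (- s * V \<omega>) \<partial>M)))"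
    proof (cases "s > 0")
      case True
      have bound: "exp (- s * V \<omega>) \<le> 1" for \<omega> using True V[of \<omega>] by simp
      have int: "integrable M (\<lambda>\<omega>. exp (- s * V \<omega>))"
        by (rule integrable_const_bound[where B = 1]) (use bound in auto)
      have "(\<integral>\<^sup>+\<omega>. ennreal ((1 - exp (- s * V \<omega>)) * exp (- s) / s) \<partial>M)
          = ennreal (\<integral>\<omega>. (1 - exp (- s * V \<omega>)) * exp (- s) / s \<partial>M)"
        using bound True int by (intro nn_integral_eq_integral AE_I2) auto
      also have "(\<integral>\<omega>. (1 - exp (- s * V \<omega>)) * exp (- s) / s \<partial>M)
          = (1 - (\<integral>\<omega>. exp (- s * V \<omega>) \<partial>M)) * exp (- s) / s"
        using int by (simp add: prob_space)
      finally show ?thesis using True by (simp add: mult.commute)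
    qed simp
  qed
  finally show ?thesis .
qed

text \<open>The tangent at y = ln q of the convex function y -> ln(1 + x e^y), whose slope there is
  l = xq/(1 + xq). Convexity is used as the weighted inequality of arithmetic and geometric means,
  applied to t/q and 1 with weights l and 1 - l.\<close>

lemma ln_one_plus_ge_tangent:
  fixes x q t :: real
  assumes "x > 0" "q > 0" "t > 0"
  shows "ln (1 + x * q) + x * q / (1 + x * q) * (ln t - ln q) \<le> ln (1 + x * t)"
proof -
  define l where "l = x * q / (1 + x * q)"
  have pos: "1 + x * q > 0" "1 + x * t > 0" using assms by (simp_all add: add_pos_pos)
  then have l1: "1 - l = 1 / (1 + x * q)" by (simp add: l_def field_simps)
  have l: "0 \<le> l" "l \<le> 1" using assms pos by (simp_all add: l_def)
  have "(t / q) powr l \<le> l * (t / q) + (1 - l) * 1"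
    using Youngs_inequality_0[of l "1 - l" "t / q" 1] l assms by simp
  also have "\<dots> = (1 + x * t) / (1 + x * q)"
    unfolding l1 using assms pos by (simp add: l_def field_simps)
  finally have "ln ((t / q) powr l) \<le> ln ((1 + x * t) / (1 + x * q))"
    using assms by (intro ln_mono) auto
  then show ?thesis
    using assms pos by (simp add: ln_powr ln_div l_def[symmetric])
qed

section \<open>The unit exponential law and Euler's constant\<close>

definition unit_exponential :: "real measure"
  where "unit_exponential = density lborel (exponential_density 1)"

lemma prob_space_unit_exponential: "prob_space unit_exponential"
  unfolding unit_exponential_def by (rule prob_space_exponential_density) simp

lemma sets_unit_exponential [simp, measurable_cong]: "sets unit_exponential = sets borel"
  by (simp add: unit_exponential_def)

lemma nn_integral_unit_exponential:
  assumes [measurable]: "f \<in> borel_measurable borel"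
  shows "(\<integral>\<^sup>+t. f t \<partial>unit_exponential) = (\<integral>\<^sup>+t. ennreal (exp (- t)) * f t * indicator {0..} t \<partial>lborel)"
  unfolding unit_exponential_def
  by (subst nn_integral_density) (auto intro!: nn_integral_cong simp: exponential_density_def)

text \<open>Euler's integral for Gamma. Exponents in (-1, 0) are included because the logarithm is
  approximated by negative powers. The absolute value keeps later integrands nonnegative on the
  whole line; the law itself lives on t \<ge> 0.\<close>

lemma unit_exponential_moment:
  assumes "r > - 1"
  shows "has_bochner_integral unit_exponential (\<lambda>t. \<bar>t\<bar> powr r) (Gamma (r + 1))"
proof (rule has_bochner_integral_nn_integral)
  show "(\<integral>\<^sup>+t. ennreal (\<bar>t\<bar> powr r) \<partial>unit_exponential) = ennreal (Gamma (r + 1))"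
    using assms by (subst nn_integral_unit_exponential)
      (auto simp: Gamma_conv_nn_integral_real exp_minus field_simps indicator_def
        intro!: nn_integral_cong simp flip: ennreal_mult)
qed (use assms in \<open>auto intro!: less_imp_le Gamma_real_pos\<close>)

lemma laplace_unit_exponential:
  assumes "x \<ge> 0"
  shows "(\<integral>t. exp (- x * \<bar>t\<bar>) \<partial>unit_exponential) = 1 / (1 + x)"
proof (rule has_bochner_integral_integral_eq, rule has_bochner_integral_nn_integral)
  have "(\<integral>\<^sup>+t. ennreal (exp (- x * \<bar>t\<bar>)) \<partial>unit_exponential)
      = (\<integral>\<^sup>+t. ennreal (exp (- t * (1 + x))) * indicator {0..} t \<partial>lborel)"
    by (subst nn_integral_unit_exponential)
      (auto intro!: nn_integral_cong simp: indicator_def algebra_simps simp flip: ennreal_mult exp_add)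
  also have "\<dots> = ennreal (0 - (- exp (- 0 * (1 + x)) / (1 + x)))"
  proof (rule nn_integral_FTC_atLeast)
    fix t :: real
    show "((\<lambda>t. - exp (- t * (1 + x)) / (1 + x)) has_real_derivative exp (- t * (1 + x))) (at t)"
      using assms by (auto intro!: derivative_eq_intros simp: add_nonneg_eq_0_iff field_simps)
    show "((\<lambda>t. - exp (- t * (1 + x)) / (1 + x)) \<longlongrightarrow> 0) at_top"
      using assms by real_asymp
  qed auto
  finally show "(\<integral>\<^sup>+t. ennreal (exp (- x * \<bar>t\<bar>)) \<partial>unit_exponential) = ennreal (1 / (1 + x))"
    by simp
qed (use assms in auto)

lemma integrable_ln_one_plus:
  fixes V :: "'a \<Rightarrow> real"
  assumes "integrable M V" "\<And>\<omega>. 0 \<le> V \<omega>"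
  shows "integrable M (\<lambda>\<omega>. ln (1 + V \<omega>))"
proof (rule Bochner_Integration.integrable_bound[OF assms(1)])
  show "(\<lambda>\<omega>. ln (1 + V \<omega>)) \<in> borel_measurable M"
    using borel_measurable_integrable[OF assms(1)] by measurable
  show "AE \<omega> in M. norm (ln (1 + V \<omega>)) \<le> norm (V \<omega>)"
    using assms(2) ln_add_one_self_le_self by (intro AE_I2) (simp add: abs_of_nonneg)
qed

text \<open>The tangent inequality is averaged with ln t replaced by its lower bound (1 - t^(-h))/h.
  The mean of that bound is (1 - Gamma(1 - h))/h, which tends to Gamma'(1) = -gamma as h decreases
  to 0, so no differentiation under the integral sign is needed.\<close>

lemma integral_ln_one_plus_unit_exponential_ge:
  assumes "x > 0"
  shows "ln (1 + x * exp (- euler_mascheroni)) \<le> (\<integral>t. ln (1 + x * \<bar>t\<bar>) \<partial>unit_exponential)"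
proof -
  interpret prob_space unit_exponential by (rule prob_space_unit_exponential)
  \<comment> \<open>The tangent is taken at ln q = -gamma, the mean of ln t, so that the linear term
    disappears in the limit.\<close>
  define q where "q = exp (- euler_mascheroni :: real)"
  define l where "l = x * q / (1 + x * q)"
  have q: "q > 0" "ln q = - euler_mascheroni" by (simp_all add: q_def)
  have l: "l \<ge> 0" using assms q by (simp add: l_def)
  have int: "integrable unit_exponential (\<lambda>t. ln (1 + x * \<bar>t\<bar>))"
  proof (rule integrable_ln_one_plus)
    have "integrable unit_exponential (\<lambda>t. \<bar>t\<bar> powr 1)"
      using unit_exponential_moment[of 1] by (auto simp: has_bochner_integral_iff)
    then show "integrable unit_exponential (\<lambda>t. x * \<bar>t\<bar>)" by simp
  qed (use assms in simp)
  have lower: "ln (1 + x * q) + l * ((1 - Gamma (1 - h)) / h + euler_mascheroni)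
      \<le> (\<integral>t. ln (1 + x * \<bar>t\<bar>) \<partial>unit_exponential)" if h: "0 < h" "h < 1" for h
  proof -
    have m: "integrable unit_exponential (\<lambda>t. \<bar>t\<bar> powr (- h))"
      "(\<integral>t. \<bar>t\<bar> powr (- h) \<partial>unit_exponential) = Gamma (1 - h)"
      using unit_exponential_moment[of "- h"] h by (auto simp: has_bochner_integral_iff)
    have "ln (1 + x * q) + l * ((1 - Gamma (1 - h)) / h + euler_mascheroni)
        = (\<integral>t. ln (1 + x * q) + l * ((1 - \<bar>t\<bar> powr (- h)) / h + euler_mascheroni) \<partial>unit_exponential)"
      using m by (simp add: prob_space)
    also have "\<dots> \<le> (\<integral>t. ln (1 + x * \<bar>t\<bar>) \<partial>unit_exponential)"
    proof (rule integral_mono_AE)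
      have "AE t in lborel. t \<noteq> (0::real)" by (rule AE_lborel_singleton)
      then have "AE t in unit_exponential. t \<noteq> 0"
        unfolding unit_exponential_def by (subst AE_density) auto
      then show "AE t in unit_exponential.
          ln (1 + x * q) + l * ((1 - \<bar>t\<bar> powr (- h)) / h + euler_mascheroni) \<le> ln (1 + x * \<bar>t\<bar>)"
      proof eventually_elim
        case (elim t)
        then have t: "\<bar>t\<bar> > 0" by simp
        \<comment> \<open>This is 1 + y \<le> e^y for y = -h ln t; dividing by h gives the lower
          bound for the logarithm.\<close>
        have "- h * ln \<bar>t\<bar> \<le> \<bar>t\<bar> powr (- h) - 1"
          using ln_le_minus_one[of "\<bar>t\<bar> powr (- h)"] t by (simp add: ln_powr)
        then have "(1 - \<bar>t\<bar> powr (- h)) / h \<le> ln \<bar>t\<bar>" using h by (simp add: field_simps)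
        then have "l * ((1 - \<bar>t\<bar> powr (- h)) / h + euler_mascheroni) \<le> l * (ln \<bar>t\<bar> - ln q)"
          using l q by (intro mult_left_mono) auto
        then show ?case
          using ln_one_plus_ge_tangent[OF assms q(1) t] unfolding l_def by linarith
      qed
    qed (use m int in auto)
    finally show ?thesis .
  qed
  have "(Gamma has_real_derivative Gamma 1 * Digamma 1) (at (1::real))"
    by (rule has_field_derivative_Gamma) auto
  then have "((\<lambda>h. (Gamma (1 + h) - Gamma 1) / h) \<longlongrightarrow> - euler_mascheroni) (at (0::real))"
    unfolding DERIV_def by simp
  moreover have "filterlim (\<lambda>h. - h) (at 0) (at_right (0::real))"
    using tendsto_minus[OF tendsto_ident_at[of "0::real" "{0<..}"]]
    by (simp add: filterlim_at eventually_at_filter)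
  ultimately have "((\<lambda>h. (Gamma (1 + - h) - Gamma 1) / (- h)) \<longlongrightarrow> - euler_mascheroni) (at_right (0::real))"
    by (rule filterlim_compose)
  moreover have "(Gamma (1 + - h) - Gamma 1) / (- h) = (1 - Gamma (1 - h)) / h" for h :: real
    by (simp add: minus_divide_left)
  ultimately have "((\<lambda>h. (1 - Gamma (1 - h)) / h) \<longlongrightarrow> - euler_mascheroni) (at_right (0::real))"
    by simp
  then have "((\<lambda>h. ln (1 + x * q) + l * ((1 - Gamma (1 - h)) / h + euler_mascheroni))
      \<longlongrightarrow> ln (1 + x * q) + l * (- euler_mascheroni + euler_mascheroni)) (at_right (0::real))"
    by (intro tendsto_intros)
  then have "ln (1 + x * q) + l * (- euler_mascheroni + euler_mascheroni)
      \<le> (\<integral>t. ln (1 + x * \<bar>t\<bar>) \<partial>unit_exponential)"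
  proof (rule tendsto_upperbound)
    show "\<forall>\<^sub>F h in at_right (0::real). ln (1 + x * q) + l * ((1 - Gamma (1 - h)) / h + euler_mascheroni)
        \<le> (\<integral>t. ln (1 + x * \<bar>t\<bar>) \<partial>unit_exponential)"
      unfolding eventually_at_right_field using lower by (intro exI[of _ 1]) auto
  qed simp
  then show ?thesis by (simp add: q_def)
qed

context prob_space
begin

text \<open>The prescribed Laplace transform is that of x times a unit exponential variable, so the
  mean of ln(1 + V) can be computed in the exponential model.\<close>

lemma integral_ln_one_plus_ge:
  fixes V :: "'a \<Rightarrow> real"
  assumes V: "integrable M V" "\<And>\<omega>. 0 \<le> V \<omega>" and "x > 0"
    and laplace: "\<And>s. s > 0 \<Longrightarrow> (\<integral>\<omega>. exp (- s * V \<omega>) \<partial>M) = 1 / (1 + s * x)"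
  shows "ln (1 + x * exp (- euler_mascheroni)) \<le> (\<integral>\<omega>. ln (1 + V \<omega>) \<partial>M)"
proof -
  interpret E: prob_space unit_exponential by (rule prob_space_unit_exponential)
  note [measurable] = borel_measurable_integrable[OF V(1)]
  have "(\<integral>\<^sup>+\<omega>. ennreal (ln (1 + V \<omega>)) \<partial>M) = (\<integral>\<^sup>+t. ennreal (ln (1 + x * \<bar>t\<bar>)) \<partial>unit_exponential)"
    using laplace laplace_unit_exponential \<open>x > 0\<close>
    by (subst nn_integral_ln_one_plus_laplace[OF _ V(2)], simp,
        subst E.nn_integral_ln_one_plus_laplace)
      (auto intro!: nn_integral_cong simp: indicator_def mult.assoc[symmetric])
  then have "(\<integral>\<omega>. ln (1 + V \<omega>) \<partial>M) = (\<integral>t. ln (1 + x * \<bar>t\<bar>) \<partial>unit_exponential)"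
    using V(2) \<open>x > 0\<close> by (subst (1 2) integral_eq_nn_integral) auto
  then show ?thesis using integral_ln_one_plus_unit_exponential_ge[OF \<open>x > 0\<close>] by simp
qed

lemma integral_ln_one_plus_le:
  fixes V :: "'a \<Rightarrow> real"
  assumes V: "integrable M V" "\<And>\<omega>. 0 \<le> V \<omega>"
  shows "(\<integral>\<omega>. ln (1 + V \<omega>) \<partial>M) \<le> ln (1 + (\<integral>\<omega>. V \<omega> \<partial>M))"
proof -
  define m where "m = (\<integral>\<omega>. V \<omega> \<partial>M)"
  have m: "m \<ge> 0" unfolding m_def using V(2) by simp
  \<comment> \<open>Jensen's inequality through the tangent of the logarithm at 1 + m, whose linear
    part has mean 0.\<close>
  have "(\<integral>\<omega>. ln (1 + V \<omega>) \<partial>M) \<le> (\<integral>\<omega>. ln (1 + m) + (V \<omega> - m) / (1 + m) \<partial>M)"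
  proof (rule integral_mono[OF integrable_ln_one_plus[OF V]])
    fix \<omega>
    have "ln ((1 + V \<omega>) / (1 + m)) \<le> (1 + V \<omega>) / (1 + m) - 1"
      using m V(2)[of \<omega>] by (intro ln_le_minus_one) auto
    then show "ln (1 + V \<omega>) \<le> ln (1 + m) + (V \<omega> - m) / (1 + m)"
      using m V(2)[of \<omega>] by (simp add: ln_div field_simps)
  qed (use V(1) in auto)
  also have "\<dots> = ln (1 + m)"
    using V(1) by (simp add: prob_space m_def)
  finally show ?thesis by (simp add: m_def)
qed

end

section \<open>Proper complex Gaussian variables\<close>

text \<open>
  Encoded by the characteristic function: real and imaginary part are independent centred
  Gaussians of variance \<open>E |Z|\<^sup>2 / 2\<close> each. In this form it passes to mean-square limits at once.
\<close>

definition proper_gaussian :: "'a measure \<Rightarrow> ('a \<Rightarrow> complex) \<Rightarrow> bool"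
  where "proper_gaussian M Z \<longleftrightarrow> second_order M Z \<and>
    (\<forall>u v. (\<integral>\<omega>. iexp (u * Re (Z \<omega>) + v * Im (Z \<omega>)) \<partial>M)
      = complex_of_real (exp (- (u\<^sup>2 + v\<^sup>2) * (l2_norm M Z)\<^sup>2 / 4)))"

text \<open>Serves twice: for the continuity of characteristic functions under mean-square limits,
  and for the dependence of the Fourier kernel on the frequency.\<close>

lemma norm_iexp_diff_le: "cmod (iexp x - iexp y) \<le> \<bar>x - y\<bar>"
proof -
  have "iexp x - iexp y = iexp y * (iexp (x - y) - 1)"
    by (simp add: algebra_simps flip: exp_add)
  then have "cmod (iexp x - iexp y) = cmod (iexp (x - y) - 1)"
    by (simp add: norm_mult)
  also have "\<dots> \<le> \<bar>x - y\<bar>" using iexp_approx1[of "x - y" 0] by simp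
  finally show ?thesis .
qed

context prob_space
begin

text \<open>Both sides of the defining identity converge: characteristic functions are Lipschitz in
  the first absolute moment of the difference, which \<open>l2_norm\<close> dominates, and the
  right-hand side is continuous in \<open>l2_norm\<close>.\<close>

lemma proper_gaussian_ms_tendsto:
  assumes F: "F \<noteq> bot" and lim: "ms_tendsto M S L F" and S: "\<forall>\<^sub>F i in F. proper_gaussian M (S i)"
  shows "proper_gaussian M L"
  unfolding proper_gaussian_def
proof (intro conjI allI)
  show L: "second_order M L" by (rule ms_tendstoD[OF lim])
  fix u v :: real
  let ?e = "\<lambda>Z. \<integral>\<omega>. iexp (u * Re (Z \<omega>) + v * Im (Z \<omega>)) \<partial>M"
  have to_L: "((\<lambda>i. ?e (S i)) \<longlongrightarrow> ?e L) F"
  proof (rule LIM_zero_cancel, rule Lim_null_comparison)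
    show "\<forall>\<^sub>F i in F. cmod (?e (S i) - ?e L) \<le> (\<bar>u\<bar> + \<bar>v\<bar>) * l2_norm M (\<lambda>\<omega>. S i \<omega> - L \<omega>)"
      using ms_tendstoD(2)[OF lim]
    proof eventually_elim
      case (elim i)
      note [measurable] = second_orderD(1)[OF elim] second_orderD(1)[OF L]
      have D: "second_order M (\<lambda>\<omega>. S i \<omega> - L \<omega>)" by (rule second_order_diff[OF elim L])
      have int: "integrable M (\<lambda>\<omega>. iexp (u * Re (Z \<omega>) + v * Im (Z \<omega>)))"
        if [measurable]: "Z \<in> borel_measurable M" for Z :: "'a \<Rightarrow> complex"
        by (rule integrable_iexp) measurable
      have "?e (S i) - ?e L = (\<integral>\<omega>. iexp (u * Re (S i \<omega>) + v * Im (S i \<omega>))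
          - iexp (u * Re (L \<omega>) + v * Im (L \<omega>)) \<partial>M)"
        by (rule Bochner_Integration.integral_diff[symmetric]) (rule int, measurable)+
      also have "cmod \<dots> \<le> (\<integral>\<omega>. (\<bar>u\<bar> + \<bar>v\<bar>) * cmod (S i \<omega> - L \<omega>) \<partial>M)"
      proof (rule order_trans[OF integral_norm_bound integral_mono])
        fix \<omega>
        have "cmod (iexp (u * Re (S i \<omega>) + v * Im (S i \<omega>)) - iexp (u * Re (L \<omega>) + v * Im (L \<omega>)))
            \<le> \<bar>u * Re (S i \<omega> - L \<omega>) + v * Im (S i \<omega> - L \<omega>)\<bar>"
          by (rule order_trans[OF norm_iexp_diff_le]) (simp add: algebra_simps)
        also have "\<dots> \<le> \<bar>u\<bar> * \<bar>Re (S i \<omega> - L \<omega>)\<bar> + \<bar>v\<bar> * \<bar>Im (S i \<omega> - L \<omega>)\<bar>"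
          by (rule order_trans[OF abs_triangle_ineq]) (simp only: abs_mult)
        also have "\<dots> \<le> (\<bar>u\<bar> + \<bar>v\<bar>) * cmod (S i \<omega> - L \<omega>)"
          unfolding distrib_right by (intro add_mono mult_left_mono abs_Re_le_cmod abs_Im_le_cmod) auto
        finally show "cmod (iexp (u * Re (S i \<omega>) + v * Im (S i \<omega>)) - iexp (u * Re (L \<omega>) + v * Im (L \<omega>)))
            \<le> (\<bar>u\<bar> + \<bar>v\<bar>) * cmod (S i \<omega> - L \<omega>)" .
      qed (use int nn_integral_norm_le_l2_norm(2)[OF D] in auto)
      also have "\<dots> \<le> (\<bar>u\<bar> + \<bar>v\<bar>) * l2_norm M (\<lambda>\<omega>. S i \<omega> - L \<omega>)"
        using nn_integral_norm_le_l2_norm(3)[OF D] by (simp add: mult_left_mono)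
      finally show ?case .
    qed
    show "((\<lambda>i. (\<bar>u\<bar> + \<bar>v\<bar>) * l2_norm M (\<lambda>\<omega>. S i \<omega> - L \<omega>)) \<longlongrightarrow> 0) F"
      using tendsto_mult_right_zero[OF ms_tendsto_l2_norm[OF lim]] .
  qed
  have "((\<lambda>i. complex_of_real (exp (- (u\<^sup>2 + v\<^sup>2) * (l2_norm M (S i))\<^sup>2 / 4)))
      \<longlongrightarrow> complex_of_real (exp (- (u\<^sup>2 + v\<^sup>2) * (l2_norm M L)\<^sup>2 / 4))) F"
    by (intro tendsto_intros tendsto_l2_norm[OF lim]) auto
  moreover have "\<forall>\<^sub>F i in F. complex_of_real (exp (- (u\<^sup>2 + v\<^sup>2) * (l2_norm M (S i))\<^sup>2 / 4)) = ?e (S i)"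
    using S by eventually_elim (simp add: proper_gaussian_def)
  ultimately have "((\<lambda>i. ?e (S i)) \<longlongrightarrow> complex_of_real (exp (- (u\<^sup>2 + v\<^sup>2) * (l2_norm M L)\<^sup>2 / 4))) F"
    by (rule Lim_transform_eventually)
  with F to_L show "?e L = complex_of_real (exp (- (u\<^sup>2 + v\<^sup>2) * (l2_norm M L)\<^sup>2 / 4))"
    by (rule tendsto_unique)
qed

end

lemma integral_exp_std_normal:
  assumes "0 \<le> k"
  shows "(\<integral>x. exp (- k * x\<^sup>2) \<partial>std_normal_distribution) = 1 / sqrt (1 + 2 * k)"
proof -
  \<comment> \<open>The factor exp(-k x^2) turns the standard normal density into a multiple of the
    centred one with variance 1/(1 + 2k).\<close>
  define \<sigma> where "\<sigma> = 1 / sqrt (1 + 2 * k)"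
  have \<sigma>: "\<sigma> > 0" "\<sigma>\<^sup>2 = 1 / (1 + 2 * k)" using assms by (auto simp: \<sigma>_def power_divide)
  have "std_normal_density x * exp (- k * x\<^sup>2) = \<sigma> * normal_density 0 \<sigma> x" for x
  proof -
    have "- (x\<^sup>2 / (2 * \<sigma>\<^sup>2)) = - x\<^sup>2 / 2 + - k * x\<^sup>2"
      using assms by (simp add: \<sigma>(2) field_simps)
    then show ?thesis
      using \<sigma>(1) by (simp add: normal_density_def real_sqrt_mult flip: exp_add)
  qed
  then have "(\<integral>x. exp (- k * x\<^sup>2) \<partial>std_normal_distribution) = (\<integral>x. \<sigma> * normal_density 0 \<sigma> x \<partial>lborel)"
    by (subst integral_density) auto
  also have "\<dots> = \<sigma>" using \<sigma> by simp
  finally show ?thesis by (simp add: \<sigma>_def)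
qed

lemma iexp_std_normal: "(\<integral>x. iexp (t * x) \<partial>std_normal_distribution) = complex_of_real (exp (- t\<^sup>2 / 2))"
  using fun_cong[OF char_std_normal_distribution, of t] by (simp add: char_def)

context prob_space
begin

text \<open>
  The Laplace transform of the squared modulus is the characteristic function averaged over an
  independent Gaussian frequency, which avoids identifying the law of a planar vector.
\<close>

lemma laplace_proper_gaussian:
  assumes Z: "proper_gaussian M Z" and "0 \<le> s"
  shows "(\<integral>\<omega>. exp (- s * (cmod (Z \<omega>))\<^sup>2) \<partial>M) = 1 / (1 + s * (l2_norm M Z)\<^sup>2)"
proof -
  \<comment> \<open>For a standard normal N, the mean of e^(ikrN) is e^(-k^2 r^2/2), which must
    equal e^(-s r^2).\<close>
  define k where "k = sqrt (2 * s)"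
  have k: "k\<^sup>2 = 2 * s" using \<open>0 \<le> s\<close> by (simp add: k_def)
  have [measurable]: "Z \<in> borel_measurable M"
    using Z by (simp add: proper_gaussian_def second_order_def)
  let ?N = "std_normal_distribution"
  interpret N: prob_space ?N by (rule prob_space_normal_density) simp
  interpret NN: pair_prob_space ?N ?N ..
  interpret MN: pair_prob_space M "?N \<Otimes>\<^sub>M ?N" ..
  define f where "f \<omega> y = iexp (k * fst y * Re (Z \<omega>) + k * snd y * Im (Z \<omega>))" for \<omega> and y :: "real \<times> real"
  have f_split: "f \<omega> (x, y) = iexp (k * Re (Z \<omega>) * x) * iexp (k * Im (Z \<omega>) * y)" for \<omega> x y
    by (simp add: f_def algebra_simps flip: exp_add)
  have [measurable]: "case_prod f \<in> borel_measurable (M \<Otimes>\<^sub>M (?N \<Otimes>\<^sub>M ?N))"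
    unfolding f_def by measurable
  have "integrable (M \<Otimes>\<^sub>M (?N \<Otimes>\<^sub>M ?N)) (case_prod f)"
    by (rule MN.P.integrable_const_bound[where B = 1]) (auto simp: f_def)
  then have swap: "(\<integral>\<omega>. (\<integral>y. f \<omega> y \<partial>(?N \<Otimes>\<^sub>M ?N)) \<partial>M) = (\<integral>y. (\<integral>\<omega>. f \<omega> y \<partial>M) \<partial>(?N \<Otimes>\<^sub>M ?N))"
    by (rule MN.Fubini_integral[symmetric])
  \<comment> \<open>Averaging over the auxiliary frequency recovers the exponential of the squared
    modulus.\<close>
  have left: "(\<integral>y. f \<omega> y \<partial>(?N \<Otimes>\<^sub>M ?N)) = complex_of_real (exp (- s * (cmod (Z \<omega>))\<^sup>2))" if "\<omega> \<in> space M" for \<omega>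
  proof -
    have "(\<integral>y. f \<omega> y \<partial>(?N \<Otimes>\<^sub>M ?N)) = (\<integral>x. \<integral>y. f \<omega> (x, y) \<partial>?N \<partial>?N)"
    proof (rule NN.integral_fst'[symmetric])
      show "integrable (?N \<Otimes>\<^sub>M ?N) (f \<omega>)"
        unfolding f_def by (rule NN.P.integrable_const_bound[where B = 1]) auto
    qed
    also have "\<dots> = complex_of_real (exp (- (k * Re (Z \<omega>))\<^sup>2 / 2) * exp (- (k * Im (Z \<omega>))\<^sup>2 / 2))"
      unfolding f_split integral_mult_right_zero integral_mult_left_zero iexp_std_normal by simp
    also have "exp (- (k * Re (Z \<omega>))\<^sup>2 / 2) * exp (- (k * Im (Z \<omega>))\<^sup>2 / 2) = exp (- s * (cmod (Z \<omega>))\<^sup>2)"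
      by (simp add: power_mult_distrib k cmod_power2 algebra_simps flip: exp_add)
    finally show ?thesis .
  qed
  \<comment> \<open>Averaging over \<omega> instead gives the characteristic function of
    \<open>Z\<close>, a product of Gaussian factors in the two coordinates.\<close>
  have right: "(\<integral>\<omega>. f \<omega> y \<partial>M)
      = complex_of_real (exp (- (s * (l2_norm M Z)\<^sup>2 / 2) * (fst y)\<^sup>2) * exp (- (s * (l2_norm M Z)\<^sup>2 / 2) * (snd y)\<^sup>2))" for y
  proof -
    have "(\<integral>\<omega>. f \<omega> y \<partial>M)
        = complex_of_real (exp (- ((k * fst y)\<^sup>2 + (k * snd y)\<^sup>2) * (l2_norm M Z)\<^sup>2 / 4))"
      using Z unfolding proper_gaussian_def f_def by blast
    also have "- ((k * fst y)\<^sup>2 + (k * snd y)\<^sup>2) * (l2_norm M Z)\<^sup>2 / 4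
        = - (s * (l2_norm M Z)\<^sup>2 / 2) * (fst y)\<^sup>2 + - (s * (l2_norm M Z)\<^sup>2 / 2) * (snd y)\<^sup>2"
      by (simp add: power_mult_distrib k field_simps)
    finally show ?thesis unfolding exp_add .
  qed
  have "complex_of_real (\<integral>\<omega>. exp (- s * (cmod (Z \<omega>))\<^sup>2) \<partial>M)
      = (\<integral>\<omega>. (\<integral>y. f \<omega> y \<partial>(?N \<Otimes>\<^sub>M ?N)) \<partial>M)"
    unfolding integral_complex_of_real[symmetric] using left by (intro Bochner_Integration.integral_cong) auto
  also have "\<dots> = complex_of_real (\<integral>y. exp (- (s * (l2_norm M Z)\<^sup>2 / 2) * (fst y)\<^sup>2)
      * exp (- (s * (l2_norm M Z)\<^sup>2 / 2) * (snd y)\<^sup>2) \<partial>(?N \<Otimes>\<^sub>M ?N))"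
    unfolding swap right integral_complex_of_real ..
  also have "(\<integral>y. exp (- (s * (l2_norm M Z)\<^sup>2 / 2) * (fst y)\<^sup>2)
      * exp (- (s * (l2_norm M Z)\<^sup>2 / 2) * (snd y)\<^sup>2) \<partial>(?N \<Otimes>\<^sub>M ?N))
    = (\<integral>x. \<integral>y. exp (- (s * (l2_norm M Z)\<^sup>2 / 2) * x\<^sup>2) * exp (- (s * (l2_norm M Z)\<^sup>2 / 2) * y\<^sup>2) \<partial>?N \<partial>?N)"
  proof (subst NN.integral_fst'[symmetric])
    show "integrable (?N \<Otimes>\<^sub>M ?N) (\<lambda>y. exp (- (s * (l2_norm M Z)\<^sup>2 / 2) * (fst y)\<^sup>2)
      * exp (- (s * (l2_norm M Z)\<^sup>2 / 2) * (snd y)\<^sup>2))"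
      using \<open>0 \<le> s\<close> by (intro NN.P.integrable_const_bound[where B = 1] AE_I2) (auto intro!: mult_le_one)
  qed simp
  also have "\<dots> = 1 / sqrt (1 + s * (l2_norm M Z)\<^sup>2) * (1 / sqrt (1 + s * (l2_norm M Z)\<^sup>2))"
    using integral_exp_std_normal[of "s * (l2_norm M Z)\<^sup>2 / 2"] \<open>0 \<le> s\<close> by simp
  also have "\<dots> = 1 / (1 + s * (l2_norm M Z)\<^sup>2)"
    using \<open>0 \<le> s\<close> by (simp add: abs_of_nonneg)
  finally show ?thesis unfolding of_real_eq_iff .
qed

lemma integral_ln_proper_gaussian:
  assumes Z: "proper_gaussian M Z" and "\<alpha> > 0" and m: "(l2_norm M Z)\<^sup>2 = m" "m > 0"
  shows "ln (1 + exp (- euler_mascheroni) * \<alpha> * m) \<le> (\<integral>\<omega>. ln (1 + \<alpha> * (cmod (Z \<omega>))\<^sup>2) \<partial>M)"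
    and "(\<integral>\<omega>. ln (1 + \<alpha> * (cmod (Z \<omega>))\<^sup>2) \<partial>M) \<le> ln (1 + \<alpha> * m)"
proof -
  have int: "integrable M (\<lambda>\<omega>. \<alpha> * (cmod (Z \<omega>))\<^sup>2)"
    using Z by (simp add: proper_gaussian_def second_order_def)
  have "ln (1 + \<alpha> * m * exp (- euler_mascheroni)) \<le> (\<integral>\<omega>. ln (1 + \<alpha> * (cmod (Z \<omega>))\<^sup>2) \<partial>M)"
  proof (rule integral_ln_one_plus_ge[OF int])
    fix s :: real assume "s > 0"
    then show "(\<integral>\<omega>. exp (- s * (\<alpha> * (cmod (Z \<omega>))\<^sup>2)) \<partial>M) = 1 / (1 + s * (\<alpha> * m))"
      using laplace_proper_gaussian[OF Z, of "s * \<alpha>"] m \<open>\<alpha> > 0\<close> by (simp add: mult.assoc)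
  qed (use \<open>\<alpha> > 0\<close> m in auto)
  then show "ln (1 + exp (- euler_mascheroni) * \<alpha> * m) \<le> (\<integral>\<omega>. ln (1 + \<alpha> * (cmod (Z \<omega>))\<^sup>2) \<partial>M)"
    by (simp add: mult_ac)
  show "(\<integral>\<omega>. ln (1 + \<alpha> * (cmod (Z \<omega>))\<^sup>2) \<partial>M) \<le> ln (1 + \<alpha> * m)"
    using integral_ln_one_plus_le[OF int] \<open>\<alpha> > 0\<close> m by (simp add: l2_norm_power2)
qed

text \<open>Mean 0 forces the degenerate case to be the constant 0, where the formula for the
  characteristic function holds with variance 0; both cases thus obey one formula.\<close>

lemma gaussian_rv_centered:
  assumes X: "gaussian_rv M X" and mean: "(\<integral>\<omega>. X \<omega> \<partial>M) = 0"
  shows "second_order M X"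
    and "(\<integral>\<omega>. iexp (X \<omega>) \<partial>M) = complex_of_real (exp (- (\<integral>\<omega>. (X \<omega>)\<^sup>2 \<partial>M) / 2))"
proof -
  have [measurable]: "X \<in> borel_measurable M" using X by (simp add: gaussian_rv_def)
  from X consider \<mu> \<sigma> where "\<sigma> > 0" "distributed M lborel X (normal_density \<mu> \<sigma>)"
    | \<mu> where "AE \<omega> in M. X \<omega> = \<mu>"
    unfolding gaussian_rv_def by auto
  then have "second_order M X \<and>
    (\<integral>\<omega>. iexp (X \<omega>) \<partial>M) = complex_of_real (exp (- (\<integral>\<omega>. (X \<omega>)\<^sup>2 \<partial>M) / 2))"
  proof cases
    case (1 \<mu> \<sigma>)
    then have [simp]: "\<mu> = 0" using mean normal_distributed_expectation by fastforce
    note D = 1(2)[simplified]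
    have var: "(\<integral>\<omega>. (X \<omega>)\<^sup>2 \<partial>M) = \<sigma>\<^sup>2"
      using normal_distributed_variance[OF 1] mean by simp
    have "integrable lborel (\<lambda>x. normal_density 0 \<sigma> x * x\<^sup>2)"
      using integrable_normal_moment[OF 1(1), of 0 2] by simp
    then have "integrable M (\<lambda>\<omega>. (X \<omega>)\<^sup>2)"
      using distributed_integrable[OF D, of "\<lambda>x. x\<^sup>2"] by simp
    moreover have "(\<integral>\<omega>. iexp (X \<omega>) \<partial>M) = complex_of_real (exp (- \<sigma>\<^sup>2 / 2))"
    proof -
      have "distributed M lborel (\<lambda>\<omega>. X \<omega> / \<sigma>) std_normal_density"
        using normal_standard_normal_convert[OF 1(1), of X 0] D by simp
      then have "(\<integral>x. iexp (\<sigma> * x) \<partial>std_normal_distribution) = (\<integral>\<omega>. iexp (\<sigma> * (X \<omega> / \<sigma>)) \<partial>M)"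
        by (subst distributed_distr_eq_density[symmetric], assumption)
          (subst integral_distr, use 1(1) in auto)
      then show ?thesis using 1(1) iexp_std_normal[of \<sigma>] by simp
    qed
    ultimately show ?thesis by (simp add: second_order_def var)
  next
    case (2 \<mu>)
    then have "\<mu> = 0" using mean integral_cong_AE[of X M "\<lambda>_. \<mu>"] by (simp add: prob_space)
    then have ae: "AE \<omega> in M. X \<omega> = 0" using 2 by simp
    have "integrable M (\<lambda>\<omega>. (X \<omega>)\<^sup>2) \<longleftrightarrow> integrable M (\<lambda>\<omega>. 0::real)"
      by (rule integrable_cong_AE) (use ae in auto)
    moreover have "(\<integral>\<omega>. (X \<omega>)\<^sup>2 \<partial>M) = (\<integral>\<omega>. 0 \<partial>M)"
      by (rule integral_cong_AE) (use ae in auto)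
    moreover have "(\<integral>\<omega>. iexp (X \<omega>) \<partial>M) = (\<integral>\<omega>. 1 \<partial>M)"
      by (rule integral_cong_AE) (use ae in auto)
    ultimately show ?thesis by (simp add: second_order_def prob_space)
  qed
  then show "second_order M X"
    and "(\<integral>\<omega>. iexp (X \<omega>) \<partial>M) = complex_of_real (exp (- (\<integral>\<omega>. (X \<omega>)\<^sup>2 \<partial>M) / 2))" by auto
qed

end

section \<open>Calculus for the covariance kernel and the capacity bound\<close>

text \<open>Writing the primitive with \<open>max x 0\<close> makes it constant before 0 and
  continuous across it, so one formula serves intervals on either side of the jump. It is the
  \<open>G\<close> required for integrals over the real line.\<close>

lemma has_integral_exp_max:
  fixes b C s t :: real
  assumes "b > 0" "s \<le> t"
  shows "((\<lambda>x. if x \<in> {0..} then C * exp (- b * x) else 0) has_integral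
    (- C / b * exp (- b * max t 0) - - C / b * exp (- b * max s 0))) {s..t}"
proof (rule fundamental_theorem_of_calculus_interior_strong[where S = "{0}"])
  show "continuous_on {s..t} (\<lambda>x. - C / b * exp (- b * max x 0))"
    by (intro continuous_intros)
  fix x assume x: "x \<in> {s<..<t} - {0}"
  show "((\<lambda>x. - C / b * exp (- b * max x 0)) has_vector_derivative
      (if x \<in> {0..} then C * exp (- b * x) else 0)) (at x)"
  proof (cases "x > 0")
    case True
    have "((\<lambda>x. - C / b * exp (- b * x)) has_vector_derivative C * exp (- b * x)) (at x)"
      using \<open>b > 0\<close> by (auto intro!: derivative_eq_intros simp flip: has_real_derivative_iff_has_vector_derivative)
    then show ?thesis
      using True by (auto intro: has_vector_derivative_transform_within_open[where S = "{0<..}"])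
  next
    case False
    then have "x < 0" using x by auto
    then show ?thesis
      by (auto intro: has_vector_derivative_transform_within_open[OF has_vector_derivative_const, where S = "{..<0}"])
  qed
qed (use assms in auto)

text \<open>The bound is the integral over the whole half-line, hence independent of t. It enters
  the Lipschitz constant of the spectrum in the frequency.\<close>

lemma has_integral_mult_exp_bound:
  fixes b t :: real
  assumes "b > 0" "0 \<le> t"
  obtains A where "((\<lambda>x. x * exp (- b * x)) has_integral A) {0..t}" "A \<le> 1 / b\<^sup>2"
proof
  let ?G = "\<lambda>x. - (x / b + 1 / b\<^sup>2) * exp (- b * x)"
  show "((\<lambda>x. x * exp (- b * x)) has_integral ?G t - ?G 0) {0..t}"
    using assms by (intro fundamental_theorem_of_calculus)
      (auto intro!: derivative_eq_intros simp: power2_eq_square field_simps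
        simp flip: has_real_derivative_iff_has_vector_derivative)
  have "0 \<le> (t / b + 1 / b\<^sup>2) * exp (- b * t)" using assms by simp
  then show "?G t - ?G 0 \<le> 1 / b\<^sup>2" unfolding mult_minus_left by simp
qed

text \<open>Hides the division by \<mu>, which is impossible for \<mu> = 0; later arguments use only
  the derivative of \<open>Q\<close> and its value at 0.\<close>

lemma exp_primitive:
  fixes \<mu> :: complex
  obtains Q where "\<And>y. (Q has_vector_derivative exp (\<mu> * of_real y)) (at (y::real) within S)" "Q 0 = 0"
proof -
  define q where "q y = (if \<mu> = 0 then y else (exp (\<mu> * y) - 1) / \<mu>)" for y
  have "(q has_field_derivative exp (\<mu> * y)) (at y)" for y
    unfolding q_def by (cases "\<mu> = 0") (auto intro!: derivative_eq_intros)
  then have "((\<lambda>y. q (of_real y)) has_vector_derivative exp (\<mu> * of_real y)) (at (y::real) within S)" for y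
    by (rule has_vector_derivative_real_field)
  moreover have "q (of_real 0) = 0" by (simp add: q_def)
  ultimately show ?thesis using that by blast
qed

text \<open>
  With \<open>\<kappa> = a + b + i \<omega>\<close> and \<open>\<mu> = a - b + i \<omega>\<close>, the kernel is the real part of
  \<open>exp (\<mu> min(x, y) - \<kappa> max(x, y))\<close>; \<open>\<mu>\<close> may vanish.
\<close>

lemma OU_kernel_double_integral:
  fixes a b \<omega> :: real
  assumes "a > 0" "b > 0"
  defines "k \<equiv> \<lambda>x y. exp (- a * \<bar>x - y\<bar>) * exp (- b * (x + y)) * cos (\<omega> * (x - y))"
  obtains D where "\<And>t. 0 \<le> t \<Longrightarrow> \<exists>F. (\<forall>y\<in>{0..t}. ((\<lambda>x. k x y) has_integral F y) {0..t})
      \<and> (F has_integral D t) {0..t}"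
    and "(D \<longlongrightarrow> (a + b) / (b * ((a + b)\<^sup>2 + \<omega>\<^sup>2))) at_top"
proof -
  define \<kappa> where "\<kappa> = Complex (a + b) \<omega>"
  define \<mu> where "\<mu> = Complex (a - b) \<omega>"
  have [simp]: "\<kappa> \<noteq> 0" using assms by (simp add: \<kappa>_def complex_eq_iff)
  obtain Q where Q: "\<And>y. (Q has_vector_derivative exp (\<mu> * of_real y)) (at (y::real) within UNIV)" "Q 0 = 0"
    using exp_primitive by blast
  have dQ [derivative_intros]: "(Q has_vector_derivative exp (\<mu> * of_real y)) (at y within S)" for y S
    using Q(1) by (rule has_vector_derivative_within_subset) simp
  have dE [derivative_intros]: "((\<lambda>y. exp (z * of_real y)) has_vector_derivative z * exp (z * of_real y)) (at y within S)"
    for z :: complex and y S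
    by (rule has_vector_derivative_real_field) (auto intro!: derivative_eq_intros)
  note [derivative_intros] = dE[of "- z" for z, simplified]
  have k_le: "k x y = Re (exp (- \<kappa> * of_real y) * exp (\<mu> * of_real x))" if "x \<le> y" for x y
  proof -
    have "- \<kappa> * of_real y + \<mu> * of_real x = Complex (- a * \<bar>x - y\<bar> + - b * (x + y)) (\<omega> * (x - y))"
      using that by (simp add: complex_eq_iff \<kappa>_def \<mu>_def algebra_simps)
    then show ?thesis unfolding exp_add[symmetric] k_def by (simp add: Re_exp)
  qed
  have k_ge: "k x y = Re (exp (\<mu> * of_real y) * exp (- \<kappa> * of_real x))" if "y \<le> x" for x y
  proof -
    have "cos (\<omega> * (x - y)) = cos (\<omega> * (y - x))"
      using cos_minus[of "\<omega> * (x - y)"] by (simp add: right_diff_distrib)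
    then have "k x y = k y x" by (simp add: k_def abs_minus_commute add.commute)
    then show ?thesis unfolding k_le[OF that] by (simp only: mult.commute)
  qed
  \<comment> \<open>The inner integral, split at x = y where the kernel changes its exponential
    form; \<open>d\<close> is the outer integral of \<open>f\<close>.\<close>
  define f where "f t y = exp (- \<kappa> * of_real y) * Q y
      + exp (\<mu> * of_real y) * (exp (- \<kappa> * of_real y) - exp (- \<kappa> * of_real t)) / \<kappa>" for t y
  define d where "d t = 2 * (of_real ((1 - exp (- 2 * b * t)) / (2 * b)) - exp (- \<kappa> * of_real t) * Q t) / \<kappa>" for t
  have inner: "((\<lambda>x. k x y) has_integral Re (f t y)) {0..t}" if y: "0 \<le> y" "y \<le> t" for t y
  proof -
    have "((\<lambda>x. exp (- \<kappa> * of_real y) * exp (\<mu> * of_real x)) has_integral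
        exp (- \<kappa> * of_real y) * Q y - exp (- \<kappa> * of_real y) * Q 0) {0..y}"
      using y by (intro fundamental_theorem_of_calculus) (auto intro!: derivative_eq_intros)
    from has_integral_Re[OF this] have 1: "((\<lambda>x. k x y) has_integral Re (exp (- \<kappa> * of_real y) * Q y)) {0..y}"
      using k_le by (subst has_integral_cong[where g = "\<lambda>x. Re (exp (- \<kappa> * of_real y) * exp (\<mu> * of_real x))"]) (auto simp: Q)
    have "((\<lambda>x. exp (\<mu> * of_real y) * exp (- \<kappa> * of_real x)) has_integral
        exp (\<mu> * of_real y) * exp (- \<kappa> * of_real t) / (- \<kappa>) - exp (\<mu> * of_real y) * exp (- \<kappa> * of_real y) / (- \<kappa>)) {y..t}"
    proof (rule fundamental_theorem_of_calculus[OF y(2)])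
      fix x
      show "((\<lambda>x. exp (\<mu> * of_real y) * exp (- \<kappa> * of_real x) / (- \<kappa>)) has_vector_derivative
          exp (\<mu> * of_real y) * exp (- \<kappa> * of_real x)) (at x within {y..t})"
        unfolding divide_inverse by (auto intro!: derivative_eq_intros)
    qed
    from has_integral_Re[OF this] have 2: "((\<lambda>x. k x y) has_integral
        Re (exp (\<mu> * of_real y) * (exp (- \<kappa> * of_real y) - exp (- \<kappa> * of_real t)) / \<kappa>)) {y..t}"
      using k_ge by (subst has_integral_cong[where g = "\<lambda>x. Re (exp (\<mu> * of_real y) * exp (- \<kappa> * of_real x))"])
        (auto simp: algebra_simps diff_divide_distrib)
    show ?thesis
      using has_integral_combine[OF y 1 2] by (simp add: f_def)
  qed
  have outer: "((\<lambda>y. Re (f t y)) has_integral Re (d t)) {0..t}" if "0 \<le> t" for t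
  proof -
    \<comment> \<open>\<beta> = \<mu> - \<kappa> is real, since a and \<omega> cancel; unlike \<mu>
      it never vanishes.\<close>
    define \<beta> where "\<beta> = complex_of_real (- 2 * b)"
    have [simp]: "\<beta> \<noteq> 0" using \<open>b > 0\<close> by (simp add: \<beta>_def)
    have exp_eq: "exp (\<beta> * of_real y) = exp (- \<kappa> * of_real y) * exp (\<mu> * of_real y)" for y
    proof -
      have "\<beta> * of_real y = - \<kappa> * of_real y + \<mu> * of_real y"
        by (simp add: complex_eq_iff \<kappa>_def \<mu>_def \<beta>_def algebra_simps)
      then show ?thesis unfolding exp_add[symmetric] by simp
    qed
    \<comment> \<open>Integrating e^(-\<kappa>y) Q(y) by parts leaves an e^(\<beta>y)/\<kappa> term,
      which adds to the equal one already in \<open>f\<close>; this explains the 2.\<close>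
    let ?P = "\<lambda>y. exp (- \<kappa> * of_real y) * Q y * (- 1 / \<kappa>) + exp (\<beta> * of_real y) * (2 / (\<beta> * \<kappa>))
        + Q y * (- exp (- \<kappa> * of_real t) / \<kappa>)"
    have "((\<lambda>y. f t y) has_integral ?P t - ?P 0) {0..t}"
    proof (rule fundamental_theorem_of_calculus[OF that])
      fix y
      have "(?P has_vector_derivative
         (exp (- \<kappa> * of_real y) * exp (\<mu> * of_real y) + - \<kappa> * exp (- \<kappa> * of_real y) * Q y) * (- 1 / \<kappa>)
         + \<beta> * exp (\<beta> * of_real y) * (2 / (\<beta> * \<kappa>))
         + exp (\<mu> * of_real y) * (- exp (- \<kappa> * of_real t) / \<kappa>)) (at y within {0..t})"
        by (intro has_vector_derivative_add has_vector_derivative_mult_left has_vector_derivative_mult dE dQ)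
      also have "(exp (- \<kappa> * of_real y) * exp (\<mu> * of_real y) + - \<kappa> * exp (- \<kappa> * of_real y) * Q y) * (- 1 / \<kappa>)
         + \<beta> * exp (\<beta> * of_real y) * (2 / (\<beta> * \<kappa>))
         + exp (\<mu> * of_real y) * (- exp (- \<kappa> * of_real t) / \<kappa>) = f t y"
        unfolding f_def exp_eq by (simp add: field_simps)
      finally show "(?P has_vector_derivative f t y) (at y within {0..t})" .
    qed
    also have "?P t - ?P 0 = d t"
    proof -
      have "exp (\<beta> * of_real t) = of_real (exp (- 2 * b * t))"
        by (simp add: \<beta>_def flip: exp_of_real)
      then show ?thesis
        using \<open>b > 0\<close> unfolding d_def by (simp add: Q \<beta>_def field_simps)
    qed
    finally show ?thesis by (rule has_integral_Re)
  qed
  have lim: "((\<lambda>t. Re (2 * (of_real (r t) - q t) / \<kappa>)) \<longlongrightarrow> Re (2 * (of_real r' - q') / \<kappa>)) F"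
    if "(r \<longlongrightarrow> r') F" "(q \<longlongrightarrow> q') F" for r :: "real \<Rightarrow> real" and q r' q' F
    using that by (intro tendsto_intros) simp_all
  have "((\<lambda>t. exp (- \<kappa> * of_real t) * Q t) \<longlongrightarrow> 0) at_top"
  proof (rule Lim_null_comparison)
    \<comment> \<open>\<open>Q\<close> grows at most like t e^(at), while e^(-\<kappa>t) decays like
      e^(-(a+b)t); the surplus e^(-bt) remains.\<close>
    have bound: "norm (exp (- \<kappa> * of_real t) * Q t) \<le> t * exp (- b * t)" if "t \<ge> 0" for t
    proof -
      have "norm (Q t) \<le> exp (a * t) * measure lborel (cbox 0 t)"
      proof (rule has_integral_bound)
        show "((\<lambda>x. exp (\<mu> * of_real x)) has_integral Q t) (cbox 0 t)"
          using fundamental_theorem_of_calculus[OF that, of Q "\<lambda>x. exp (\<mu> * of_real x)"] dQ Q(2) by simp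
        fix x assume "x \<in> cbox 0 t"
        then have "a * x \<le> a * t" "0 \<le> b * x" using assms by (auto intro: mult_left_mono)
        then have "(a - b) * x \<le> a * t" by (simp add: algebra_simps)
        then show "norm (exp (\<mu> * of_real x)) \<le> exp (a * t)" by (simp add: norm_exp_eq_Re \<mu>_def)
      qed simp
      then have "norm (exp (- \<kappa> * of_real t) * Q t) \<le> exp (- (a + b) * t) * (exp (a * t) * t)"
        unfolding norm_mult using that by (intro mult_mono) (auto simp: norm_exp_eq_Re \<kappa>_def algebra_simps)
      also have "\<dots> = t * exp (- b * t)"
        by (simp add: algebra_simps flip: exp_add)
      finally show ?thesis .
    qed
    show "\<forall>\<^sub>F t in at_top. norm (exp (- \<kappa> * of_real t) * Q t) \<le> t * exp (- b * t)"
      by (rule eventually_mono[OF eventually_ge_at_top[of 0]]) (rule bound)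
    show "((\<lambda>t. t * exp (- b * t)) \<longlongrightarrow> 0) at_top"
      using \<open>b > 0\<close> by real_asymp
  qed
  moreover have "((\<lambda>t. (1 - exp (- 2 * b * t)) / (2 * b)) \<longlongrightarrow> 1 / (2 * b)) at_top"
    using \<open>b > 0\<close> by real_asymp (simp add: field_simps)
  ultimately have "((\<lambda>t. Re (d t)) \<longlongrightarrow> Re (2 * (of_real (1 / (2 * b)) - 0) / \<kappa>)) at_top"
    unfolding d_def by (intro lim)
  also have "Re (2 * (of_real (1 / (2 * b)) - 0) / \<kappa>) = (a + b) / (b * ((a + b)\<^sup>2 + \<omega>\<^sup>2))"
  proof -
    have "2 * (of_real (1 / (2 * b)) - 0) / \<kappa> = of_real (1 / b) * inverse \<kappa>"
      using \<open>b > 0\<close> by (simp add: field_simps)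
    also have "Re \<dots> = 1 / b * ((a + b) / ((a + b)\<^sup>2 + \<omega>\<^sup>2))"
      by (simp add: \<kappa>_def)
    finally show ?thesis by simp
  qed
  finally have "((\<lambda>t. Re (d t)) \<longlongrightarrow> (a + b) / (b * ((a + b)\<^sup>2 + \<omega>\<^sup>2))) at_top" .
  then show ?thesis
    by (intro that[of "\<lambda>t. Re (d t)"] exI[of _ "\<lambda>y. Re (f _ y)"]) (auto intro: inner outer)
qed

text \<open>The derivative 2u/(1 + u^2) lies in [-1, 1], so adding or subtracting the logarithm
  leaves u increasing. The capacity integrand is thus Lipschitz in the amplitude, although its
  argument is quadratic.\<close>

lemma ln_one_plus_square_diff_le:
  fixes x y :: real
  shows "\<bar>ln (1 + x\<^sup>2) - ln (1 + y\<^sup>2)\<bar> \<le> \<bar>x - y\<bar>"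
proof -
  have "ln (1 + y\<^sup>2) - ln (1 + x\<^sup>2) \<le> y - x \<and> ln (1 + x\<^sup>2) - ln (1 + y\<^sup>2) \<le> y - x" if "x \<le> y" for x y :: real
  proof -
    have pos: "1 + u\<^sup>2 > 0" for u :: real by (simp add: add_pos_nonneg)
    have sq: "u * 2 \<le> 1 + u\<^sup>2" "- (u * 2) \<le> 1 + u\<^sup>2" for u :: real
      using sum_squares_bound[of u 1] sum_squares_bound[of "- u" 1] by simp_all
    have nn: "0 \<le> 1 - 2 * u / (1 + u\<^sup>2)" "0 \<le> 1 + 2 * u / (1 + u\<^sup>2)" for u :: real
      using pos[of u] sq[of u] by (simp_all add: field_simps)
    have d: "((\<lambda>u. u - ln (1 + u\<^sup>2)) has_real_derivative 1 - 2 * u / (1 + u\<^sup>2)) (at u)"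
      "((\<lambda>u. u + ln (1 + u\<^sup>2)) has_real_derivative 1 + 2 * u / (1 + u\<^sup>2)) (at u)" for u
      using pos[of u] by (auto intro!: derivative_eq_intros)
    have "x - ln (1 + x\<^sup>2) \<le> y - ln (1 + y\<^sup>2)"
      by (rule DERIV_nonneg_imp_nondecreasing[OF that]) (use d(1) nn(1) in blast)
    moreover have "x + ln (1 + x\<^sup>2) \<le> y + ln (1 + y\<^sup>2)"
      by (rule DERIV_nonneg_imp_nondecreasing[OF that]) (use d(2) nn(2) in blast)
    ultimately show ?thesis by auto
  qed
  from this[of x y] this[of y x] show ?thesis by (cases "x \<le> y") auto
qed

text \<open>As the spectral variance is a constant over A + f^2, the argument of the logarithm is (B
  + f^2)/(A + f^2), with A and B the squares of the quantities \<open>r\<close> and \<open>q\<close>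
  in \<open>OU_capacity_bound\<close>.\<close>

lemma has_integral_log_one_plus_OU_spectral_variance:
  assumes pos: "a > 0" "b > 0" "c > 0" "\<alpha> > 0" "W > 0"
  shows "((\<lambda>f. log 2 (1 + 2 * exp (- \<theta>) * \<alpha> * OU_spectral_variance a b c f)) has_integral
    OU_capacity_bound a b c \<alpha> W \<theta>) {- W / 2..W / 2}"
proof -
  define \<beta>\<^sub>1 where "\<beta>\<^sub>1 = 2 * pi\<^sup>2 / (\<alpha> * c * (a + b))"
  define A where "A = (a + b)\<^sup>2 / (4 * pi\<^sup>2)"
  define B where "B = A + exp (- \<theta>) / \<beta>\<^sub>1"
  have \<beta>1: "\<beta>\<^sub>1 > 0" using pos by (simp add: \<beta>\<^sub>1_def)
  have A: "A > 0" using pos by (simp add: A_def)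
  have B: "B > 0" using A \<beta>1 by (simp add: B_def add_pos_pos)
  have sq: "A + f\<^sup>2 > 0" "B + f\<^sup>2 > 0" for f using A B by (simp_all add: add_pos_nonneg)
  have log_eq: "log 2 (1 + 2 * exp (- \<theta>) * \<alpha> * OU_spectral_variance a b c f)
      = (ln (B + f\<^sup>2) - ln (A + f\<^sup>2)) / ln 2" for f
  proof -
    have den: "(a + b)\<^sup>2 + (2 * pi * f)\<^sup>2 = 4 * pi\<^sup>2 * (A + f\<^sup>2)"
      by (simp add: A_def field_simps)
    have "2 * exp (- \<theta>) * \<alpha> * (c * (a + b) / (4 * pi\<^sup>2 * D)) = exp (- \<theta>) / \<beta>\<^sub>1 / D" if "D > 0" for D
      using pos that by (simp add: \<beta>\<^sub>1_def field_simps)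
    from this[OF sq(1)]
    have "2 * exp (- \<theta>) * \<alpha> * OU_spectral_variance a b c f = exp (- \<theta>) / \<beta>\<^sub>1 / (A + f\<^sup>2)"
      unfolding OU_spectral_variance_def den .
    moreover have "(B + f\<^sup>2) / (A + f\<^sup>2) = (A + f\<^sup>2) / (A + f\<^sup>2) + exp (- \<theta>) / \<beta>\<^sub>1 / (A + f\<^sup>2)"
      unfolding add_divide_distrib[symmetric] by (simp add: B_def)
    ultimately have "1 + 2 * exp (- \<theta>) * \<alpha> * OU_spectral_variance a b c f = (B + f\<^sup>2) / (A + f\<^sup>2)"
      using sq(1)[of f] by simp
    then show ?thesis using sq[of f] by (simp add: log_def ln_div)
  qed
  \<comment> \<open>A primitive of ln(C + f^2) by parts. It is odd in f, which doubles the boundary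
    values, and the terms -2f cancel between B and A.\<close>
  define G where "G C f = f * ln (C + f\<^sup>2) + 2 * sqrt C * arctan (f / sqrt C) - 2 * f" for C f :: real
  have G: "(G C has_real_derivative ln (C + f\<^sup>2)) (at f within S)" if "C > 0" for C f S
  proof -
    have C: "C + f\<^sup>2 > 0" "sqrt C > 0" using that by (auto simp: add_pos_nonneg)
    have "1 + (f / sqrt C)\<^sup>2 = (C + f\<^sup>2) / C"
      using that by (simp add: power_divide add_divide_distrib)
    then have arctan: "2 * sqrt C * (inverse (1 + (f / sqrt C)\<^sup>2) * (1 / sqrt C)) = 2 * C / (C + f\<^sup>2)"
      using C by simp
    have "((\<lambda>f. f * ln (C + f\<^sup>2)) has_real_derivative ln (C + f\<^sup>2) + f * (2 * f / (C + f\<^sup>2))) (at f within S)"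
      "((\<lambda>f. 2 * f) has_real_derivative 2) (at f within S)"
      using C by (auto intro!: derivative_eq_intros)
    moreover have "((\<lambda>f. arctan (f / sqrt C)) has_real_derivative
        inverse (1 + (f / sqrt C)\<^sup>2) * (1 / sqrt C)) (at f within S)"
      by (intro DERIV_chain2[OF DERIV_arctan] DERIV_cdivide DERIV_ident)
    ultimately have "(G C has_real_derivative
        (ln (C + f\<^sup>2) + f * (2 * f / (C + f\<^sup>2))) + 2 * sqrt C * (inverse (1 + (f / sqrt C)\<^sup>2) * (1 / sqrt C)) - 2)
        (at f within S)"
      unfolding G_def by (intro DERIV_add DERIV_diff DERIV_cmult)
    also have "(ln (C + f\<^sup>2) + f * (2 * f / (C + f\<^sup>2))) + 2 * sqrt C * (inverse (1 + (f / sqrt C)\<^sup>2) * (1 / sqrt C)) - 2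
        = ln (C + f\<^sup>2)"
    proof -
      have "f * (2 * f / (C + f\<^sup>2)) + 2 * C / (C + f\<^sup>2) = 2 * (C + f\<^sup>2) / (C + f\<^sup>2)"
        by (simp add: power2_eq_square algebra_simps flip: add_divide_distrib)
      also have "\<dots> = 2" using C(1) by (intro nonzero_mult_div_cancel_right) simp
      finally show ?thesis unfolding arctan by linarith
    qed
    finally show ?thesis .
  qed
  have "((\<lambda>f. (ln (B + f\<^sup>2) - ln (A + f\<^sup>2)) / ln 2) has_integral
      (G B (W / 2) - G A (W / 2)) / ln 2 - (G B (- W / 2) - G A (- W / 2)) / ln 2) {- W / 2..W / 2}"
    using \<open>W > 0\<close> G[OF A] G[OF B]
    by (intro fundamental_theorem_of_calculus)
      (auto intro!: DERIV_cdivide DERIV_diff simp flip: has_real_derivative_iff_has_vector_derivative)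
  also have "(G B (W / 2) - G A (W / 2)) / ln 2 - (G B (- W / 2) - G A (- W / 2)) / ln 2
      = W * ((ln (B + (W / 2)\<^sup>2) - ln (A + (W / 2)\<^sup>2)) / ln 2)
        - 4 * sqrt A / ln 2 * arctan (W / 2 / sqrt A) + 4 * sqrt B / ln 2 * arctan (W / 2 / sqrt B)"
    by (simp add: G_def arctan_minus field_simps)
  also have "\<dots> = OU_capacity_bound a b c \<alpha> W \<theta>"
    unfolding log_eq[symmetric] OU_capacity_bound_def Let_def
    by (simp add: A_def B_def \<beta>\<^sub>1_def)
  finally show ?thesis unfolding log_eq .
qed

section \<open>The spectrum of the channel\<close>

text \<open>\<open>gaussian_process\<close> speaks of finite sets of distinct times, but two cells
  of a tagged division may share a tag; the weights of equal times are collected.\<close>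

lemma gaussian_process_sum:
  assumes "gaussian_process M X" "finite I"
  shows "gaussian_rv M (\<lambda>\<omega>. \<Sum>i\<in>I. w i * X (x i) \<omega>)"
proof -
  have "(\<Sum>i\<in>I. w i * X (x i) \<omega>) = (\<Sum>\<tau>\<in>x ` I. (\<Sum>i\<in>{i \<in> I. x i = \<tau>}. w i) * X \<tau> \<omega>)" for \<omega>
    by (subst sum.image_gen[OF assms(2), of _ x])
      (auto simp: sum_distrib_right intro!: sum.cong)
  then show ?thesis
    using assms unfolding gaussian_process_def by simp
qed

locale attenuated_OU = prob_space M for M :: "'a measure" +
  fixes X Y :: "real \<Rightarrow> 'a \<Rightarrow> real" and a b c :: real
  assumes pos: "a > 0" "b > 0" "c > 0"
    and gaussian: "gaussian_process M X" "gaussian_process M Y"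
    and indep: "indep_processes M X Y"
    and mean: "\<And>\<tau>. (\<integral>\<omega>. X \<tau> \<omega> \<partial>M) = 0" "\<And>\<tau>. (\<integral>\<omega>. Y \<tau> \<omega> \<partial>M) = 0"
    and cov: "covariance_fun M X = OU_covariance a b c" "covariance_fun M Y = OU_covariance a b c"
begin

abbreviation R :: "real \<Rightarrow> real \<Rightarrow> real"
  where "R \<equiv> OU_covariance a b c"

definition H :: "real \<Rightarrow> 'a \<Rightarrow> complex"
  where "H \<tau> \<omega> = complex_of_real (X \<tau> \<omega>) + \<i> * complex_of_real (Y \<tau> \<omega>)"

lemma second_order_XY: "second_order M (X \<tau>)" "second_order M (Y \<tau>)"
  using gaussian_rv_centered(1)[OF gaussian_process_sum[OF gaussian(1), of "{\<tau>}" "\<lambda>_. 1" "\<lambda>\<tau>. \<tau>"]]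
    gaussian_rv_centered(1)[OF gaussian_process_sum[OF gaussian(2), of "{\<tau>}" "\<lambda>_. 1" "\<lambda>\<tau>. \<tau>"]]
  by (simp_all add: mean)

lemmas measurable_XY [measurable] = second_orderD(1)[OF second_order_XY(1)] second_orderD(1)[OF second_order_XY(2)]

lemma integrable_XY: "integrable M (X \<tau>)" "integrable M (Y \<tau>)"
  using second_order_XY by (auto intro: integrable_second_order)

lemma integrable_products:
  "integrable M (\<lambda>\<omega>. X \<tau> \<omega> * X \<tau>' \<omega>)" "integrable M (\<lambda>\<omega>. Y \<tau> \<omega> * Y \<tau>' \<omega>)"
  "integrable M (\<lambda>\<omega>. X \<tau> \<omega> * Y \<tau>' \<omega>)"
  using integrable_inner_second_order[OF second_order_XY(1) second_order_XY(1)]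
    integrable_inner_second_order[OF second_order_XY(2) second_order_XY(2)]
    integrable_inner_second_order[OF second_order_XY(1) second_order_XY(2)]
  by simp_all

lemma integral_XX: "(\<integral>\<omega>. X \<tau> \<omega> * X \<tau>' \<omega> \<partial>M) = R \<tau> \<tau>'"
  and integral_YY: "(\<integral>\<omega>. Y \<tau> \<omega> * Y \<tau>' \<omega> \<partial>M) = R \<tau> \<tau>'"
  using fun_cong[OF fun_cong[OF cov(1)], of \<tau> \<tau>'] fun_cong[OF fun_cong[OF cov(2)], of \<tau> \<tau>']
  by (simp_all add: covariance_fun_def mean)

text \<open>Independence is given on path space with its product sigma-algebra, for which these
  combinations of coordinates are measurable.\<close>

lemma indep_linear_combinations:
  "indep_var borel (\<lambda>\<omega>. \<Sum>i\<in>I. u i * X (x i) \<omega>) borel (\<lambda>\<omega>. \<Sum>i\<in>J. v i * Y (y i) \<omega>)"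
proof -
  have "(\<lambda>g. \<Sum>i\<in>I. u i * g (x i)) \<in> borel_measurable (\<Pi>\<^sub>M \<tau>\<in>UNIV. borel)"
    for I and u :: "'i \<Rightarrow> real" and x :: "'i \<Rightarrow> real"
    by (intro borel_measurable_sum borel_measurable_times measurable_component_singleton) auto
  from indep_var_compose[OF indep[unfolded indep_processes_def] this this]
  show ?thesis by (simp add: comp_def)
qed

lemma integral_XY: "(\<integral>\<omega>. X \<tau> \<omega> * Y \<tau>' \<omega> \<partial>M) = 0"
  using indep_linear_combinations[where I = "{()}" and J = "{()}" and u = "\<lambda>_. 1" and v = "\<lambda>_. 1"
      and x = "\<lambda>_. \<tau>" and y = "\<lambda>_. \<tau>'"]
    indep_var_lebesgue_integral[OF _ integrable_XY(1)[of \<tau>] integrable_XY(2)[of \<tau>']]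
  by (simp add: mean)

lemma second_order_H: "second_order M (\<lambda>\<omega>. z * H \<tau> \<omega>)"
proof (rule second_orderI)
  show "(\<lambda>\<omega>. z * H \<tau> \<omega>) \<in> borel_measurable M" unfolding H_def by measurable
  have "(cmod (z * H \<tau> \<omega>))\<^sup>2 = (cmod z)\<^sup>2 * ((X \<tau> \<omega>)\<^sup>2 + (Y \<tau> \<omega>)\<^sup>2)" for \<omega>
    by (simp add: norm_mult power_mult_distrib cmod_power2 H_def)
  then show "integrable M (\<lambda>\<omega>. (cmod (z * H \<tau> \<omega>))\<^sup>2)"
    using integrable_products[of \<tau> \<tau>] by (simp add: power2_eq_square)
qed

text \<open>Expanding leaves the two equal covariances, hence the 2, and a cross term with factor
  Im(z cnj z') whose mean is 0 by independence.\<close>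

lemma integral_inner_H:
  "(\<integral>\<omega>. (z * H \<tau> \<omega>) \<bullet> (z' * H \<tau>' \<omega>) \<partial>M) = 2 * R \<tau> \<tau>' * Re (z * cnj z')"
proof -
  have "(\<integral>\<omega>. (z * H \<tau> \<omega>) \<bullet> (z' * H \<tau>' \<omega>) \<partial>M)
      = (\<integral>\<omega>. Re (z * cnj z') * (X \<tau> \<omega> * X \<tau>' \<omega> + Y \<tau> \<omega> * Y \<tau>' \<omega>)
          + Im (z * cnj z') * (X \<tau> \<omega> * Y \<tau>' \<omega> - X \<tau>' \<omega> * Y \<tau> \<omega>) \<partial>M)"
    by (intro Bochner_Integration.integral_cong refl) (simp add: inner_complex_def H_def algebra_simps)
  also have "\<dots> = 2 * R \<tau> \<tau>' * Re (z * cnj z')"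
    using integrable_products by (simp add: integral_XX integral_YY integral_XY)
  finally show ?thesis .
qed

lemma l2_norm_H: "l2_norm M (\<lambda>\<omega>. z * H \<tau> \<omega>) = cmod z * sqrt (2 * R \<tau> \<tau>)"
proof -
  have "(l2_norm M (\<lambda>\<omega>. z * H \<tau> \<omega>))\<^sup>2 = 2 * R \<tau> \<tau> * (cmod z)\<^sup>2"
    unfolding l2_norm_power2 power2_norm_eq_inner integral_inner_H
    by (simp add: complex_mult_cnj cmod_power2[symmetric] flip: power2_norm_eq_inner)
  then have "l2_norm M (\<lambda>\<omega>. z * H \<tau> \<omega>) = sqrt ((cmod z)\<^sup>2 * (2 * R \<tau> \<tau>))"
    by (metis l2_norm_nonneg mult.commute real_sqrt_pow2 real_sqrt_power real_sqrt_abs abs_of_nonneg)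
  then show ?thesis by (simp add: real_sqrt_mult)
qed

lemma centered_linear_combination:
  fixes u v x :: "'i \<Rightarrow> real"
  assumes "finite I"
  defines "A \<equiv> \<lambda>\<omega>. \<Sum>i\<in>I. u i * X (x i) \<omega>" and "B \<equiv> \<lambda>\<omega>. \<Sum>i\<in>I. v i * Y (x i) \<omega>"
  shows "(\<integral>\<omega>. iexp (A \<omega> + B \<omega>) \<partial>M)
    = complex_of_real (exp (- (\<Sum>i\<in>I. \<Sum>j\<in>I. (u i * u j + v i * v j) * R (x i) (x j)) / 2))"
proof -
  have mean0: "(\<integral>\<omega>. A \<omega> \<partial>M) = 0" "(\<integral>\<omega>. B \<omega> \<partial>M) = 0"
    using integrable_XY by (simp_all add: A_def B_def mean)
  have g: "gaussian_rv M A" "gaussian_rv M B"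
    unfolding A_def B_def using gaussian assms(1) by (auto intro: gaussian_process_sum)
  have [measurable]: "A \<in> borel_measurable M" "B \<in> borel_measurable M"
    by (simp_all add: A_def B_def)
  have sq: "(\<integral>\<omega>. (A \<omega>)\<^sup>2 \<partial>M) = (\<Sum>i\<in>I. \<Sum>j\<in>I. u i * u j * R (x i) (x j))"
    "(\<integral>\<omega>. (B \<omega>)\<^sup>2 \<partial>M) = (\<Sum>i\<in>I. \<Sum>j\<in>I. v i * v j * R (x i) (x j))"
  proof -
    have "(A \<omega>)\<^sup>2 = (\<Sum>i\<in>I. \<Sum>j\<in>I. u i * u j * (X (x i) \<omega> * X (x j) \<omega>))"
      "(B \<omega>)\<^sup>2 = (\<Sum>i\<in>I. \<Sum>j\<in>I. v i * v j * (Y (x i) \<omega> * Y (x j) \<omega>))" for \<omega>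
      by (simp_all add: A_def B_def power2_eq_square sum_product mult_ac)
    then show "(\<integral>\<omega>. (A \<omega>)\<^sup>2 \<partial>M) = (\<Sum>i\<in>I. \<Sum>j\<in>I. u i * u j * R (x i) (x j))"
      "(\<integral>\<omega>. (B \<omega>)\<^sup>2 \<partial>M) = (\<Sum>i\<in>I. \<Sum>j\<in>I. v i * v j * R (x i) (x j))"
      using integrable_products by (simp_all add: integral_XX integral_YY)
  qed
  have "indep_var borel (iexp \<circ> A) borel (iexp \<circ> B)"
    unfolding A_def B_def by (rule indep_var_compose[OF indep_linear_combinations]) measurable
  then have "(\<integral>\<omega>. iexp (A \<omega>) * iexp (B \<omega>) \<partial>M) = (\<integral>\<omega>. iexp (A \<omega>) \<partial>M) * (\<integral>\<omega>. iexp (B \<omega>) \<partial>M)"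
    using indep_var_lebesgue_integral[of "iexp \<circ> A" "iexp \<circ> B"] integrable_iexp[of A] integrable_iexp[of B]
    by (simp add: comp_def)
  also have "\<dots> = complex_of_real (exp (- (\<integral>\<omega>. (A \<omega>)\<^sup>2 \<partial>M) / 2 + - (\<integral>\<omega>. (B \<omega>)\<^sup>2 \<partial>M) / 2))"
    using gaussian_rv_centered(2)[OF g(1) mean0(1)] gaussian_rv_centered(2)[OF g(2) mean0(2)]
    unfolding exp_add by simp
  also have "- (\<integral>\<omega>. (A \<omega>)\<^sup>2 \<partial>M) / 2 + - (\<integral>\<omega>. (B \<omega>)\<^sup>2 \<partial>M) / 2
      = - (\<Sum>i\<in>I. \<Sum>j\<in>I. (u i * u j + v i * v j) * R (x i) (x j)) / 2"
    unfolding sq by (simp add: distrib_right sum.distrib field_simps)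
  finally show ?thesis by (simp add: exp_add distrib_left)
qed

text \<open>Circular symmetry comes from the common covariance of \<open>X\<close> and
  \<open>Y\<close>: every real functional u Re + v Im of the sum has variance proportional to u^2 +
  v^2.\<close>

lemma proper_gaussian_sum_H:
  fixes z :: "'i \<Rightarrow> complex"
  assumes "finite I"
  shows "proper_gaussian M (\<lambda>\<omega>. \<Sum>i\<in>I. z i * H (x i) \<omega>)"
  unfolding proper_gaussian_def
proof (intro conjI allI)
  let ?S = "\<lambda>\<omega>. \<Sum>i\<in>I. z i * H (x i) \<omega>"
  show "second_order M ?S"
    by (intro second_order_sum second_order_H)
  have norm: "(l2_norm M ?S)\<^sup>2 = (\<Sum>i\<in>I. \<Sum>j\<in>I. 2 * R (x i) (x j) * Re (z i * cnj (z j)))"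
    unfolding l2_norm_power2 power2_norm_eq_inner inner_sum_left unfolding inner_sum_right
    using integrable_inner_second_order[OF second_order_H second_order_H]
    by (simp add: integral_inner_H del: complex_cnj_mult times_complex.sel)
  fix u v :: real
  \<comment> \<open>The coefficients of X and Y in u Re(z H) + v Im(z H). In
    \<open>?p i * ?p j + ?q i * ?q j\<close> the mixed terms u v cancel, leaving (u^2 + v^2) Re(z_i
    cnj z_j).\<close>
  let ?p = "\<lambda>i. u * Re (z i) + v * Im (z i)" and ?q = "\<lambda>i. v * Re (z i) - u * Im (z i)"
  have "u * Re (?S \<omega>) + v * Im (?S \<omega>)
      = (\<Sum>i\<in>I. ?p i * X (x i) \<omega>) + (\<Sum>i\<in>I. ?q i * Y (x i) \<omega>)" for \<omega>
    by (simp add: H_def sum_distrib_left algebra_simps flip: sum.distrib sum_subtractf)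
  then have "(\<integral>\<omega>. iexp (u * Re (?S \<omega>) + v * Im (?S \<omega>)) \<partial>M)
      = complex_of_real (exp (- (\<Sum>i\<in>I. \<Sum>j\<in>I. (?p i * ?p j + ?q i * ?q j) * R (x i) (x j)) / 2))"
    using centered_linear_combination[OF assms, of ?p x ?q] by simp
  also have "(\<Sum>i\<in>I. \<Sum>j\<in>I. (?p i * ?p j + ?q i * ?q j) * R (x i) (x j))
      = (u\<^sup>2 + v\<^sup>2) * (l2_norm M ?S)\<^sup>2 / 2"
    unfolding norm sum_distrib_left sum_divide_distrib
    by (intro sum.cong refl) (simp add: power2_eq_square algebra_simps)
  also have "- ((u\<^sup>2 + v\<^sup>2) * (l2_norm M ?S)\<^sup>2 / 2) / 2 = - (u\<^sup>2 + v\<^sup>2) * (l2_norm M ?S)\<^sup>2 / 4"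
    by (simp add: algebra_simps)
  finally show "(\<integral>\<omega>. iexp (u * Re (?S \<omega>) + v * Im (?S \<omega>)) \<partial>M)
      = complex_of_real (exp (- (u\<^sup>2 + v\<^sup>2) * (l2_norm M ?S)\<^sup>2 / 4))" .
qed

end

lemma eventually_at_bot_times_at_top: "\<forall>\<^sub>F (s :: real, t :: real) in at_bot \<times>\<^sub>F at_top. s \<le> 0 \<and> 0 \<le> t"
  using eventually_prodI[OF eventually_le_at_bot[of "0::real"] eventually_ge_at_top[of "0::real"]]
  by (simp add: case_prod_unfold)

lemma at_bot_times_at_top_neq_bot: "at_bot \<times>\<^sub>F at_top \<noteq> (bot :: (real \<times> real) filter)"
  by (simp add: prod_filter_eq_bot)

section \<open>The Fourier integral of the channel: existence, law, variance, continuity in the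
  frequency\<close>

context attenuated_OU
begin

definition wave :: "real \<Rightarrow> real \<Rightarrow> complex"
  where "wave f \<tau> = exp (- \<i> * complex_of_real (2 * pi * f * \<tau>))"

lemma wave_eq_cis: "wave f \<tau> = cis (- (2 * pi * f * \<tau>))"
  by (simp add: wave_def cis_conv_exp)

lemma norm_wave [simp]: "cmod (wave f \<tau>) = 1"
  by (simp add: wave_eq_cis)

lemma norm_wave_diff_le: "cmod (wave f \<tau> - wave g \<tau>) \<le> 2 * pi * \<bar>f - g\<bar> * \<bar>\<tau>\<bar>"
proof -
  have "cmod (wave f \<tau> - wave g \<tau>) \<le> \<bar>- (2 * pi * f * \<tau>) - - (2 * pi * g * \<tau>)\<bar>"
    unfolding wave_eq_cis cis_conv_exp by (rule norm_iexp_diff_le)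
  also have "- (2 * pi * f * \<tau>) - - (2 * pi * g * \<tau>) = - (2 * pi * ((f - g) * \<tau>))"
    by (simp add: algebra_simps)
  also have "\<bar>\<dots>\<bar> = 2 * pi * \<bar>f - g\<bar> * \<bar>\<tau>\<bar>"
    by (simp add: abs_mult mult.assoc)
  finally show ?thesis .
qed

lemma R_nonneg: "0 \<le> x \<Longrightarrow> 0 \<le> y \<Longrightarrow> R x y = b * c * (exp (- a * \<bar>x - y\<bar>) * exp (- b * (x + y)))"
  by (simp add: OU_covariance_def)

lemma R_negative: "x < 0 \<or> y < 0 \<Longrightarrow> R x y = 0"
  by (auto simp: OU_covariance_def)

lemma integral_inner_wave:
  "(\<integral>\<omega>. (wave f x * H x \<omega>) \<bullet> (wave f y * H y \<omega>) \<partial>M) = 2 * R x y * cos (2 * pi * f * (x - y))"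
proof -
  have "wave f x * cnj (wave f y) = cis (- (2 * pi * f * (x - y)))"
    by (simp add: wave_eq_cis cis_cnj cis_mult algebra_simps)
  then show ?thesis unfolding integral_inner_H by simp
qed

lemma l2_norm_H_eq:
  "l2_norm M (\<lambda>\<omega>. z * H x \<omega>) = cmod z * (if x \<in> {0..} then sqrt (2 * b * c) * exp (- b * x) else 0)"
proof (cases "x \<ge> 0")
  case True
  have "2 * R x x = 2 * b * c * (exp (- b * x))\<^sup>2"
    using True by (simp add: R_nonneg power2_eq_square algebra_simps flip: exp_add)
  then show ?thesis unfolding l2_norm_H using True by (simp add: real_sqrt_mult)
next
  case False
  then show ?thesis unfolding l2_norm_H by (simp add: R_negative)
qed

text \<open>The process is null before 0 and has a continuous covariance from 0 on, so 0 is the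
  exceptional point of the existence criterion.\<close>

lemma has_ms_integral_wave_exists:
  assumes "s \<le> t"
  shows "\<exists>I. has_ms_integral M (\<lambda>\<tau> \<omega>. wave f \<tau> * H \<tau> \<omega>) s t I"
proof (rule has_ms_integral_exists[OF assms second_order_H, where ?x0.0 = 0])
  fix x
  show "l2_norm M (\<lambda>\<omega>. wave f x * H x \<omega>) \<le> sqrt (2 * b * c)"
    unfolding l2_norm_H_eq using pos by (simp add: mult_left_le)
next
  fix \<epsilon> :: real assume "\<epsilon> > 0"
  \<comment> \<open>The mean squared increment for nonnegative times, without indicators: continuous
    on the plane and 0 on the diagonal, so uniform continuity on a compact square gives the
    modulus.\<close>
  define g where "g p = 2 * b * c * (exp (- b * (fst p + fst p)) + exp (- b * (snd p + snd p))
      - 2 * (exp (- a * \<bar>fst p - snd p\<bar>) * exp (- b * (fst p + snd p)) * cos (2 * pi * f * (fst p - snd p))))"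
    for p :: "real \<times> real"
  have diff: "(l2_norm M (\<lambda>\<omega>. wave f x * H x \<omega> - wave f y * H y \<omega>))\<^sup>2
      = 2 * R x x + 2 * R y y - 4 * R x y * cos (2 * pi * f * (x - y))" for x y
  proof -
    have "(l2_norm M (\<lambda>\<omega>. wave f x * H x \<omega> + - wave f y * H y \<omega>))\<^sup>2
        = 2 * R x x + 2 * R y y - 4 * R x y * cos (2 * pi * f * (x - y))"
      unfolding l2_norm_add_power2[OF second_order_H second_order_H] l2_norm_H
      using integral_inner_wave[of f x y]
      by (simp add: power_mult_distrib OU_covariance_def pos less_imp_le mult_nonneg_nonneg zero_le_mult_iff)
    then show ?thesis by simp
  qed
  have "uniformly_continuous_on ({0..\<bar>t\<bar>} \<times> {0..\<bar>t\<bar>}) g"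
    unfolding g_def by (intro compact_uniformly_continuous continuous_intros compact_Times compact_Icc)
  then obtain d where d: "d > 0" "\<And>p q. p \<in> {0..\<bar>t\<bar>} \<times> {0..\<bar>t\<bar>} \<Longrightarrow> q \<in> {0..\<bar>t\<bar>} \<times> {0..\<bar>t\<bar>} \<Longrightarrow>
      dist q p < d \<Longrightarrow> dist (g q) (g p) < \<epsilon>\<^sup>2"
    using \<open>\<epsilon> > 0\<close> unfolding uniformly_continuous_on_def by (metis zero_less_power)
  have "l2_norm M (\<lambda>\<omega>. wave f x * H x \<omega> - wave f y * H y \<omega>) \<le> \<epsilon>"
    if xy: "x \<in> {s..t}" "y \<in> {s..t}" "\<bar>x - y\<bar> < d" "x < 0 \<longleftrightarrow> y < 0" for x y
  proof (rule power2_le_imp_le)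
    show "(l2_norm M (\<lambda>\<omega>. wave f x * H x \<omega> - wave f y * H y \<omega>))\<^sup>2 \<le> \<epsilon>\<^sup>2"
    proof (cases "x < 0")
      case True
      then show ?thesis using xy(4) unfolding diff by (simp add: R_negative)
    next
      case False
      then have xy0: "x \<ge> 0" "y \<ge> 0" using xy(4) by auto
      have "dist (g (x, y)) (g (x, x)) < \<epsilon>\<^sup>2"
        using xy xy0 by (intro d(2)) (auto simp: dist_Pair_Pair dist_real_def abs_minus_commute)
      moreover have "g (x, x) = 0" by (simp add: g_def)
      moreover have "g (x, y) = 2 * R x x + 2 * R y y - 4 * R x y * cos (2 * pi * f * (x - y))"
        using xy0 by (simp add: g_def R_nonneg algebra_simps)
      ultimately show ?thesis unfolding diff by (simp add: dist_real_def)
    qed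
  qed (use \<open>\<epsilon> > 0\<close> in simp)
  then show "\<exists>\<delta>>0. \<forall>x\<in>{s..t}. \<forall>y\<in>{s..t}. \<bar>x - y\<bar> < \<delta> \<longrightarrow> (x < 0) = (y < 0) \<longrightarrow>
      l2_norm M (\<lambda>\<omega>. wave f x * H x \<omega> - wave f y * H y \<omega>) \<le> \<epsilon>"
    using d(1) by blast
qed

lemma has_ms_integral_real_line_wave_exists:
  "\<exists>I. has_ms_integral_real_line M (\<lambda>\<tau> \<omega>. wave f \<tau> * H \<tau> \<omega>) I"
proof (rule has_ms_integral_real_line_exists[OF second_order_H has_ms_integral_wave_exists])
  let ?C = "sqrt (2 * b * c)"
  let ?G = "\<lambda>x. - ?C / b * exp (- b * max x 0)"
  show "l2_norm M (\<lambda>\<omega>. wave f x * H x \<omega>) \<le> (if x \<in> {0..} then ?C * exp (- b * x) else 0)" for x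
    unfolding l2_norm_H_eq by simp
  show "((\<lambda>x. if x \<in> {0..} then ?C * exp (- b * x) else 0) has_integral ?G t - ?G s) {s..t}" if "s \<le> t" for s t
    using has_integral_exp_max[OF pos(2) that] .
  have "\<forall>\<^sub>F x in at_bot. ?G x = - ?C / b"
    using eventually_le_at_bot[of 0] by eventually_elim simp
  then show "(?G \<longlongrightarrow> - ?C / b) at_bot" by (rule tendsto_eventually)
  have "((\<lambda>x. - ?C / b * exp (- b * x)) \<longlongrightarrow> 0) at_top"
    using pos by real_asymp
  moreover have "\<forall>\<^sub>F x in at_top. - ?C / b * exp (- b * x) = ?G x"
    using eventually_ge_at_top[of 0] by eventually_elim simp
  ultimately show "(?G \<longlongrightarrow> 0) at_top" by (rule Lim_transform_eventually)
qed

text \<open>Two limits are passed, from Riemann sums to finite intervals and then to the line.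
  \<open>Z\<close> is any version of the integral, so the result covers the one chosen in
  \<open>channel_spectrum\<close>.\<close>

lemma proper_gaussian_spectrum:
  assumes "has_ms_integral_real_line M (\<lambda>\<tau> \<omega>. wave f \<tau> * H \<tau> \<omega>) Z"
  shows "proper_gaussian M Z"
proof -
  obtain J where J: "\<And>s t. s \<le> t \<Longrightarrow> has_ms_integral M (\<lambda>\<tau> \<omega>. wave f \<tau> * H \<tau> \<omega>) s t (J s t)"
    and lim: "ms_tendsto M (\<lambda>(s, t). J s t) Z (at_bot \<times>\<^sub>F at_top)"
    using assms unfolding has_ms_integral_real_line_def by blast
  have "proper_gaussian M (J s t)" if "s \<le> t" for s t
  proof (rule proper_gaussian_ms_tendsto[OF riemann_filter_neq_bot J[OF that, unfolded has_ms_integral_def]])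
    have "proper_gaussian M (\<lambda>\<omega>. \<Sum>(x, K)\<in>p. measure lborel K *\<^sub>R (wave f x * H x \<omega>))"
      if "p tagged_division_of {s..t}" for p
      using proper_gaussian_sum_H[OF tagged_division_of_finite[OF that],
          of "\<lambda>k. of_real (measure lborel (snd k)) * wave f (fst k)" fst]
      by (simp add: case_prod_unfold scaleR_conv_of_real mult.assoc)
    then show "\<forall>\<^sub>F p in riemann_filter s t.
        proper_gaussian M (\<lambda>\<omega>. \<Sum>(x, K)\<in>p. measure lborel K *\<^sub>R (wave f x * H x \<omega>))"
      unfolding eventually_riemann_filter by (auto intro: exI[of _ 1])
  qed
  then have "\<forall>\<^sub>F i in at_bot \<times>\<^sub>F at_top. proper_gaussian M (case i of (s, t) \<Rightarrow> J s t)"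
    using eventually_at_bot_times_at_top by (auto elim!: eventually_mono)
  with at_bot_times_at_top_neq_bot lim show ?thesis by (rule proper_gaussian_ms_tendsto)
qed

text \<open>The pairing is applied twice, with the process at time y and then with the integral
  itself. The second moment becomes an iterated integral of the covariance over [0, t], whose limit
  is known.\<close>

lemma l2_norm_spectrum:
  assumes "has_ms_integral_real_line M (\<lambda>\<tau> \<omega>. wave f \<tau> * H \<tau> \<omega>) Z"
  shows "(l2_norm M Z)\<^sup>2 = 2 * OU_spectral_variance a b c f"
proof -
  let ?E = "\<lambda>\<tau> \<omega>. wave f \<tau> * H \<tau> \<omega>"
  let ?k = "\<lambda>x y. exp (- a * \<bar>x - y\<bar>) * exp (- b * (x + y)) * cos (2 * pi * f * (x - y))"
  obtain J where J: "\<And>s t. s \<le> t \<Longrightarrow> has_ms_integral M ?E s t (J s t)"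
    and lim: "ms_tendsto M (\<lambda>(s, t). J s t) Z (at_bot \<times>\<^sub>F at_top)"
    using assms unfolding has_ms_integral_real_line_def by blast
  obtain D where D: "\<And>t. 0 \<le> t \<Longrightarrow> \<exists>F. (\<forall>y\<in>{0..t}. ((\<lambda>x. ?k x y) has_integral F y) {0..t}) \<and> (F has_integral D t) {0..t}"
    and D_lim: "(D \<longlongrightarrow> (a + b) / (b * ((a + b)\<^sup>2 + (2 * pi * f)\<^sup>2))) at_top"
    using OU_kernel_double_integral[OF pos(1,2), of "2 * pi * f"] by blast
  have "(l2_norm M (J s t))\<^sup>2 = 2 * b * c * D t" if st: "s \<le> 0" "0 \<le> t" for s t
  proof -
    have "s \<le> t" and cut: "{0..} \<inter> {s..t} = {0..t}" using st by auto
    note J' = J[OF \<open>s \<le> t\<close>]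
    have so: "second_order M (J s t)"
      using J' by (auto simp: has_ms_integral_def dest: ms_tendstoD)
    obtain F where F: "\<And>y. y \<in> {0..t} \<Longrightarrow> ((\<lambda>x. ?k x y) has_integral F y) {0..t}" "(F has_integral D t) {0..t}"
      using D[OF st(2)] by blast
    have inner: "(\<integral>\<omega>. ?E y \<omega> \<bullet> J s t \<omega> \<partial>M) = (if y \<in> {0..} then 2 * b * c * F y else 0)" if y: "y \<in> {s..t}" for y
    proof -
      have 1: "((\<lambda>x. 2 * R x y * cos (2 * pi * f * (x - y))) has_integral (\<integral>\<omega>. J s t \<omega> \<bullet> ?E y \<omega> \<partial>M)) {s..t}"
        using has_ms_integral_imp_has_integral_inner[OF second_order_H J' second_order_H[of "wave f y" y]]
        unfolding integral_inner_wave .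
      have 2: "((\<lambda>x. 2 * R x y * cos (2 * pi * f * (x - y))) has_integral
          (if y \<in> {0..} then 2 * b * c * F y else 0)) {s..t}"
      proof (cases "y \<ge> 0")
        case True
        then have "((\<lambda>x. if x \<in> {0..} then 2 * b * c * ?k x y else 0) has_integral 2 * b * c * F y) {s..t}"
          unfolding has_integral_restrict_Int cut using F(1)[of y] y by (intro has_integral_mult_right) auto
        moreover have "(\<lambda>x. if x \<in> {0..} then 2 * b * c * ?k x y else 0) = (\<lambda>x. 2 * R x y * cos (2 * pi * f * (x - y)))"
          using True by (auto simp: R_nonneg R_negative fun_eq_iff)
        ultimately show ?thesis using True by simp
      next
        case False
        then show ?thesis by (simp add: R_negative)
      qed
      show ?thesis using has_integral_unique[OF 1 2] by (simp add: inner_commute)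
    qed
    have "((\<lambda>y. \<integral>\<omega>. ?E y \<omega> \<bullet> J s t \<omega> \<partial>M) has_integral (\<integral>\<omega>. J s t \<omega> \<bullet> J s t \<omega> \<partial>M)) {s..t}"
      by (rule has_ms_integral_imp_has_integral_inner[OF second_order_H J' so])
    then have 1: "((\<lambda>y. if y \<in> {0..} then 2 * b * c * F y else 0) has_integral (l2_norm M (J s t))\<^sup>2) {s..t}"
      unfolding l2_norm_power2 power2_norm_eq_inner by (rule has_integral_eq[rotated]) (rule inner)
    have 2: "((\<lambda>y. if y \<in> {0..} then 2 * b * c * F y else 0) has_integral 2 * b * c * D t) {s..t}"
      unfolding has_integral_restrict_Int cut by (rule has_integral_mult_right[OF F(2)])
    show ?thesis by (rule has_integral_unique[OF 1 2])
  qed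
  then have "\<forall>\<^sub>F i in at_bot \<times>\<^sub>F at_top. (l2_norm M (case i of (s, t) \<Rightarrow> J s t))\<^sup>2 = 2 * b * c * D (snd i)"
    using eventually_at_bot_times_at_top by (auto elim!: eventually_mono)
  moreover have "((\<lambda>i. 2 * b * c * D (snd i)) \<longlongrightarrow>
      2 * b * c * ((a + b) / (b * ((a + b)\<^sup>2 + (2 * pi * f)\<^sup>2)))) (at_bot \<times>\<^sub>F at_top :: (real \<times> real) filter)"
    by (intro tendsto_mult_left filterlim_compose[OF D_lim filterlim_snd])
  ultimately have "((\<lambda>i. (l2_norm M (case i of (s, t) \<Rightarrow> J s t))\<^sup>2) \<longlongrightarrow>
      2 * b * c * ((a + b) / (b * ((a + b)\<^sup>2 + (2 * pi * f)\<^sup>2)))) (at_bot \<times>\<^sub>F at_top)"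
    by (subst tendsto_cong)
  from tendsto_unique[OF at_bot_times_at_top_neq_bot tendsto_power[OF tendsto_l2_norm[OF lim]] this]
  show ?thesis using pos by (simp add: OU_spectral_variance_def)
qed

text \<open>The Fourier kernels at time x differ by at most 2 pi |f - g| |x|, and the channel has
  norm \<open>sqrt (2 * b * c) * exp (- b * x)\<close> there for x \<ge> 0; integrating x e^(-bx)
  contributes 1/b^2.\<close>

lemma l2_norm_spectrum_diff_le:
  assumes "has_ms_integral_real_line M (\<lambda>\<tau> \<omega>. wave f \<tau> * H \<tau> \<omega>) Z"
    and "has_ms_integral_real_line M (\<lambda>\<tau> \<omega>. wave g \<tau> * H \<tau> \<omega>) Z'"
  shows "l2_norm M (\<lambda>\<omega>. Z \<omega> - Z' \<omega>) \<le> 2 * pi * sqrt (2 * b * c) / b\<^sup>2 * \<bar>f - g\<bar>"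
proof -
  obtain J where J: "\<And>s t. s \<le> t \<Longrightarrow> has_ms_integral M (\<lambda>\<tau> \<omega>. wave f \<tau> * H \<tau> \<omega>) s t (J s t)"
    and J_lim: "ms_tendsto M (\<lambda>(s, t). J s t) Z (at_bot \<times>\<^sub>F at_top)"
    using assms(1) unfolding has_ms_integral_real_line_def by blast
  obtain J' where J': "\<And>s t. s \<le> t \<Longrightarrow> has_ms_integral M (\<lambda>\<tau> \<omega>. wave g \<tau> * H \<tau> \<omega>) s t (J' s t)"
    and J'_lim: "ms_tendsto M (\<lambda>(s, t). J' s t) Z' (at_bot \<times>\<^sub>F at_top)"
    using assms(2) unfolding has_ms_integral_real_line_def by blast
  let ?C = "2 * pi * \<bar>f - g\<bar> * sqrt (2 * b * c)"
  have "0 \<le> ?C" using pos by simp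
  have bound: "l2_norm M (\<lambda>\<omega>. J s t \<omega> - J' s t \<omega>) \<le> 2 * pi * sqrt (2 * b * c) / b\<^sup>2 * \<bar>f - g\<bar>"
    if st: "s \<le> 0" "0 \<le> t" for s t
  proof -
    have "s \<le> t" and cut: "{0..} \<inter> {s..t} = {0..t}" using st by auto
    obtain A where A: "((\<lambda>x. x * exp (- b * x)) has_integral A) {0..t}" "A \<le> 1 / b\<^sup>2"
      using has_integral_mult_exp_bound[OF pos(2) st(2)] .
    have "has_ms_integral M (\<lambda>\<tau> \<omega>. (wave f \<tau> - wave g \<tau>) * H \<tau> \<omega>) s t (\<lambda>\<omega>. J s t \<omega> - J' s t \<omega>)"
      using has_ms_integral_diff[OF J[OF \<open>s \<le> t\<close>] J'[OF \<open>s \<le> t\<close>]] by (simp add: left_diff_distrib)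
    then have "l2_norm M (\<lambda>\<omega>. J s t \<omega> - J' s t \<omega>) \<le> ?C * A"
    proof (rule has_ms_integral_l2_norm_le[OF second_order_H])
      show "((\<lambda>x. if x \<in> {0..} then ?C * (x * exp (- b * x)) else 0) has_integral ?C * A) {s..t}"
        unfolding has_integral_restrict_Int cut by (rule has_integral_mult_right[OF A(1)])
      fix x
      show "l2_norm M (\<lambda>\<omega>. (wave f x - wave g x) * H x \<omega>) \<le> (if x \<in> {0..} then ?C * (x * exp (- b * x)) else 0)"
      proof (cases "x \<ge> 0")
        case True
        have "cmod (wave f x - wave g x) * (sqrt (2 * b * c) * exp (- b * x))
            \<le> 2 * pi * \<bar>f - g\<bar> * \<bar>x\<bar> * (sqrt (2 * b * c) * exp (- b * x))"
          using pos by (intro mult_right_mono norm_wave_diff_le) auto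
        then show ?thesis unfolding l2_norm_H_eq using True by (simp add: mult_ac)
      qed (simp add: l2_norm_H_eq)
    qed
    also have "\<dots> \<le> ?C * (1 / b\<^sup>2)" using A(2) \<open>0 \<le> ?C\<close> by (rule mult_left_mono)
    finally show ?thesis by (simp add: mult_ac)
  qed
  have "((\<lambda>i. l2_norm M (\<lambda>\<omega>. (case i of (s, t) \<Rightarrow> J s t) \<omega> - (case i of (s, t) \<Rightarrow> J' s t) \<omega>))
      \<longlongrightarrow> l2_norm M (\<lambda>\<omega>. Z \<omega> - Z' \<omega>)) (at_bot \<times>\<^sub>F at_top)"
    by (rule tendsto_l2_norm[OF ms_tendsto_diff[OF J_lim J'_lim]])
  then show ?thesis
  proof (rule tendsto_upperbound)
    show "\<forall>\<^sub>F i in at_bot \<times>\<^sub>F at_top. l2_norm M (\<lambda>\<omega>. (case i of (s, t) \<Rightarrow> J s t) \<omega> - (case i of (s, t) \<Rightarrow> J' s t) \<omega>)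
        \<le> 2 * pi * sqrt (2 * b * c) / b\<^sup>2 * \<bar>f - g\<bar>"
      using eventually_at_bot_times_at_top bound by (auto elim!: eventually_mono)
  qed (rule at_bot_times_at_top_neq_bot)
qed

end

section \<open>Ergodic capacity\<close>

text \<open>Isolates what the capacity needs from the channel: the law at each single frequency, its
  second moment, and mean-square continuity. Dependence between frequencies does not enter the
  bounds, because the expectation of the frequency integral is the integral of expectations.\<close>

lemma (in prob_space) ergodic_capacity_between:
  fixes H :: "real \<Rightarrow> 'a \<Rightarrow> complex"
  defines "Z \<equiv> channel_spectrum M H"
  assumes Z: "\<And>f. proper_gaussian M (Z f)"
    and lipschitz: "\<And>f g. l2_norm M (\<lambda>\<omega>. Z f \<omega> - Z g \<omega>) \<le> C * \<bar>f - g\<bar>"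
    and v: "\<And>f. (l2_norm M (Z f))\<^sup>2 = 2 * OU_spectral_variance a b c f"
    and pos: "a > 0" "b > 0" "c > 0" "\<alpha> > 0" "W > 0"
  shows "OU_capacity_bound a b c \<alpha> W euler_mascheroni \<le> ergodic_capacity M H \<alpha> W"
    and "ergodic_capacity M H \<alpha> W \<le> OU_capacity_bound a b c \<alpha> W 0"
proof -
  define L where "L f \<omega> = log 2 (1 + \<alpha> * (cmod (Z f \<omega>))\<^sup>2)" for f \<omega>
  define k where "k = sqrt \<alpha> / ln 2"
  have "k \<ge> 0" using pos by (simp add: k_def)
  have Z_so: "second_order M (Z f)" for f using Z by (simp add: proper_gaussian_def)
  note [measurable] = second_orderD(1)[OF Z_so]
  have [measurable]: "L f \<in> borel_measurable M" for f unfolding L_def by measurable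
  have L_lip: "\<bar>log 2 (1 + \<alpha> * (cmod z)\<^sup>2) - log 2 (1 + \<alpha> * (cmod w)\<^sup>2)\<bar> \<le> k * cmod (z - w)" for z w
  proof -
    have sq: "\<alpha> * r\<^sup>2 = (sqrt \<alpha> * r)\<^sup>2" for r :: real using pos by (simp add: power_mult_distrib)
    have "\<bar>ln (1 + \<alpha> * (cmod z)\<^sup>2) - ln (1 + \<alpha> * (cmod w)\<^sup>2)\<bar> \<le> \<bar>sqrt \<alpha> * cmod z - sqrt \<alpha> * cmod w\<bar>"
      unfolding sq by (rule ln_one_plus_square_diff_le)
    also have "\<dots> = sqrt \<alpha> * \<bar>cmod z - cmod w\<bar>"
      using pos by (simp add: abs_mult flip: right_diff_distrib)
    also have "\<dots> \<le> sqrt \<alpha> * cmod (z - w)"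
      using norm_triangle_ineq3[of z w] pos by (intro mult_left_mono) auto
    finally have "\<bar>ln (1 + \<alpha> * (cmod z)\<^sup>2) - ln (1 + \<alpha> * (cmod w)\<^sup>2)\<bar> / ln 2 \<le> sqrt \<alpha> * cmod (z - w) / ln 2"
      by (intro divide_right_mono) auto
    then show ?thesis by (simp add: log_def k_def flip: diff_divide_distrib)
  qed
  \<comment> \<open>Comparison with amplitude 0, where the logarithm vanishes, gives linear growth
    in the amplitude.\<close>
  have L_so: "second_order M (L f)" for f
    using L_lip[of "Z f _" 0] by (intro second_order_dominated[OF Z_so[of f], where C = k]) (auto simp: L_def)
  have L_cont: "l2_norm M (\<lambda>\<omega>. L f \<omega> - L g \<omega>) \<le> k * C * \<bar>f - g\<bar>" for f g
  proof -
    have "l2_norm M (\<lambda>\<omega>. L f \<omega> - L g \<omega>) \<le> k * l2_norm M (\<lambda>\<omega>. Z f \<omega> - Z g \<omega>)"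
      using L_lip by (intro l2_norm_le_mult second_order_diff Z_so \<open>k \<ge> 0\<close>) (auto simp: L_def)
    also have "\<dots> \<le> k * (C * \<bar>f - g\<bar>)" by (intro mult_left_mono lipschitz \<open>k \<ge> 0\<close>)
    finally show ?thesis by (simp add: mult.assoc)
  qed
  have "C \<ge> 0" using order_trans[OF l2_norm_nonneg lipschitz[of 1 0]] by simp
  have "\<exists>I. has_ms_integral M L (- W / 2) (W / 2) I"
  \<comment> \<open>There is no jump here; the left endpoint as exceptional point makes the side
    condition trivial.\<close>
  proof (rule has_ms_integral_exists[where ?x0.0 = "- W / 2" and B = "l2_norm M (L 0) + k * C * (W / 2)"])
    fix x assume "x \<in> {- W / 2..W / 2}"
    then have "k * C * \<bar>x\<bar> \<le> k * C * (W / 2)"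
      using \<open>k \<ge> 0\<close> \<open>C \<ge> 0\<close> by (intro mult_left_mono) auto
    then show "l2_norm M (L x) \<le> l2_norm M (L 0) + k * C * (W / 2)"
      using L_cont[of x 0] l2_norm_triangle[OF second_order_diff[OF L_so L_so] L_so, of x 0 0] by simp
  next
    fix \<epsilon> :: real assume "\<epsilon> > 0"
    show "\<exists>\<delta>>0. \<forall>x\<in>{- W / 2..W / 2}. \<forall>y\<in>{- W / 2..W / 2}. \<bar>x - y\<bar> < \<delta> \<longrightarrow> (x < - W / 2) = (y < - W / 2)
        \<longrightarrow> l2_norm M (\<lambda>\<omega>. L x \<omega> - L y \<omega>) \<le> \<epsilon>"
    proof (intro exI[of _ "\<epsilon> / (k * C + 1)"] conjI ballI impI)
      have pos1: "k * C + 1 > 0" using \<open>k \<ge> 0\<close> \<open>C \<ge> 0\<close> by (simp add: add_nonneg_pos)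
      then show "\<epsilon> / (k * C + 1) > 0" using \<open>\<epsilon> > 0\<close> by simp
      fix x y :: real assume "\<bar>x - y\<bar> < \<epsilon> / (k * C + 1)"
      then have "(k * C + 1) * \<bar>x - y\<bar> \<le> \<epsilon>" using pos1 by (simp add: field_simps)
      then show "l2_norm M (\<lambda>\<omega>. L x \<omega> - L y \<omega>) \<le> \<epsilon>"
        using L_cont[of x y] by (simp add: distrib_right)
    qed
  qed (use L_so pos in auto)
  then have I: "has_ms_integral M L (- W / 2) (W / 2) (ms_integral M L (- W / 2) (W / 2))"
    unfolding ms_integral_def by (rule someI_ex)
  have cap: "ergodic_capacity M H \<alpha> W = (\<integral>\<omega>. ms_integral M L (- W / 2) (W / 2) \<omega> \<partial>M)"
    unfolding ergodic_capacity_def L_def Z_def ..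
  \<comment> \<open>Pairing with the constant 1 turns the mean-square integral into its
    expectation.\<close>
  have one: "second_order M (\<lambda>_. 1 :: real)" by (intro second_orderI) auto
  have C_int: "((\<lambda>f. \<integral>\<omega>. L f \<omega> \<partial>M) has_integral ergodic_capacity M H \<alpha> W) {- W / 2..W / 2}"
    using has_ms_integral_imp_has_integral_inner[OF L_so I one] by (simp add: cap)
  have \<sigma>: "OU_spectral_variance a b c f > 0" for f
    using pos by (simp add: OU_spectral_variance_def add_pos_nonneg)
  have EL: "(\<integral>\<omega>. L f \<omega> \<partial>M) = (\<integral>\<omega>. ln (1 + \<alpha> * (cmod (Z f \<omega>))\<^sup>2) \<partial>M) / ln 2" for f
    by (simp add: L_def log_def)
  note bounds = integral_ln_proper_gaussian[OF Z pos(4) v]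
  have "log 2 (1 + 2 * exp (- euler_mascheroni) * \<alpha> * OU_spectral_variance a b c f) \<le> (\<integral>\<omega>. L f \<omega> \<partial>M)" for f
    using bounds(1)[of f] \<sigma>[of f] unfolding EL log_def by (intro divide_right_mono) (simp_all add: mult_ac)
  then show "OU_capacity_bound a b c \<alpha> W euler_mascheroni \<le> ergodic_capacity M H \<alpha> W"
    by (rule has_integral_le[OF has_integral_log_one_plus_OU_spectral_variance[OF pos] C_int])
  have "(\<integral>\<omega>. L f \<omega> \<partial>M) \<le> log 2 (1 + 2 * exp (- 0) * \<alpha> * OU_spectral_variance a b c f)" for f
    using bounds(2)[of f] \<sigma>[of f] unfolding EL log_def by (intro divide_right_mono) (simp_all add: mult_ac)
  then show "ergodic_capacity M H \<alpha> W \<le> OU_capacity_bound a b c \<alpha> W 0"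
    by (rule has_integral_le[OF C_int has_integral_log_one_plus_OU_spectral_variance[OF pos]])
qed

theorem mainTheorem4:
  fixes M :: "'a measure" and H :: "real \<Rightarrow> 'a \<Rightarrow> complex" and a b c \<alpha> W :: real
  assumes "prob_space M"
    and "a > 0" and "b > 0" and "c > 0" and "\<alpha> > 0" and "W > 0"
    and "OU_channel M a b c H"
  shows "OU_capacity_bound a b c \<alpha> W euler_mascheroni \<le> ergodic_capacity M H \<alpha> W
       \<and> ergodic_capacity M H \<alpha> W \<le> OU_capacity_bound a b c \<alpha> W 0"
proof -
  obtain X Y where "attenuated_OU M X Y a b c"
    and H: "H = (\<lambda>\<tau> \<omega>. complex_of_real (X \<tau> \<omega>) + \<i> * complex_of_real (Y \<tau> \<omega>))"
    using assms unfolding OU_channel_def attenuated_OU_def attenuated_OU_axioms_def by blast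
  interpret OU: attenuated_OU M X Y a b c by fact
  have H_eq: "H = OU.H" by (simp add: H OU.H_def fun_eq_iff)
  \<comment> \<open>Existence of some integral guarantees that the representative chosen by
    \<open>SOME\<close> is one, at every frequency.\<close>
  have Z: "has_ms_integral_real_line M (\<lambda>\<tau> \<omega>. OU.wave f \<tau> * OU.H \<tau> \<omega>) (channel_spectrum M H f)" for f
    unfolding channel_spectrum_def H_eq ms_integral_real_line_def OU.wave_def[symmetric]
    using OU.has_ms_integral_real_line_wave_exists by (rule someI_ex)
  show ?thesis
    using OU.ergodic_capacity_between[OF OU.proper_gaussian_spectrum[OF Z]
        OU.l2_norm_spectrum_diff_le[OF Z Z] OU.l2_norm_spectrum[OF Z] assms(2-6)] by blast
qed

end
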